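(* Let $W$ be the Weyl group of type $D_n$, $n\ge 4$, with Coxeter number $h=2(n-1)$. Then there exists an admissible hsop $\Theta$ such that the subvariety $V^\Theta\subset V$ consists of $(h+1)^n$ distinct points and there is a $W\times C$-equivariant bijection between $V^\Theta$ and $\mathsf{Park}^{NC}_W$.
   Context: $W$ is the group of $n\times n$ signed permutation matrices with an even number of entries equal to $-1$, acting on $V=\mathbb{R}^n$; we also write $V$ for the complexification $\mathbb{C}^n$. $T\subset W$ is the set of reflections. Fix simple reflections and let $c$ be a Coxeter element (product of the simple reflections in some order); $h$ is its order, $C=\langle c\rangle$, $\omega=e^{2\pi i/h}$. Noncrossing parking functions: $\mathcal{L}$ is the set of all intersections (flats) of reflecting hyperplanes of $W$ (including $V$). For $X\in\mathcal{L}$, $W_X$ is the pointwise stabilizer of $X$. Let $\ell_T(w)$ be the least $k$ such that $w$ is a product of $k$ reflections, and write $u\le_T v$ iff $\ell_T(v)=\ell_T(u)+\ell_T(u^{-1}v)$. $NC(W)=\{w\in W:w\le_T c\}$, identified via the injection $w\mapsto V^w$ with a set of flats (noncrossing flats). $\mathsf{Park}^{NC}_W$ is the set of classes $[w,X]$ with $w\in W$, $X\in NC(W)$, where $[w,X]=[w',X']$ iff $X=X'$ and $wW_X=w'W_X$. $W\times C$ acts by $(v,c^d).[w,X]=[vwc^{-d},c^d(X)]$. Hsops: $\mathbb{C}[V]=\mathbb{C}[x_1,\dots,x_n]$ with $x_1,\dots,x_n$ a basis of $V^*$. An admissible hsop is a homogeneous system of parameters $\Theta=(\theta_1,\dots,\theta_n)$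 in $\mathbb{C}[V]$ with all $\theta_i$ of degree $h+1$ such that the linear isomorphism $V^*\to\mathbb{C}\theta_1+\cdots+\mathbb{C}\theta_n$, $x_i\mapsto\theta_i$, is $W$-equivariant. $V^\Theta\subset V=\mathbb{C}^n$ is the zero locus of the ideal $(\theta_1-x_1,\dots,\theta_n-x_n)$; $W$ acts on it by restriction of its linear action on $V$, and $c^d\in C$ acts by scaling by $\omega^d$. *)

theory Defs
  imports "HOL-Analysis.Analysis" "HOL-Library.Poly_Mapping"
begin

section \<open>Real reflection groups as sets of matrices\<close>

(* On real^'n^'n the class operations * and ^ are componentwise, hence the
   separate products and powers with respect to **. *)

definition mat_prod :: "(real^'n^'n) list \<Rightarrow> real^'n^'n" where
  "mat_prod ws = foldr (**) ws (mat 1)"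

definition mat_power :: "real^'n^'n \<Rightarrow> nat \<Rightarrow> real^'n^'n" where
  "mat_power w d = mat_prod (replicate d w)"

definition mat_order :: "real^'n^'n \<Rightarrow> nat" where
  "mat_order w = (LEAST k. 0 < k \<and> mat_power w k = mat 1)"

definition reflection_along :: "real^'n \<Rightarrow> real^'n^'n" where
  "reflection_along \<alpha> = matrix (\<lambda>v. v - (2 * (v \<bullet> \<alpha>) / (\<alpha> \<bullet> \<alpha>)) *\<^sub>R \<alpha>)"

definition reflections :: "(real^'n^'n) set \<Rightarrow> (real^'n^'n) set" where
  "reflections W = {t \<in> W. \<exists>\<alpha>. \<alpha> \<noteq> 0 \<and> t = reflection_along \<alpha>}"

definition unit_roots :: "(real^'n^'n) set \<Rightarrow> (real^'n) set" where
  "unit_roots W = {\<alpha>. norm \<alpha> = 1 \<and> reflection_along \<alpha> \<in> W}"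

definition simple_system :: "(real^'n^'n) set \<Rightarrow> (real^'n) set \<Rightarrow> bool" where
  "simple_system W \<Delta> \<longleftrightarrow>
     \<Delta> \<subseteq> unit_roots W \<and> independent \<Delta> \<and>
     (\<forall>\<beta>\<in>unit_roots W. \<exists>k. \<beta> = (\<Sum>\<alpha>\<in>\<Delta>. k \<alpha> *\<^sub>R \<alpha>) \<and>
        ((\<forall>\<alpha>\<in>\<Delta>. k \<alpha> \<ge> 0) \<or> (\<forall>\<alpha>\<in>\<Delta>. k \<alpha> \<le> 0)))"

definition coxeter_element :: "(real^'n) set \<Rightarrow> real^'n^'n \<Rightarrow> bool" where
  "coxeter_element \<Delta> c \<longleftrightarrow>
     (\<exists>\<alpha>s. distinct \<alpha>s \<and> set \<alpha>s = \<Delta> \<and> c = mat_prod (map reflection_along \<alpha>s))"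

definition weyl_group_D :: "(real^'n^'n) set" where
  "weyl_group_D = {w.
     (\<forall>i j. w $ i $ j \<in> {-1, 0, 1}) \<and>
     (\<forall>i. \<exists>!j. w $ i $ j \<noteq> 0) \<and>
     (\<forall>j. \<exists>!i. w $ i $ j \<noteq> 0) \<and>
     even (card {(i, j). w $ i $ j = -1})}"


section \<open>Noncrossing parking functions\<close>

definition reflection_length :: "(real^'n^'n) set \<Rightarrow> real^'n^'n \<Rightarrow> nat" where
  "reflection_length W w =
     (LEAST k. \<exists>ts. length ts = k \<and> set ts \<subseteq> reflections W \<and> mat_prod ts = w)"

definition absolute_le :: "(real^'n^'n) set \<Rightarrow> real^'n^'n \<Rightarrow> real^'n^'n \<Rightarrow> bool" where
  "absolute_le W u v \<longleftrightarrow>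
     reflection_length W v = reflection_length W u + reflection_length W (matrix_inv u ** v)"

definition fixed_space :: "real^'n^'n \<Rightarrow> (real^'n) set" where
  "fixed_space w = {v. w *v v = v}"

definition noncrossing_flats :: "(real^'n^'n) set \<Rightarrow> real^'n^'n \<Rightarrow> (real^'n) set set" where
  "noncrossing_flats W c = fixed_space ` {w \<in> W. absolute_le W w c}"

definition pointwise_stabilizer ::
    "(real^'n^'n) set \<Rightarrow> (real^'n) set \<Rightarrow> (real^'n^'n) set" where
  "pointwise_stabilizer W X = {w \<in> W. \<forall>v\<in>X. w *v v = v}"

definition park_rel :: "(real^'n^'n) set \<Rightarrow> real^'n^'n \<Rightarrow>
    (((real^'n^'n) \<times> (real^'n) set) \<times> ((real^'n^'n) \<times> (real^'n) set)) set" where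
  "park_rel W c = {((w, X), (w', X')).
     w \<in> W \<and> w' \<in> W \<and> X \<in> noncrossing_flats W c \<and> X' \<in> noncrossing_flats W c \<and>
     X = X' \<and> (\<lambda>u. w ** u) ` pointwise_stabilizer W X = (\<lambda>u. w' ** u) ` pointwise_stabilizer W X}"

definition park_class :: "(real^'n^'n) set \<Rightarrow> real^'n^'n \<Rightarrow> real^'n^'n \<Rightarrow> (real^'n) set \<Rightarrow>
    ((real^'n^'n) \<times> (real^'n) set) set" where
  "park_class W c w X = park_rel W c `` {(w, X)}"

definition Park_NC :: "(real^'n^'n) set \<Rightarrow> real^'n^'n \<Rightarrow>
    ((real^'n^'n) \<times> (real^'n) set) set set" where
  "Park_NC W c = (W \<times> noncrossing_flats W c) // park_rel W c"


section \<open>Polynomials on the complexification\<close>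

text \<open>Exponent vectors are finitely supported maps from the index type of the coordinates.\<close>

type_synonym 'n cpoly = "('n \<Rightarrow>\<^sub>0 nat) \<Rightarrow>\<^sub>0 complex"

definition const_poly :: "complex \<Rightarrow> 'n cpoly" where
  "const_poly a = Poly_Mapping.single 0 a"

definition var_poly :: "'n \<Rightarrow> 'n cpoly" where
  "var_poly i = Poly_Mapping.single (Poly_Mapping.single i 1) 1"

definition poly_eval :: "'n::finite cpoly \<Rightarrow> complex^'n \<Rightarrow> complex" where
  "poly_eval p z = (\<Sum>m\<in>Poly_Mapping.keys p. Poly_Mapping.lookup p m *
     (\<Prod>i\<in>UNIV. (z $ i) ^ Poly_Mapping.lookup m i))"

definition poly_subst :: "'n::finite cpoly \<Rightarrow> ('n \<Rightarrow> 'n cpoly) \<Rightarrow> 'n cpoly" where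
  "poly_subst p \<sigma> = (\<Sum>m\<in>Poly_Mapping.keys p. const_poly (Poly_Mapping.lookup p m) *
     (\<Prod>i\<in>UNIV. \<sigma> i ^ Poly_Mapping.lookup m i))"

definition homogeneous_of_degree :: "nat \<Rightarrow> 'n::finite cpoly \<Rightarrow> bool" where
  "homogeneous_of_degree d p \<longleftrightarrow>
     (\<forall>m\<in>Poly_Mapping.keys p. (\<Sum>i\<in>UNIV. Poly_Mapping.lookup m i) = d)"

definition lin_comb :: "('n::finite \<Rightarrow> 'n cpoly) \<Rightarrow> complex^'n \<Rightarrow> 'n cpoly" where
  "lin_comb \<theta> a = (\<Sum>i\<in>UNIV. const_poly (a $ i) * \<theta> i)"

definition gen_ideal :: "('n::finite \<Rightarrow> 'n cpoly) \<Rightarrow> 'n cpoly set" where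
  "gen_ideal \<theta> = {p. \<exists>q. p = (\<Sum>i\<in>UNIV. q i * \<theta> i)}"

text \<open>The contragredient action: \<open>(w p)(z) = p(w\<^sup>-\<^sup>1 z)\<close>.\<close>

definition poly_act :: "real^'n^'n \<Rightarrow> 'n::finite cpoly \<Rightarrow> 'n cpoly" where
  "poly_act w p = poly_subst p
     (\<lambda>i. \<Sum>j\<in>UNIV. const_poly (complex_of_real (matrix_inv w $ i $ j)) * var_poly j)"

text \<open>A homogeneous system of parameters, all of whose members have degree \<open>d\<close>:
  the quotient of the polynomial ring by the ideal they generate is finite-dimensional.\<close>

definition hsop_of_degree :: "nat \<Rightarrow> ('n::finite \<Rightarrow> 'n cpoly) \<Rightarrow> bool" where
  "hsop_of_degree d \<theta> \<longleftrightarrow>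
     0 < d \<and> (\<forall>i. homogeneous_of_degree d (\<theta> i)) \<and>
     (\<exists>B. finite B \<and> (\<forall>p. \<exists>a. p - (\<Sum>b\<in>B. const_poly (a b) * b) \<in> gen_ideal \<theta>))"

text \<open>The linear forms are the \<open>lin_comb var_poly a\<close>; the map in question sends
  \<open>lin_comb var_poly a\<close> to \<open>lin_comb \<theta> a\<close>.\<close>

definition admissible_hsop ::
    "(real^'n^'n) set \<Rightarrow> nat \<Rightarrow> ('n::finite \<Rightarrow> 'n cpoly) \<Rightarrow> bool" where
  "admissible_hsop W h \<theta> \<longleftrightarrow>
     hsop_of_degree (h + 1) \<theta> \<and> inj (lin_comb \<theta>) \<and>
     (\<forall>w\<in>W. \<forall>a b. poly_act w (lin_comb var_poly a) = lin_comb var_poly b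
        \<longrightarrow> poly_act w (lin_comb \<theta> a) = lin_comb \<theta> b)"

definition V_theta :: "('n::finite \<Rightarrow> 'n cpoly) \<Rightarrow> (complex^'n) set" where
  "V_theta \<theta> = {z. \<forall>p\<in>gen_ideal (\<lambda>i. \<theta> i - var_poly i). poly_eval p z = 0}"


section \<open>Equivariance\<close>

definition complexify :: "real^'n^'n \<Rightarrow> complex^'n^'n" where
  "complexify w = (\<chi> i j. complex_of_real (w $ i $ j))"

text \<open>Action of \<open>(v, c\<^sup>d)\<close> on the complexification, where \<open>c\<close> has order \<open>h\<close>.\<close>

definition V_act :: "nat \<Rightarrow> real^'n^'n \<Rightarrow> nat \<Rightarrow> complex^'n \<Rightarrow> complex^'n" where
  "V_act h v d z = (exp (2 * of_real pi * \<i> / of_nat h) ^ d) *s (complexify v *v z)"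

text \<open>Elements of the cyclic group generated by \<open>c\<close> are written \<open>c\<^sup>d\<close> with \<open>d\<close> a
  natural number, which reaches all of them because \<open>c\<close> has finite order.\<close>

definition park_equivariant :: "(real^'n^'n) set \<Rightarrow> real^'n^'n \<Rightarrow> (complex^'n) set \<Rightarrow>
    (complex^'n \<Rightarrow> ((real^'n^'n) \<times> (real^'n) set) set) \<Rightarrow> bool" where
  "park_equivariant W c A f \<longleftrightarrow>
     (\<forall>v\<in>W. \<forall>d. \<forall>z\<in>A. \<forall>w\<in>W. \<forall>X\<in>noncrossing_flats W c.
        f z = park_class W c w X \<longrightarrow>
        f (V_act (mat_order c) v d z) =
          park_class W c (v ** w ** matrix_inv (mat_power c d)) ((*v) (mat_power c d) ` X))"

end

theory Submission
  imports Defs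
begin

text \<open>
  Take \<open>\<theta> i = x i ^ (2 n - 1)\<close>, so that \<open>V\<^sup>\<Theta>\<close> consists of the points all of whose coordinates are 0 or
  \<open>h\<close>-th roots of unity. A Coxeter element \<open>c\<close> turns a cycle of signed basis vectors
  \<open>e 0 \<mapsto> e 1 \<mapsto> \<dots>\<close> with \<open>e (j + n - 1) = - e j\<close> and negates the remaining coordinate line \<open>\<eta>\<close>.
  As \<open>c - 1\<close> is invertible, \<open>c\<close> is encoded by the skew form \<open>S\<close> with
  \<open>S (c x - x) (c y - y) = \<langle>c x, y\<rangle> - \<langle>x, c y\<rangle>\<close>, and by a dimension count based on Carter's
  \<open>\<ell>\<^sub>T(w) = codim V\<^sup>w\<close>, an element \<open>w\<close> lies below \<open>c\<close> if and only if it satisfies the same identity.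
  On signed basis vectors \<open>S\<close> is the cyclic order, and the identity becomes a noncrossing condition on the
  chords \<open>x \<rightarrow> w x\<close>.

  Attach the value \<open>\<omega> ^ j\<close> to \<open>e j\<close>. A noncrossing \<open>w\<close> has exactly one labelled point \<open>z\<^sub>w\<close>: on a
  block on which \<open>w\<close> is a positive cycle it takes the value of the first element of the block, and it vanishes on the
  other blocks. The bijection sends \<open>[g, V\<^sup>w]\<close> to \<open>g z\<^sub>w\<close>. Removing a shortest chord of \<open>w\<close>
  shortens the cycle; by induction every \<open>W\<close>-orbit in \<open>V\<^sup>\<Theta>\<close> contains \<open>z\<^sub>w\<close> for exactly one noncrossing
  \<open>w\<close>. The stabilizer of \<open>z\<^sub>w\<close> is the pointwise stabilizer of \<open>V\<^sup>w\<close>, and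
  \<open>z\<^sub>w'\<close> is \<open>\<omega> c z\<^sub>w\<close> for \<open>w' = c w c\<^sup>-\<^sup>1\<close>, which gives the two equivariances.
\<close>

section \<open>Signed permutation matrices\<close>

text \<open>Elements of the group are handled as permutations of the 2n vectors
  \<open>signed_basis\<close> commuting with negation, and points of complex n-space as odd
  functions on these vectors; thus signs need no bookkeeping. The skew form replaces factorizations
  of \<open>c\<close> by an identity that is tested on two basis vectors at a time. Blocks through
  \<eta>, the peculiarity of type D, fall under the same identity because \<eta> lies in the radical
  of \<open>S\<close>. The inductions run over sets \<open>P\<close> of cycle vectors closed under
  negation, such that the element fixes every cycle vector outside \<open>P\<close>. The vector
  \<eta> always stays free, since parity may force a sign change which only \<eta> can absorb. They
  stop when \<open>P\<close> lies in one line, where only four elements are left. Two of these, the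
  reflections exchanging \<open>k\<close> with \<eta> or with \<open>- \<eta>\<close>, have points
  that differ in one sign; that these lie in different orbits is the parity condition of type D. For
  an orbit the chord to be removed has to be read off the point alone. The number of basis vectors
  carrying each value is an orbit invariant, and counting shows that it always exhibits a fixed
  vector or a shortest chord.\<close>

definition signed_basis :: "(real^'n) set" where
  "signed_basis = range (\<lambda>i. axis i 1) \<union> range (\<lambda>i. - axis i 1)"

lemma signed_basisE:
  assumes "a \<in> signed_basis"
  obtains i s where "s = 1 \<or> s = -1" "a = s *\<^sub>R axis i (1::real)"
  using assms unfolding signed_basis_def by (auto; metis scaleR_minus1_left scaleR_one)

lemma axis_in_signed_basis: "axis i 1 \<in> signed_basis"
  by (auto simp: signed_basis_def)

lemma uminus_in_signed_basis [simp]: "- a \<in> signed_basis \<longleftrightarrow> a \<in> signed_basis"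
  unfolding signed_basis_def by (auto simp: minus_equation_iff image_iff) (metis minus_minus)+

lemma finite_signed_basis [simp]: "finite (signed_basis :: (real^'n) set)"
  by (simp add: signed_basis_def)

lemma inner_signed_basis:
  assumes "a \<in> signed_basis" "b \<in> signed_basis"
  shows "a \<bullet> b = (if a = b then 1 else if a = - b then -1 else 0)"
proof -
  obtain i s where s: "s = 1 \<or> s = -1" "a = s *\<^sub>R axis i (1::real)"
    using signed_basisE[OF assms(1)] .
  obtain j t where t: "t = 1 \<or> t = -1" "b = t *\<^sub>R axis j (1::real)"
    using signed_basisE[OF assms(2)] .
  have "a = b \<longleftrightarrow> i = j \<and> s = t" "a = - b \<longleftrightarrow> i = j \<and> s = - t"
  proof -
    have a: "a = axis i s" and b: "b = axis j t" and mb: "- b = axis j (- t)"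
      by (simp_all add: s(2) t(2) vec_eq_iff axis_def)
    show "a = b \<longleftrightarrow> i = j \<and> s = t"
      unfolding a b axis_eq_axis using s(1) t(1) by auto
    show "a = - b \<longleftrightarrow> i = j \<and> s = - t"
      unfolding a mb axis_eq_axis using s(1) t(1) by auto
  qed
  then show ?thesis using s t by (auto simp: inner_axis_axis)
qed

lemma signed_basis_self [simp]: "a \<in> signed_basis \<Longrightarrow> a \<bullet> a = 1"
  by (simp add: inner_signed_basis)

lemma signed_basis_neq_uminus [simp]: "a \<in> signed_basis \<Longrightarrow> a \<noteq> - a"
  using inner_signed_basis[of a a] inner_minus_right[of a a] by fastforce

lemma inner_eq_1_iff: "a \<in> signed_basis \<Longrightarrow> b \<in> signed_basis \<Longrightarrow> a \<bullet> b = 1 \<longleftrightarrow> a = b"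
  by (simp add: inner_signed_basis)

lemma inner_eq_0_iff: "a \<in> signed_basis \<Longrightarrow> b \<in> signed_basis \<Longrightarrow> a \<bullet> b = 0 \<longleftrightarrow> a \<noteq> b \<and> a \<noteq> - b"
  by (simp add: inner_signed_basis)

lemma signed_basis_ext: "(\<And>a. a \<in> signed_basis \<Longrightarrow> x \<bullet> a = y \<bullet> a) \<Longrightarrow> x = y"
  using axis_in_signed_basis by (metis cart_eq_inner_axis vec_eq_iff)

text \<open>Reduces linear identities to basis vectors; allowing both signs costs nothing and avoids
  coordinates.\<close>

lemma signed_basis_induct:
  fixes P :: "real^'n \<Rightarrow> bool"
  assumes "\<And>a. a \<in> signed_basis \<Longrightarrow> P a" "P 0"
    and "\<And>x y. P x \<Longrightarrow> P y \<Longrightarrow> P (x + y)" "\<And>r x. P x \<Longrightarrow> P (r *\<^sub>R x)"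
  shows "P x"
proof -
  have "x \<in> span signed_basis"
  proof -
    have "Basis \<subseteq> (signed_basis :: (real^'n) set)"
      by (auto simp: Basis_vec_def axis_in_signed_basis)
    then show ?thesis using span_mono span_Basis by blast
  qed
  then show ?thesis
    by (induction rule: span_induct_alt) (use assms in auto)
qed

lemma matrix_eq_on_signed_basis:
  fixes A B :: "real^'n^'m"
  assumes "\<And>a. a \<in> signed_basis \<Longrightarrow> A *v a = B *v a"
  shows "A = B"
proof -
  have "A *v x = B *v x" for x
    by (induction x rule: signed_basis_induct)
      (auto simp: assms matrix_vector_right_distrib matrix_vector_mult_scaleR)
  then show ?thesis by (simp add: matrix_eq)
qed

definition sperm :: "('n \<Rightarrow> 'n) \<Rightarrow> ('n \<Rightarrow> real) \<Rightarrow> real^'n^'n" where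
  "sperm \<pi> r = (\<chi> i j. if j = \<pi> i then r i else 0)"

lemma sperm_mult_vec: "(sperm \<pi> r *v x) $ i = r i * x $ \<pi> i"
  by (simp add: sperm_def matrix_vector_mult_def if_distrib[where f = "\<lambda>x. x * _"] cong: if_cong)

lemma sperm_mult:
  "sperm \<pi> r ** sperm \<pi>' r' = sperm (\<pi>' \<circ> \<pi>) (\<lambda>i. r i * r' (\<pi> i))"
  by (simp add: matrix_eq vec_eq_iff matrix_vector_mul_assoc[symmetric] sperm_mult_vec)

lemma sperm_transpose:
  assumes "bij \<pi>"
  shows "transpose (sperm \<pi> r) = sperm (inv \<pi>) (r \<circ> inv \<pi>)"
proof -
  have "j = inv \<pi> i \<longleftrightarrow> i = \<pi> j" for i j
    using bij_inv_eq_iff[OF assms] by metis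
  then show ?thesis by (simp add: sperm_def transpose_def vec_eq_iff bij_is_inj[OF assms])
qed

text \<open>An even number of entries -1 means that the signs multiply to 1. In this form the parity
  condition is visibly preserved by products and inverses.\<close>

lemma weyl_group_D_eq:
  "(weyl_group_D :: (real^'n^'n) set) = {sperm \<pi> r |\<pi> r. bij \<pi> \<and> (\<forall>i. r i = 1 \<or> r i = -1) \<and> prod r UNIV = 1}"
proof -
  have neg: "card {(i, j). sperm \<pi> r $ i $ j = -1} = card {i. r i = -1}" for \<pi> :: "'n \<Rightarrow> 'n" and r
  proof -
    have "{(i, j). sperm \<pi> r $ i $ j = -1} = (\<lambda>i. (i, \<pi> i)) ` {i. r i = -1}"
      by (auto simp: sperm_def split: if_splits)
    moreover have "inj_on (\<lambda>i. (i, \<pi> i)) {i. r i = -1}" by (auto simp: inj_on_def)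
    ultimately show ?thesis by (simp add: card_image)
  qed
  have pr: "even (card {i. r i = -1}) \<longleftrightarrow> prod r UNIV = 1"
    if "\<forall>i. r i = 1 \<or> r i = -1" for r :: "'n \<Rightarrow> real"
  proof -
    have "prod r UNIV = (\<Prod>i\<in>UNIV. if r i = -1 then -1 else 1)"
      by (rule prod.cong) (use that in auto)
    also have "\<dots> = (-1) ^ card {i. r i = -1}"
      by (simp add: prod.If_cases)
    finally show ?thesis by (auto simp: minus_one_power_iff)
  qed
  show ?thesis
  proof (intro equalityI subsetI)
    fix w :: "real^'n^'n" assume w: "w \<in> weyl_group_D"
    then have w1: "w $ i $ j \<in> {-1, 0, 1}" and w2: "\<exists>!j. w $ i $ j \<noteq> 0"
      and w3: "\<exists>!i. w $ i $ j \<noteq> 0" for i j by (auto simp: weyl_group_D_def)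
    obtain \<pi> where \<pi>: "w $ i $ j \<noteq> 0 \<longleftrightarrow> j = \<pi> i" for i j
      using w2 by metis
    define r where "r i = w $ i $ \<pi> i" for i
    have r: "r i = 1 \<or> r i = -1" for i using w1[of i "\<pi> i"] \<pi>[of i "\<pi> i"] by (auto simp: r_def)
    have eq: "w = sperm \<pi> r" using \<pi> by (auto simp: sperm_def vec_eq_iff r_def)
    have "inj \<pi>" by (rule injI) (metis \<pi> w3)
    then have "bij \<pi>" using finite_UNIV_inj_surj[of \<pi>] by (auto simp: bij_def)
    moreover have "prod r UNIV = 1" using w r pr[of r] neg[of \<pi> r] by (auto simp: weyl_group_D_def eq)
    ultimately show "w \<in> {sperm \<pi> r |\<pi> r. bij \<pi> \<and> (\<forall>i. r i = 1 \<or> r i = -1) \<and> prod r UNIV = 1}"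
      using eq r by blast
  next
    fix w :: "real^'n^'n"
    assume "w \<in> {sperm \<pi> r |\<pi> r. bij \<pi> \<and> (\<forall>i. r i = 1 \<or> r i = -1) \<and> prod r UNIV = 1}"
    then obtain \<pi> r where w: "w = sperm \<pi> r" "bij \<pi>" "prod r UNIV = 1"
      and r: "\<forall>i. r i = 1 \<or> r i = -1" by auto
    have r0: "r i \<noteq> 0" for i using r[rule_format, of i] by auto
    have "w $ i $ j \<noteq> 0 \<longleftrightarrow> j = \<pi> i" for i j using r0 by (simp add: w(1) sperm_def)
    then have "\<exists>!i. w $ i $ j \<noteq> 0" for j
      using w(2) by (metis bij_pointE)
    moreover have "\<exists>!j. w $ i $ j \<noteq> 0" for i using r0 by (auto simp: w(1) sperm_def)
    moreover have "w $ i $ j \<in> {-1, 0, 1}" for i j using r by (auto simp: w(1) sperm_def)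
    ultimately show "w \<in> weyl_group_D"
      using neg[of \<pi> r] pr[OF r] w by (simp add: weyl_group_D_def)
  qed
qed

lemma weyl_group_DE:
  assumes "w \<in> weyl_group_D"
  obtains \<pi> r where "w = sperm \<pi> r" "bij \<pi>" "\<And>i. r i = 1 \<or> r i = -1" "prod r UNIV = 1"
  using assms unfolding weyl_group_D_eq by blast

lemma mat_1_in_weyl: "mat 1 \<in> weyl_group_D"
proof -
  have "mat 1 = sperm id (\<lambda>_. 1)" by (auto simp: sperm_def mat_def vec_eq_iff)
  then show ?thesis unfolding weyl_group_D_eq by force
qed

lemma weyl_mult:
  assumes "v \<in> weyl_group_D" "w \<in> weyl_group_D"
  shows "v ** w \<in> weyl_group_D"
proof -
  obtain \<pi> r where v: "v = sperm \<pi> r" "bij \<pi>" "\<And>i. r i = 1 \<or> r i = -1" "prod r UNIV = 1"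
    using weyl_group_DE[OF assms(1)] by metis
  obtain \<pi>' r' where w: "w = sperm \<pi>' r'" "bij \<pi>'" "\<And>i. r' i = 1 \<or> r' i = -1" "prod r' UNIV = 1"
    using weyl_group_DE[OF assms(2)] by metis
  have "(\<Prod>i\<in>UNIV. r' (\<pi> i)) = prod r' UNIV"
    using prod.reindex_bij_betw[of \<pi> UNIV UNIV r'] v(2) by simp
  then have "(\<Prod>i\<in>UNIV. r i * r' (\<pi> i)) = 1" using v w by (simp add: prod.distrib)
  moreover have "r i * r' (\<pi> i) = 1 \<or> r i * r' (\<pi> i) = -1" for i
    using v(3)[of i] w(3)[of "\<pi> i"] by auto
  moreover have "bij (\<pi>' \<circ> \<pi>)" using v w bij_comp by blast
  ultimately show ?thesis unfolding weyl_group_D_eq v(1) w(1) sperm_mult by blast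
qed

lemma weyl_transpose:
  assumes "w \<in> weyl_group_D"
  shows "transpose w \<in> weyl_group_D"
proof -
  obtain \<pi> r where w: "w = sperm \<pi> r" "bij \<pi>" "\<And>i. r i = 1 \<or> r i = -1" "prod r UNIV = 1"
    using weyl_group_DE[OF assms(1)] by metis
  have "(\<Prod>i\<in>UNIV. r (inv \<pi> i)) = prod r UNIV"
    using prod.reindex_bij_betw[of "inv \<pi>" UNIV UNIV r] bij_imp_bij_inv[OF w(2)] by simp
  then show ?thesis unfolding weyl_group_D_eq w(1) sperm_transpose[OF w(2)]
    using w bij_imp_bij_inv[OF w(2)] by (auto simp: o_def)
qed

lemma weyl_orthogonal:
  assumes "w \<in> weyl_group_D"
  shows "orthogonal_matrix w"
proof -
  obtain \<pi> r where w: "w = sperm \<pi> r" "bij \<pi>" "\<And>i. r i = 1 \<or> r i = -1" "prod r UNIV = 1"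
    using weyl_group_DE[OF assms(1)] by metis
  have "r i * r i = 1" for i using w(3)[of i] by auto
  then have "transpose w ** w = mat 1"
    unfolding w(1) sperm_transpose[OF w(2)] sperm_mult
    using w(2) by (auto simp: sperm_def mat_def vec_eq_iff bij_is_surj surj_f_inv_f)
  then show ?thesis by (simp add: orthogonal_matrix)
qed

lemma weyl_transpose_mult:
  assumes "w \<in> weyl_group_D"
  shows "transpose w ** w = mat 1" "w ** transpose w = mat 1"
  using weyl_orthogonal[OF assms] by (auto simp: orthogonal_matrix_def)

lemma weyl_transpose_mult_vec [simp]:
  assumes "w \<in> weyl_group_D"
  shows "transpose w *v (w *v x) = x" "w *v (transpose w *v x) = x"
  using weyl_transpose_mult[OF assms] by (simp_all add: matrix_vector_mul_assoc del: transpose_matrix_vector)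

lemma weyl_matrix_inv: "w \<in> weyl_group_D \<Longrightarrow> matrix_inv w = transpose w"
  unfolding matrix_inv_def
  by (rule some_equality) (auto simp: weyl_transpose_mult, metis matrix_mul_assoc matrix_mul_lid matrix_mul_rid weyl_transpose_mult(1))

lemma weyl_inner [simp]:
  assumes "w \<in> weyl_group_D"
  shows "(w *v x) \<bullet> (w *v y) = x \<bullet> y"
  using weyl_orthogonal[OF assms] orthogonal_transformation_matrix[of "(*v) w"]
  by (simp add: orthogonal_transformation_def)

lemma inner_transpose: "(transpose A *v x) \<bullet> y = x \<bullet> (A *v (y::real^'n))"
  by (metis dot_lmul_matrix transpose_matrix_vector)

lemma weyl_inj: "w \<in> weyl_group_D \<Longrightarrow> w *v x = w *v y \<longleftrightarrow> x = y"
  by (metis weyl_transpose_mult_vec(1))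

lemma weyl_signed_basis:
  assumes "w \<in> weyl_group_D" "a \<in> signed_basis"
  shows "w *v a \<in> signed_basis"
proof -
  obtain \<pi> r where w: "w = sperm \<pi> r" "bij \<pi>" "\<And>i. r i = 1 \<or> r i = -1" "prod r UNIV = 1"
    using weyl_group_DE[OF assms(1)] by metis
  obtain i s where s: "s = 1 \<or> s = -1" "a = s *\<^sub>R axis i (1::real)"
    using signed_basisE[OF assms(2)] .
  obtain j where j: "\<pi> k = i \<longleftrightarrow> k = j" for k using bij_pointE[OF w(2), of i] by metis
  have "w *v a = (r j * s) *\<^sub>R axis j 1"
    by (simp add: vec_eq_iff w(1) sperm_mult_vec s(2) axis_def j)
  then show ?thesis using w(3)[of j] s(1) by (auto simp: axis_in_signed_basis)
qed

subsection \<open>Complex coordinates\<close>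

text \<open>The bilinear pairing with a real vector, without complex conjugation. It makes a complex
  point an odd function on the signed basis that determines the point.\<close>

definition coord :: "complex^'n \<Rightarrow> real^'n \<Rightarrow> complex" where
  "coord z a = (\<Sum>i\<in>UNIV. z $ i * of_real (a $ i))"

text \<open>For a signed basis vector \<open>q\<close> this sets the value at \<open>q\<close> to
  \<open>v\<close> and at \<open>- q\<close> to \<open>- v\<close>. Adding a multiple of
  \<open>q\<close> avoids choosing the index and sign of \<open>q\<close>.\<close>

definition upd :: "complex^'n \<Rightarrow> real^'n \<Rightarrow> complex \<Rightarrow> complex^'n" where
  "upd z q v = (\<chi> i. z $ i + (v - coord z q) * of_real (q $ i))"

lemma coord_axis [simp]: "coord z (axis i 1) = z $ i"
  by (simp add: coord_def axis_def if_distrib[where f = of_real] if_distrib[where f = "(*) _"] cong: if_cong)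

lemma coord_uminus [simp]: "coord z (- a) = - coord z a"
  by (simp add: coord_def sum_negf)

lemma coord_scaleR [simp]: "coord z (s *\<^sub>R a) = of_real s * coord z a"
  by (simp add: coord_def sum_distrib_left mult_ac)

lemma coord_smult: "coord (v *s z) a = v * coord z a"
  by (simp add: coord_def sum_distrib_left mult_ac)

lemma coord_ext: "(\<And>a. a \<in> signed_basis \<Longrightarrow> coord z a = coord z' a) \<Longrightarrow> z = z'"
  using axis_in_signed_basis by (metis coord_axis vec_eq_iff)

lemma coord_upd:
  "coord (upd z q v) a = coord z a + (v - coord z q) * of_real (q \<bullet> a)"
proof -
  have "(\<Sum>i\<in>UNIV. (v - coord z q) * complex_of_real (q $ i) * complex_of_real (a $ i)) =
    (v - coord z q) * of_real (q \<bullet> a)"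
    by (simp add: inner_vec_def sum_distrib_left mult.assoc)
  then show ?thesis
    by (simp add: coord_def upd_def ring_distribs(2) sum.distrib)
qed

lemma coord_upd_self [simp]: "q \<in> signed_basis \<Longrightarrow> coord (upd z q v) q = v"
  by (simp add: coord_upd)

lemma coord_upd_other:
  "q \<in> signed_basis \<Longrightarrow> a \<in> signed_basis \<Longrightarrow> a \<noteq> q \<Longrightarrow> a \<noteq> - q \<Longrightarrow> coord (upd z q v) a = coord z a"
  by (auto simp: coord_upd inner_signed_basis)

lemma upd_upd: "q \<in> signed_basis \<Longrightarrow> upd (upd z q v) q u = upd z q u"
  by (rule coord_ext) (simp add: coord_upd algebra_simps)

lemma upd_triv: "coord z q = v \<Longrightarrow> upd z q v = z"
  by (simp add: upd_def vec_eq_iff)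

lemma coord_complexify: "coord (complexify w *v z) a = coord z (transpose w *v a)"
proof -
  have "coord (complexify w *v z) a = (\<Sum>i\<in>UNIV. \<Sum>j\<in>UNIV. of_real (w $ i $ j) * z $ j * of_real (a $ i))"
    by (simp add: coord_def matrix_vector_mult_def complexify_def sum_distrib_right)
  also have "\<dots> = (\<Sum>j\<in>UNIV. \<Sum>i\<in>UNIV. of_real (w $ i $ j) * z $ j * of_real (a $ i))"
    by (rule sum.swap)
  also have "\<dots> = coord z (transpose w *v a)"
    by (simp add: coord_def matrix_vector_mult_def transpose_def sum_distrib_left mult_ac
        del: transpose_matrix_vector)
  finally show ?thesis .
qed

lemma coord_complexify_mult_vec:
  assumes "w \<in> weyl_group_D"
  shows "coord (complexify w *v z) (w *v a) = coord z a"
  by (simp add: coord_complexify assms del: transpose_matrix_vector)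

lemma complexify_mult: "complexify (v ** w) *v z = complexify v *v (complexify w *v z)"
  by (rule coord_ext)
    (simp only: coord_complexify matrix_transpose_mul matrix_vector_mul_assoc[symmetric])

lemma complexify_mat_1 [simp]: "complexify (mat 1) *v z = z"
  by (rule coord_ext) (simp add: coord_complexify del: transpose_matrix_vector)

lemma complexify_smult: "complexify w *v (v *s z) = v *s (complexify w *v z)"
  by (rule coord_ext) (simp add: coord_complexify coord_smult)

lemma complexify_upd:
  fixes q :: "real^'n"
  assumes "g \<in> weyl_group_D" "q \<in> signed_basis"
  shows "complexify g *v (upd z q v) = upd (complexify g *v z) (g *v q) v"
proof (rule coord_ext)
  fix a :: "real^'n"
  have "q \<bullet> (transpose g *v a) = (g *v q) \<bullet> a"
    by (metis inner_commute inner_transpose)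
  then show "coord (complexify g *v (upd z q v)) a = coord (upd (complexify g *v z) (g *v q) v) a"
    using assms by (simp add: coord_complexify coord_upd del: transpose_matrix_vector)
qed

text \<open>The permutation reorders the factors and the signs multiply to 1: the product of the
  coordinates is the invariant that separates type D from type B.\<close>

lemma prod_weyl:
  assumes "w \<in> weyl_group_D"
  shows "(\<Prod>i\<in>UNIV. (complexify w *v z) $ i) = (\<Prod>i\<in>UNIV. z $ i)"
proof -
  obtain \<pi> r where w: "w = sperm \<pi> r" "bij \<pi>" "\<And>i. r i = 1 \<or> r i = -1" "prod r UNIV = 1"
    using weyl_group_DE[OF assms(1)] by metis
  have "(complexify w *v z) $ i = of_real (r i) * z $ \<pi> i" for i
    by (simp add: w(1) complexify_def sperm_def matrix_vector_mult_def if_distrib[where f = of_real]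
        if_distrib[where f = "\<lambda>x. x * _"] cong: if_cong)
  moreover have "(\<Prod>i\<in>UNIV. z $ \<pi> i) = (\<Prod>i\<in>UNIV. z $ i)"
    using prod.reindex_bij_betw[of \<pi> UNIV UNIV "\<lambda>i. z $ i"] w(2) by simp
  moreover have "(\<Prod>i\<in>UNIV. complex_of_real (r i)) = 1"
    using w(4) by (metis of_real_prod of_real_1)
  ultimately show ?thesis by (simp add: prod.distrib)
qed

text \<open>The parity condition that distinguishes type D from type B: an odd number of sign changes
  is possible only in the presence of a vanishing coordinate.\<close>

lemma weyl_flip_imp_zero:
  assumes g: "g \<in> weyl_group_D" and a: "a \<in> signed_basis"
    and eq: "complexify g *v z = upd z a (- coord z a)"
  shows "\<exists>b\<in>signed_basis. coord z b = 0"
proof -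
  obtain i s where s: "s = 1 \<or> s = -1" "a = s *\<^sub>R axis i (1::real)"
    using signed_basisE[OF a] .
  have "upd z a (- coord z a) $ j = (if j = i then -1 else 1) * z $ j" for j
    using s by (auto simp: upd_def) (auto simp: axis_def)
  then have "(\<Prod>j\<in>UNIV. upd z a (- coord z a) $ j) = - (\<Prod>j\<in>UNIV. z $ j)"
    by (simp add: prod.distrib prod.If_cases)
  then have "(\<Prod>j\<in>UNIV. z $ j) = 0" using prod_weyl[OF g, of z] eq by (simp add: equal_neg_zero)
  then obtain j where "z $ j = 0" by auto
  then show ?thesis using axis_in_signed_basis[of j] coord_axis[of z j] by metis
qed

subsection \<open>Reflections\<close>

lemma reflection_along_mult_vec:
  "reflection_along \<alpha> *v v = v - (2 * (v \<bullet> \<alpha>) / (\<alpha> \<bullet> \<alpha>)) *\<^sub>R \<alpha>"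
proof -
  have "linear (\<lambda>v. v - (2 * (v \<bullet> \<alpha>) / (\<alpha> \<bullet> \<alpha>)) *\<^sub>R \<alpha>)"
    by (rule linearI) (auto simp: algebra_simps inner_add_left add_divide_distrib)
  then show ?thesis by (simp add: reflection_along_def)
qed

lemma reflection_along_scaleR: "k \<noteq> 0 \<Longrightarrow> reflection_along (k *\<^sub>R \<alpha>) = reflection_along \<alpha>"
  by (simp add: matrix_eq reflection_along_mult_vec)

lemma reflection_along_involution: "reflection_along \<alpha> *v (reflection_along \<alpha> *v x) = x"
  by (cases "\<alpha> = 0") (simp_all add: reflection_along_mult_vec inner_diff_left)

lemma reflection_along_square: "reflection_along \<alpha> ** reflection_along \<alpha> = mat 1"
  by (simp add: matrix_eq matrix_vector_mul_assoc[symmetric] reflection_along_involution)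

lemma reflection_along_transpose: "transpose (reflection_along \<alpha>) = reflection_along \<alpha>"
proof -
  have "(transpose (reflection_along \<alpha>) *v x) \<bullet> y = (reflection_along \<alpha> *v x) \<bullet> y" for x y
    unfolding inner_transpose
    by (simp add: reflection_along_mult_vec inner_diff_left inner_diff_right inner_commute)
  then show ?thesis by (metis matrix_eq vector_eq_rdot)
qed

context
  fixes x y :: "real^'n"
  assumes x: "x \<in> signed_basis" and y: "y \<in> signed_basis" and xy: "x \<noteq> y" "x \<noteq> - y"
begin

lemma inner_xy: "x \<bullet> y = 0" "y \<bullet> x = 0"
  using x y xy by (auto simp: inner_signed_basis)

lemma norm_diff_xy: "(x - y) \<bullet> (x - y) = 2"
  using x y inner_xy by (simp add: inner_diff_left inner_diff_right)

lemma swap_mult_vec: "reflection_along (x - y) *v v = v - (v \<bullet> (x - y)) *\<^sub>R (x - y)"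
  by (simp add: reflection_along_mult_vec norm_diff_xy)

lemma swap_left: "reflection_along (x - y) *v x = y"
  and swap_right: "reflection_along (x - y) *v y = x"
  using x y inner_xy by (simp_all add: swap_mult_vec inner_diff_right)

lemma swap_other:
  assumes "a \<in> signed_basis" "a \<noteq> x" "a \<noteq> -x" "a \<noteq> y" "a \<noteq> -y"
  shows "reflection_along (x - y) *v a = a"
  using assms x y by (simp add: swap_mult_vec inner_diff_right inner_signed_basis)

text \<open>If x and y are s and t times the axes i and j, the reflection is the transposition of i
  and j with the same sign s t in both rows, so the two signs cancel in the product.\<close>

lemma swap_in_weyl: "reflection_along (x - y) \<in> weyl_group_D"
proof -
  obtain i s where s: "s = 1 \<or> s = -1" "x = s *\<^sub>R axis i (1::real)"
    using signed_basisE[OF x] .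
  obtain j t where t: "t = 1 \<or> t = -1" "y = t *\<^sub>R axis j (1::real)"
    using signed_basisE[OF y] .
  have ij: "i \<noteq> j" using xy s t by auto
  define r where "r k = (if k = i \<or> k = j then s * t else 1)" for k
  have "reflection_along (x - y) = sperm (Transposition.transpose i j) r"
  proof -
    have "v \<bullet> (x - y) = s * v $ i - t * v $ j" for v
      by (simp add: s(2) t(2) inner_diff_right inner_axis)
    moreover have "(x - y) $ k = (if k = i then s else if k = j then - t else 0)" for k
      using ij by (simp add: s(2) t(2) axis_def)
    ultimately have eq: "v \<bullet> (x - y) = s * v $ i - t * v $ j" "(x - y) $ k = (if k = i then s else if k = j then - t else 0)" for v k
      by blast+
    have "(reflection_along (x - y) *v v) $ k = (sperm (Transposition.transpose i j) r *v v) $ k" for v k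
    proof -
      have "(reflection_along (x - y) *v v) $ k =
        v $ k - (s * v $ i - t * v $ j) * (if k = i then s else if k = j then - t else 0)"
        unfolding swap_mult_vec vector_minus_component[of v] vector_scaleR_component
        by (simp only: eq real_scaleR_def)
      also have "\<dots> = r k * v $ Transposition.transpose i j k"
        using s(1) t(1) ij by (elim disjE) (simp_all add: r_def Transposition.transpose_def)
      finally show ?thesis by (simp add: sperm_mult_vec)
    qed
    then show ?thesis by (simp add: matrix_eq vec_eq_iff)
  qed
  moreover have "r k = 1 \<or> r k = -1" for k using s t by (auto simp: r_def)
  moreover have "prod r UNIV = 1"
  proof -
    have "prod r UNIV = (\<Prod>k\<in>{i, j}. r k)"
      by (rule prod.mono_neutral_right) (auto simp: r_def)
    also have "\<dots> = 1" using s t ij by (auto simp: r_def)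
    finally show ?thesis .
  qed
  moreover have "bij (Transposition.transpose i j)" by simp
  ultimately show ?thesis unfolding weyl_group_D_eq by blast
qed

lemma swap_in_reflections: "reflection_along (x - y) \<in> reflections weyl_group_D"
  using swap_in_weyl xy(1) unfolding reflections_def by (auto intro!: exI[of _ "x - y"])

end

text \<open>The sign change on two orthogonal basis lines, the smallest sign change that type D
  admits, as the product of the reflections in the orthogonal roots x - y and x + y.\<close>

definition neg2 :: "real^'n \<Rightarrow> real^'n \<Rightarrow> real^'n^'n" where
  "neg2 x y = reflection_along (x - y) ** reflection_along (x + y)"

context
  fixes x y :: "real^'n"
  assumes x: "x \<in> signed_basis" and y: "y \<in> signed_basis" and xy: "x \<noteq> y" "x \<noteq> - y"
begin

lemma neg2_in_weyl: "neg2 x y \<in> weyl_group_D"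
  unfolding neg2_def using swap_in_weyl[of x y] swap_in_weyl[of x "-y"] x y xy
  by (simp add: weyl_mult)

lemma neg2_mult_vec: "neg2 x y *v v = v - (2 * (v \<bullet> x)) *\<^sub>R x - (2 * (v \<bullet> y)) *\<^sub>R y"
proof -
  have 1: "reflection_along (x + y) *v v = v - (v \<bullet> (x + y)) *\<^sub>R (x + y)"
    using swap_mult_vec[of x "-y" v] x y xy by simp
  have 2: "(v - (v \<bullet> (x + y)) *\<^sub>R (x + y)) \<bullet> (x - y) = v \<bullet> x - v \<bullet> y"
    using inner_xy[OF x y xy] x y
    by (simp add: inner_diff_left inner_diff_right inner_add_right inner_add_left)
  show ?thesis
    unfolding neg2_def matrix_vector_mul_assoc[symmetric] 1 swap_mult_vec[OF x y xy] 2
    by (simp add: vec_eq_iff inner_add_right algebra_simps)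
qed

lemma neg2_left: "neg2 x y *v x = - x" and neg2_right: "neg2 x y *v y = - y"
  using inner_xy[OF x y xy] x y by (simp_all add: neg2_mult_vec scaleR_2)

lemma neg2_other:
  assumes "a \<in> signed_basis" "a \<noteq> x" "a \<noteq> -x" "a \<noteq> y" "a \<noteq> -y"
  shows "neg2 x y *v a = a"
  using assms x y by (simp add: neg2_mult_vec inner_signed_basis)

end

section \<open>The orientation form of a Coxeter element\<close>

lemma matrix_vector_mult_uminus: "A *v (- x) = - (A *v (x :: real^'n))"
  using matrix_vector_mult_scaleR[of A "-1" x] by simp

lemma bilinear_zero_on_signed_basis:
  fixes f :: "real^'n \<Rightarrow> real^'n \<Rightarrow> real"
  assumes "\<And>x y z. f (x + y) z = f x z + f y z" "\<And>r x z. f (r *\<^sub>R x) z = r * f x z"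
    and "\<And>x y z. f z (x + y) = f z x + f z y" "\<And>r x z. f z (r *\<^sub>R x) = r * f z x"
    and "\<And>a b. a \<in> signed_basis \<Longrightarrow> b \<in> signed_basis \<Longrightarrow> f a b = 0"
  shows "f x y = 0"
proof (induction x rule: signed_basis_induct)
  fix a :: "real^'n" assume a: "a \<in> signed_basis"
  show "f a y = 0"
  proof (induction y rule: signed_basis_induct)
    show "f a 0 = 0" using assms(4)[of a 0 0] by simp
  qed (simp_all add: a assms)
next
  show "f 0 y = 0" using assms(2)[of 0 0 y] by simp
qed (simp_all add: assms)

text \<open>The sign of sin (pi d / N): a square wave, antiperiodic under d + N, with the value 0
  where it jumps.\<close>

definition csign :: "int \<Rightarrow> int \<Rightarrow> real" where
  "csign N d = (if N dvd d then 0 else if even (d div N) then 1 else -1)"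

text \<open>The antiperiodic Kronecker delta; it will be the inner product of two cycle vectors
  whose indices differ by \<open>d\<close>.\<close>

definition cdelta :: "int \<Rightarrow> int \<Rightarrow> real" where
  "cdelta N d = (if \<not> N dvd d then 0 else if even (d div N) then 1 else -1)"

lemma csign_add: "N \<noteq> 0 \<Longrightarrow> csign N (d + N) = - csign N d"
  by (simp add: csign_def)

lemma csign_add_mult: "N \<noteq> 0 \<Longrightarrow> csign N (d + k * N) = (if even k then csign N d else - csign N d)"
  by (auto simp: csign_def)

lemma cdelta_add_mult: "N \<noteq> 0 \<Longrightarrow> cdelta N (d + k * N) = (if even k then cdelta N d else - cdelta N d)"
  by (auto simp: cdelta_def)

lemma csign_small: "0 < d \<Longrightarrow> d < N \<Longrightarrow> csign N d = 1"
  by (auto simp: csign_def zdvd_not_zless)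

lemma csign_eq_1_iff:
  assumes "N > 0"
  shows "csign N d = 1 \<longleftrightarrow> 0 < d mod (2 * N) \<and> d mod (2 * N) < N"
    and "csign N d = -1 \<longleftrightarrow> N < d mod (2 * N)"
proof -
  define r where "r = d mod (2 * N)"
  have r: "0 \<le> r" "r < 2 * N" using assms by (auto simp: r_def)
  have "d = r + (2 * (d div (2 * N))) * N"
    using mod_mult_div_eq[of d "2 * N"] by (simp add: r_def mult_ac)
  then have eq: "csign N d = csign N r" using csign_add_mult[of N r "2 * (d div (2 * N))"] assms by simp
  consider "r = 0" | "0 < r" "r < N" | "r = N" | "N < r" using r by linarith
  then have "(csign N r = 1 \<longleftrightarrow> 0 < r \<and> r < N) \<and> (csign N r = -1 \<longleftrightarrow> N < r)"
  proof cases
    case 2 then show ?thesis using csign_small[of r N] by auto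
  next
    case 4
    then have "csign N r = - csign N (r - N)" using csign_add[of N "r - N"] assms by simp
    also have "\<dots> = -1" using csign_small[of "r - N" N] r 4 by simp
    finally show ?thesis using 4 by simp
  qed (use assms in \<open>auto simp: csign_def\<close>)
  then show "csign N d = 1 \<longleftrightarrow> 0 < d mod (2 * N) \<and> d mod (2 * N) < N"
    and "csign N d = -1 \<longleftrightarrow> N < d mod (2 * N)" by (auto simp: eq r_def)
qed

text \<open>The square wave jumps by 2 at multiples of \<open>N\<close>, and the value 0 there
  splits each jump into two halves, one on either side.\<close>

lemma csign_diff_eq:
  assumes "N \<ge> 2"
  shows "csign N (d + 1) - csign N d = cdelta N d + cdelta N (d + 1)"
proof -
  define r k where "r = d mod N" and "k = d div N"
  have d: "d = r + k * N" "d + 1 = (r + 1) + k * N" by (simp_all add: r_def k_def)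
  have r: "0 \<le> r" "r < N" using assms by (auto simp: r_def)
  have *: "csign N (r + 1) - csign N r = cdelta N r + cdelta N (r + 1)"
  proof -
    consider "r = 0" | "0 < r" "r + 1 < N" | "r + 1 = N" using r by linarith
    then show ?thesis
    proof cases
      case 1 then show ?thesis using assms csign_small[of 1 N] by (auto simp: csign_def cdelta_def)
    next
      case 2 then show ?thesis using csign_small[of r N] csign_small[of "r + 1" N]
        by (auto simp: cdelta_def zdvd_not_zless)
    next
      case 3
      then have "csign N r = 1" "\<not> N dvd r" using csign_small[of r N] r assms by (auto simp: zdvd_not_zless)
      moreover have "csign N (r + 1) = 0" "cdelta N (r + 1) = -1" using assms by (auto simp: 3 csign_def cdelta_def)
      ultimately show ?thesis by (simp add: cdelta_def)
    qed
  qed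
  show ?thesis unfolding d(2) unfolding d(1) using * assms by (auto simp: csign_add_mult cdelta_add_mult)
qed

text \<open>Up to signed permutations this is the normal form of a Coxeter element of type D:
  a negative cycle \<open>e 0 \<mapsto> e 1 \<mapsto> \<dots> \<mapsto> e N = - e 0\<close> and a negative fixed line \<open>\<eta>\<close>.\<close>

locale D_frame =
  fixes c :: "real^'n^'n" and e :: "int \<Rightarrow> real^'n" and \<eta> :: "real^'n" and N :: int
  assumes N: "N \<ge> 2"
    and c_weyl: "c \<in> weyl_group_D"
    and e_basis [simp]: "e j \<in> signed_basis"
    and eta_basis [simp]: "\<eta> \<in> signed_basis"
    and e_antiperiodic: "e (j + N) = - e j"
    and c_e: "c *v e j = e (j + 1)"
    and c_eta: "c *v \<eta> = - \<eta>"
    and cover: "a \<in> signed_basis \<Longrightarrow> a = \<eta> \<or> a = - \<eta> \<or> a \<in> range e"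
    and e_inj: "e i = e j \<Longrightarrow> 2 * N dvd i - j"
    and e_neq_eta [simp]: "e j \<noteq> \<eta>"
begin

lemma e_neq_uminus_eta [simp]: "e j \<noteq> - \<eta>"
  using e_neq_eta[of "j + N"] by (simp add: e_antiperiodic minus_equation_iff)

lemma e_add_mult: "e (j + k * N) = (if even k then e j else - e j)"
proof -
  have nat: "e (j + int k * N) = (if even k then e j else - e j)" for j and k :: nat
  proof (induction k)
    case (Suc k)
    have "e (j + int (Suc k) * N) = e ((j + int k * N) + N)" by (simp add: algebra_simps)
    also have "\<dots> = - e (j + int k * N)" by (rule e_antiperiodic)
    finally show ?case using Suc by auto
  qed simp
  show ?thesis
  proof (cases "k \<ge> 0")
    case True then show ?thesis using nat[of j "nat k"] by (simp add: even_nat_iff)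
  next
    case False
    then show ?thesis using nat[of "j + k * N" "nat (- k)"]
      by (auto simp: even_nat_iff split: if_splits)
  qed
qed

lemma e_uminus: "- e j = e (j + N)"
  by (simp add: e_antiperiodic)

lemma e_eq_iff: "e i = e j \<longleftrightarrow> 2 * N dvd i - j"
proof
  assume "2 * N dvd i - j"
  then obtain k where "i - j = 2 * N * k" by blast
  then have "i = j + (2 * k) * N" by (simp add: algebra_simps)
  then show "e i = e j" using e_add_mult[of j "2 * k"] by simp
qed (rule e_inj)

lemma inner_e_e: "e i \<bullet> e j = cdelta N (j - i)"
proof -
  have 1: "e i = e j \<longleftrightarrow> N dvd (j - i) \<and> even ((j - i) div N)"
  proof
    assume "e i = e j"
    then have "2 * N dvd i - j" by (simp add: e_eq_iff)
    then obtain k where "i - j = 2 * N * k" by blast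
    then have "j - i = (- 2 * k) * N" by (simp add: algebra_simps)
    then have "N dvd j - i" "(j - i) div N = - 2 * k"
      using N by (metis dvd_triv_right, metis nonzero_mult_div_cancel_right not_numeral_le_zero)
    then show "N dvd (j - i) \<and> even ((j - i) div N)" by simp
  next
    assume *: "N dvd (j - i) \<and> even ((j - i) div N)"
    define k where "k = (j - i) div N"
    have "j = i + k * N" "even k" using * by (auto simp: k_def)
    then show "e i = e j" using e_add_mult[of i k] by simp
  qed
  have 2: "e i = - e j \<longleftrightarrow> N dvd (j - i) \<and> odd ((j - i) div N)"
  proof
    assume "e i = - e j"
    then have "2 * N dvd i - (j + N)" by (simp add: e_uminus e_eq_iff)
    then obtain k where "i - (j + N) = 2 * N * k" by blast
    then have "j - i = (- 2 * k - 1) * N" by (simp add: algebra_simps)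
    then show "N dvd (j - i) \<and> odd ((j - i) div N)" using N by simp
  next
    assume *: "N dvd (j - i) \<and> odd ((j - i) div N)"
    define k where "k = (j - i) div N"
    have "j = i + k * N" "odd k" using * by (auto simp: k_def)
    then show "e i = - e j" using e_add_mult[of i k] by simp
  qed
  show ?thesis by (auto simp: inner_signed_basis 1 2 cdelta_def)
qed

lemma inner_e_eta [simp]: "e j \<bullet> \<eta> = 0" "\<eta> \<bullet> e j = 0"
  by (simp_all add: inner_signed_basis inner_commute[of \<eta>])

definition circ :: "(real^'n) set" where "circ = range e"

lemma circ_basis: "a \<in> circ \<Longrightarrow> a \<in> signed_basis"
  by (auto simp: circ_def)

lemma e_circ [simp]: "e j \<in> circ" by (simp add: circ_def)

lemma circ_uminus [simp]: "- a \<in> circ \<longleftrightarrow> a \<in> circ"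
proof -
  have *: "- b \<in> circ" if "b \<in> circ" for b using that by (auto simp: circ_def e_uminus)
  show ?thesis using *[of a] *[of "- a"] by auto
qed

lemma eta_notin_circ [simp]: "\<eta> \<notin> circ" "- \<eta> \<notin> circ"
proof -
  have "e j \<noteq> \<eta>" "e j \<noteq> - \<eta>" for j by simp_all
  then show "\<eta> \<notin> circ" "- \<eta> \<notin> circ" unfolding circ_def by (metis rangeE)+
qed

lemma basis_cases: "a \<in> signed_basis \<longleftrightarrow> a \<in> circ \<or> a = \<eta> \<or> a = - \<eta>"
  using cover circ_basis by (auto simp: circ_def)

lemma finite_circ [simp]: "finite circ"
  using finite_subset[of circ signed_basis] circ_basis by auto

text \<open>The sum over half of the cycle suffices since the other half consists of the negatives.
  The form is \<open>csign\<close> of the index difference on all cycle vectors, and \<eta>, being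
  orthogonal to each \<open>e i\<close>, lies in its radical. Thus \<open>S a b = 1\<close> says
  that \<open>b\<close> lies ahead of \<open>a\<close> by less than a half turn.\<close>

definition S :: "real^'n \<Rightarrow> real^'n \<Rightarrow> real" where
  "S x y = (\<Sum>i\<in>{0..<N}. \<Sum>j\<in>{0..<N}. (x \<bullet> e i) * (y \<bullet> e j) * csign N (j - i))"

lemma S_add_left: "S (x + y) z = S x z + S y z"
  by (simp add: S_def inner_add_left ring_distribs sum.distrib)

lemma S_add_right: "S z (x + y) = S z x + S z y"
  by (simp add: S_def inner_add_left ring_distribs sum.distrib)

lemma S_scaleR_left: "S (r *\<^sub>R x) z = r * S x z"
  by (simp add: S_def sum_distrib_left mult_ac)

lemma S_scaleR_right: "S z (r *\<^sub>R x) = r * S z x"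
  by (simp add: S_def sum_distrib_left mult_ac)

lemma S_uminus_left [simp]: "S (- x) y = - S x y"
  using S_scaleR_left[of "-1"] by simp

lemma S_uminus_right [simp]: "S y (- x) = - S y x"
  using S_scaleR_right[of _ "-1"] by simp

lemma S_diff_left: "S (x - y) z = S x z - S y z"
  using S_add_left[of x "- y"] by simp

lemma S_diff_right: "S z (x - y) = S z x - S z y"
  using S_add_right[of z x "- y"] by simp

lemma S_zero [simp]: "S 0 x = 0" "S x 0 = 0"
  by (simp_all add: S_def)

lemmas S_simps = S_add_left S_add_right S_scaleR_left S_scaleR_right S_diff_left S_diff_right

lemma S_eta [simp]: "S \<eta> x = 0" "S x \<eta> = 0"
  by (simp_all add: S_def)

lemma S_e: "S (e a) (e b) = csign N (b - a)"
proof -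
  have small: "S (e a) (e b) = csign N (b - a)" if "0 \<le> a" "a < N" "0 \<le> b" "b < N" for a b
  proof -
    have "e a \<bullet> e i = (if i = a then 1 else 0)" if "0 \<le> i" "i < N" "0 \<le> a" "a < N" for i a
    proof (cases "i = a")
      case False
      then have "\<not> N dvd i - a" using that zdvd_imp_le[of N "\<bar>i - a\<bar>"] by auto
      then show ?thesis using False by (simp add: inner_e_e cdelta_def)
    qed simp
    then have "S (e a) (e b) =
        (\<Sum>i\<in>{0..<N}. \<Sum>j\<in>{0..<N}. if j = b then if i = a then csign N (j - i) else 0 else 0)"
      unfolding S_def using that by (intro sum.cong refl) simp
    also have "\<dots> = csign N (b - a)"
      using that by (simp add: sum.delta)
    finally show ?thesis .
  qed
  define a' b' k l where "a' = a mod N" and "b' = b mod N" and "k = a div N" and "l = b div N"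
  have a: "a = a' + k * N" and b: "b = b' + l * N" by (simp_all add: a'_def b'_def k_def l_def)
  have "S (e a') (e b') = csign N (b' - a')" by (rule small) (use N in \<open>auto simp: a'_def b'_def\<close>)
  moreover have "csign N (b - a) = (if even (l - k) then csign N (b' - a') else - csign N (b' - a'))"
    using csign_add_mult[of N "b' - a'" "l - k"] N by (simp add: a b algebra_simps)
  ultimately show ?thesis by (auto simp: a b e_add_mult)
qed

text \<open>Reduces to \<open>csign\<close> being odd: the reflection r to 2 N - r exchanges the two
  half turns.\<close>

lemma S_skew: "S x y = - S y x"
proof -
  have *: "csign N (- d) = - csign N d" for d
  proof (cases "N dvd d")
    case False
    define r where "r = d mod (2 * N)"
    have "\<not> N dvd r" using False N by (simp add: r_def dvd_mod_iff)
    moreover have "0 \<le> r" "r < 2 * N" using N by (simp_all add: r_def)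
    moreover have "r \<noteq> 0" "r \<noteq> N" using \<open>\<not> N dvd r\<close> by auto
    ultimately have r: "0 < r" "r < 2 * N" "r \<noteq> N" by linarith+
    then have mod: "(- d) mod (2 * N) = 2 * N - r" by (simp add: zmod_zminus1_eq_if r_def)
    show ?thesis
    proof (cases "r < N")
      case True
      then have "csign N d = 1" "csign N (- d) = -1"
        using csign_eq_1_iff(1)[of N d] csign_eq_1_iff(2)[of N "- d"] N r mod by (auto simp flip: r_def)
      then show ?thesis by simp
    next
      case False
      then have "csign N d = -1" "csign N (- d) = 1"
        using csign_eq_1_iff(2)[of N d] csign_eq_1_iff(1)[of N "- d"] N r mod by (auto simp flip: r_def)
      then show ?thesis by simp
    qed
  qed (simp add: csign_def)
  have "S (e i) (e j) + S (e j) (e i) = 0" for i j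
    unfolding S_e using *[of "j - i"] unfolding minus_diff_eq by linarith
  then have "S a b + S b a = 0" if "a \<in> circ" "b \<in> circ" for a b
    using that unfolding circ_def by blast
  then have basis: "S a b + S b a = 0" if "a \<in> signed_basis" "b \<in> signed_basis" for a b
    using that by (auto simp: basis_cases)
  have "S x y + S y x = 0"
    by (rule bilinear_zero_on_signed_basis[of "\<lambda>x y. S x y + S y x"])
      (simp_all add: S_add_left S_add_right S_scaleR_left S_scaleR_right basis ring_distribs)
  then show ?thesis by simp
qed

lemma S_self [simp]: "S x x = 0"
  using S_skew[of x x] by simp

lemma S_c [simp]: "S (c *v x) (c *v y) = S x y"
proof -
  have "S (c *v x) (c *v y) - S x y = 0"
  proof (rule bilinear_zero_on_signed_basis[of "\<lambda>x y. S (c *v x) (c *v y) - S x y"], goal_cases)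
    case (5 a b)
    have "S (c *v e i) (c *v e j) = S (e i) (e j)" for i j by (simp add: c_e S_e)
    then have "S (c *v a) (c *v b) = S a b" if "a \<in> circ" "b \<in> circ" for a b
      using that unfolding circ_def by blast
    then show ?case using 5 by (auto simp: basis_cases c_eta matrix_vector_mult_uminus)
  qed (simp_all add: S_add_left S_add_right S_scaleR_left S_scaleR_right
      matrix_vector_right_distrib matrix_vector_mult_scaleR right_diff_distrib)
  then show ?thesis by simp
qed

subsection \<open>Noncrossing elements\<close>

text \<open>For \<open>w\<close> in the Weyl group this says that \<open>w\<close> lies below \<open>c\<close> in the absolute order: the form
  \<open>S\<close> is the Cayley transform of \<open>c\<close>. On basis vectors it says that the chords
  \<open>x \<rightarrow> w x\<close> and \<open>y \<rightarrow> w y\<close> do not cross.\<close>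

definition nc :: "real^'n^'n \<Rightarrow> bool" where
  "nc w \<longleftrightarrow> (\<forall>x y. S (w *v x - x) (w *v y - y) = (w *v x) \<bullet> y - x \<bullet> (w *v y))"

lemma ncD: "nc w \<Longrightarrow> S (w *v x - x) (w *v y - y) = (w *v x) \<bullet> y - x \<bullet> (w *v y)"
  by (simp add: nc_def)

lemma ncD':
  "nc w \<Longrightarrow> S (w *v x) (w *v y) - S (w *v x) y - S x (w *v y) + S x y = (w *v x) \<bullet> y - x \<bullet> (w *v y)"
  using ncD[of w x y] by (simp add: S_simps)

text \<open>On cycle vectors the left side is minus a second difference of \<open>csign\<close>, and
  subtracting two instances of \<open>csign_diff_eq\<close> leaves exactly the two inner products.
  On the line of \<eta> the element acts symmetrically and \<open>S\<close> vanishes.\<close>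

lemma nc_c: "nc c"
proof -
  have "S (c *v x - x) (c *v y - y) - ((c *v x) \<bullet> y - x \<bullet> (c *v y)) = 0" for x y
  proof (rule bilinear_zero_on_signed_basis[of
        "\<lambda>x y. S (c *v x - x) (c *v y - y) - ((c *v x) \<bullet> y - x \<bullet> (c *v y))"], goal_cases)
    case (5 a b)
    have "S (e (i + 1) - e i) (e (j + 1) - e j) = cdelta N (j - (i + 1)) - cdelta N (j + 1 - i)" for i j
    proof -
      define d where "d = j - i"
      have "csign N (d + 1) - csign N d = cdelta N d + cdelta N (d + 1)"
        "csign N d - csign N (d - 1) = cdelta N (d - 1) + cdelta N d"
        using csign_diff_eq[OF N, of d] csign_diff_eq[OF N, of "d - 1"] by simp_all
      moreover have eqs: "j + 1 - (i + 1) = d" "j + 1 - i = d + 1" "j - (i + 1) = d - 1" "j - i = d"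
        by (simp_all add: d_def)
      ultimately show ?thesis unfolding S_simps S_e eqs by linarith
    qed
    then have "S (c *v e i - e i) (c *v e j - e j) = (c *v e i) \<bullet> e j - e i \<bullet> (c *v e j)" for i j
      by (simp add: c_e inner_e_e)
    then have circ: "S (c *v a - a) (c *v b - b) = (c *v a) \<bullet> b - a \<bullet> (c *v b)" if "a \<in> circ" "b \<in> circ" for a b
      using that unfolding circ_def by blast
    have "(c *v e j) \<bullet> \<eta> = 0" "\<eta> \<bullet> (c *v e j) = 0" for j by (simp_all add: c_e)
    then have "(c *v a) \<bullet> \<eta> = 0" "\<eta> \<bullet> (c *v a) = 0" "a \<bullet> \<eta> = 0" "\<eta> \<bullet> a = 0" if "a \<in> circ" for a
      using that unfolding circ_def by (blast, blast, auto)
    then show ?case using 5 circ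
      by (auto simp: basis_cases c_eta S_simps matrix_vector_mult_uminus)
  qed (simp_all add: S_simps inner_add_left inner_add_right
      matrix_vector_right_distrib matrix_vector_mult_scaleR right_diff_distrib distrib_left)
  then show ?thesis by (simp add: nc_def)
qed

text \<open>Symmetry makes the right side of the identity vanish. This serves the base cases, which
  are involutions with \<open>S\<close>-isotropic moved space.\<close>

lemma nc_if_symmetric:
  assumes "\<And>x. transpose w *v x = w *v x" "\<And>x y. S (w *v x - x) (w *v y - y) = 0"
  shows "nc w"
  using assms inner_transpose[of w] by (simp add: nc_def)

text \<open>Both \<open>S\<close> and the inner product are invariant under
  \<open>c\<close>.\<close>

lemma nc_conj:
  assumes "nc w"
  shows "nc (c ** w ** transpose c)"
  unfolding nc_def
proof (intro allI)
  fix x y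
  let ?x = "transpose c *v x" and ?y = "transpose c *v y"
  have x: "x = c *v ?x" and y: "y = c *v ?y" using c_weyl weyl_transpose_mult_vec(2) by metis+
  have w: "(c ** w ** transpose c) *v z = c *v (w *v (transpose c *v z))" for z
    by (simp only: matrix_vector_mul_assoc[symmetric])
  have "S (c *v (w *v ?x - ?x)) (c *v (w *v ?y - ?y)) = (c *v (w *v ?x)) \<bullet> (c *v ?y) - (c *v ?x) \<bullet> (c *v (w *v ?y))"
    using ncD[OF assms, of ?x ?y] by (simp only: S_c weyl_inner[OF c_weyl])
  then show "S ((c ** w ** transpose c) *v x - x) ((c ** w ** transpose c) *v y - y) =
       ((c ** w ** transpose c) *v x) \<bullet> y - x \<bullet> ((c ** w ** transpose c) *v y)"
    unfolding w matrix_vector_mult_diff_distrib x[symmetric] y[symmetric] .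
qed

end

declare transpose_matrix_vector [simp del]

section \<open>Reflection length\<close>

text \<open>On the point with all coordinates 1 such an element would change one sign, which is
  possible only in the presence of a vanishing coordinate.\<close>

lemma weyl_not_single_flip:
  fixes w :: "real^'n^'n"
  assumes w: "w \<in> weyl_group_D" and a: "a \<in> signed_basis"
    and off: "\<And>b. b \<in> signed_basis \<Longrightarrow> b \<noteq> a \<Longrightarrow> b \<noteq> - a \<Longrightarrow> w *v b = b"
  shows "w *v a \<noteq> - a"
proof
  assume wa: "w *v a = - a"
  define z :: "complex^'n" where "z = (\<chi> i. 1)"
  have nz: "coord z b \<noteq> 0" if b: "b \<in> signed_basis" for b
  proof -
    obtain i s where s: "s = 1 \<or> s = -1" "b = s *\<^sub>R axis i (1::real)" using signed_basisE[OF b] .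
    have "coord z b = of_real s" by (simp add: s(2) z_def)
    then show ?thesis using s(1) by auto
  qed
  have "complexify w *v z = upd z a (- coord z a)"
  proof (rule coord_ext)
    fix b :: "real^'n" assume b: "b \<in> signed_basis"
    have *: "coord (complexify w *v z) (w *v x) = coord z x" for x by (rule coord_complexify_mult_vec[OF w])
    show "coord (complexify w *v z) b = coord (upd z a (- coord z a)) b"
    proof (cases "b = a \<or> b = - a")
      case True
      have "- coord (complexify w *v z) a = coord z a" using *[of a] wa by simp
      then have "coord (complexify w *v z) a = - coord z a" by (metis minus_minus)
      then show ?thesis using True a by auto
    next
      case False
      then show ?thesis using *[of b] off[OF b] coord_upd_other[OF a b] by simp
    qed
  qed
  then show False using weyl_flip_imp_zero[OF w a] nz by blast
qed

lemma fixed_space_subspace: "subspace (fixed_space w)"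
  by (auto simp: fixed_space_def subspace_def matrix_vector_right_distrib matrix_vector_mult_scaleR)

lemma fixed_space_transpose:
  assumes "w \<in> weyl_group_D"
  shows "fixed_space (transpose w) = fixed_space w"
  using assms by (auto simp: fixed_space_def) (metis weyl_transpose_mult_vec)+

lemma mat_prod_Cons: "mat_prod (w # ws) = w ** mat_prod ws"
  and mat_prod_Nil: "mat_prod [] = mat 1"
  by (simp_all add: mat_prod_def)

lemma mat_prod_append: "mat_prod (us @ vs) = mat_prod us ** mat_prod vs"
  by (induction us) (simp_all add: mat_prod_Cons mat_prod_Nil matrix_mul_assoc)

text \<open>Vectors fixed by \<open>w\<close> and orthogonal to the root remain fixed, and a
  hyperplane cuts the dimension by at most one.\<close>

lemma dim_fixed_space_mult_reflection:
  "dim (fixed_space w) \<le> dim (fixed_space (reflection_along \<alpha> ** w)) + 1"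
proof (cases "\<alpha> = 0")
  case True
  then have "reflection_along \<alpha> = mat 1" by (simp add: matrix_eq reflection_along_mult_vec)
  then show ?thesis by simp
next
  case False
  let ?H = "{x. \<alpha> \<bullet> x = 0}"
  have "dim {x + y |x y. x \<in> fixed_space w \<and> y \<in> ?H} + dim (fixed_space w \<inter> ?H) = dim (fixed_space w) + dim ?H"
    by (rule dim_sums_Int[OF fixed_space_subspace subspace_hyperplane])
  moreover have "dim {x + y |x y. x \<in> fixed_space w \<and> y \<in> ?H} \<le> CARD('a)"
    using dim_subset_UNIV[of "{x + y |x y. x \<in> fixed_space w \<and> y \<in> ?H}"] by simp
  moreover have "dim ?H = CARD('a) - 1" using dim_hyperplane[OF False] by simp
  ultimately have "dim (fixed_space w) \<le> dim (fixed_space w \<inter> ?H) + 1" by simp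
  also have "dim (fixed_space w \<inter> ?H) \<le> dim (fixed_space (reflection_along \<alpha> ** w))"
    by (rule dim_subset)
      (auto simp: fixed_space_def matrix_vector_mul_assoc[symmetric] reflection_along_mult_vec inner_commute)
  finally show ?thesis by simp
qed

lemma codim_fixed_space_le:
  fixes ts :: "(real^'n^'n) list"
  assumes "set ts \<subseteq> reflections W"
  shows "CARD('n) \<le> length ts + dim (fixed_space (mat_prod ts))"
  using assms
proof (induction ts)
  case Nil
  have "fixed_space (mat 1 :: real^'n^'n) = UNIV" by (auto simp: fixed_space_def)
  then show ?case by (simp add: mat_prod_Nil)
next
  case (Cons t ts)
  then obtain \<alpha> where "t = reflection_along \<alpha>" by (auto simp: reflections_def)
  then have "dim (fixed_space (mat_prod ts)) \<le> dim (fixed_space (mat_prod (t # ts))) + 1"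
    using dim_fixed_space_mult_reflection[of "mat_prod ts" \<alpha>] by (simp add: mat_prod_Cons)
  then show ?case using Cons by simp
qed

text \<open>Carter's observation: if \<open>w x - x\<close> is a root, then its reflection exchanges \<open>x\<close> and \<open>w x\<close>.\<close>

lemma weyl_moves_along_root:
  assumes w: "w \<in> weyl_group_D" and neq: "w \<noteq> mat 1"
  shows "\<exists>x u v. u \<in> signed_basis \<and> v \<in> signed_basis \<and> u \<noteq> v \<and> u \<noteq> - v \<and> w *v x - x = u - v"
proof (cases "\<exists>a\<in>signed_basis. w *v a \<noteq> a \<and> w *v a \<noteq> - a")
  case True
  then show ?thesis using weyl_signed_basis[OF w] by metis
next
  case False
  obtain a where a: "a \<in> signed_basis" "w *v a \<noteq> a"
    using matrix_eq_on_signed_basis[of w "mat 1"] neq by auto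
  then have wa: "w *v a = - a" using False by blast
  obtain b where b: "b \<in> signed_basis" "b \<noteq> a" "b \<noteq> - a" "w *v b \<noteq> b"
    using weyl_not_single_flip[OF w a(1)] wa by blast
  then have wb: "w *v b = - b" using False by blast
  \<comment> \<open>All basis lines are preserved here, so by parity two of them are negated; on
    this vector \<open>w\<close> minus the identity gives a + b, which is a root.\<close>
  let ?x = "(- 1 / 2) *\<^sub>R (a + b)"
  have "w *v ?x - ?x = a - (- b)"
    unfolding matrix_vector_mult_scaleR matrix_vector_right_distrib wa wb
    by (simp add: vec_eq_iff field_simps)
  moreover have "a \<noteq> - b" using b(3) by (metis minus_minus)
  moreover have "a \<noteq> - (- b)" using b(2) by auto
  ultimately show ?thesis using a b by (metis uminus_in_signed_basis)
qed

text \<open>Composing with the reflection that exchanges \<open>x\<close> and \<open>w *v x\<close>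
  keeps all fixed vectors, since these are orthogonal to the root, and adds \<open>x\<close>. So
  each factor gains at least one dimension of fixed space.\<close>

lemma weyl_reflection_factorization:
  fixes w :: "real^'n^'n"
  assumes "w \<in> weyl_group_D"
  shows "\<exists>ts. set ts \<subseteq> reflections weyl_group_D \<and> mat_prod ts = w \<and> length ts + dim (fixed_space w) \<le> CARD('n)"
  using assms
proof (induction "CARD('n) - dim (fixed_space w)" arbitrary: w rule: less_induct)
  case less
  note w = less.prems
  show ?case
  proof (cases "w = mat 1")
    case True
    have "fixed_space (mat 1 :: real^'n^'n) = UNIV" by (auto simp: fixed_space_def)
    then show ?thesis using True by (intro exI[of _ "[]"]) (simp add: mat_prod_Nil)
  next
    case False
    then obtain x u v where uv: "u \<in> signed_basis" "v \<in> signed_basis" "u \<noteq> v" "u \<noteq> - v" "w *v x - x = u - v"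
      using weyl_moves_along_root[OF w] by blast
    let ?t = "reflection_along (u - v)"
    let ?w = "?t ** w"
    have tr: "?t \<in> reflections weyl_group_D" and tw: "?t \<in> weyl_group_D"
      using swap_in_reflections[OF uv(1-4)] swap_in_weyl[OF uv(1-4)] by auto
    \<comment> \<open>Since x and w x = x + (u - v) have equal length, x pairs to -1 with the root,
      and the reflection carries w x back to x.\<close>
    have "(w *v x) \<bullet> (w *v x) = x \<bullet> x" using w by simp
    moreover have wx: "w *v x = x + (u - v)" using uv(5) by (simp add: algebra_simps)
    ultimately have "(u - v) \<bullet> (u - v) + 2 * (x \<bullet> (u - v)) = 0"
      by (simp add: inner_add_left inner_add_right inner_commute)
    then have "x \<bullet> (u - v) = -1" using norm_diff_xy[OF uv(1-4)] by simp
    then have "(w *v x) \<bullet> (u - v) = 1" using norm_diff_xy[OF uv(1-4)] by (simp add: wx inner_add_left)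
    then have "?w *v x = x"
      using swap_mult_vec[OF uv(1-4), of "w *v x"] by (simp add: matrix_vector_mul_assoc[symmetric] wx)
    then have x: "x \<in> fixed_space ?w" "x \<notin> fixed_space w" using uv(3,5) by (auto simp: fixed_space_def)
    have sub: "fixed_space w \<subseteq> fixed_space ?w"
    proof
      fix y assume "y \<in> fixed_space w"
      then have y: "w *v y = y" by (simp add: fixed_space_def)
      have "(w *v y) \<bullet> (w *v x) = y \<bullet> x" using w by simp
      then have "y \<bullet> (u - v) = 0" by (simp add: y wx inner_add_right)
      then show "y \<in> fixed_space ?w"
        using swap_mult_vec[OF uv(1-4), of y] y by (simp add: fixed_space_def matrix_vector_mul_assoc[symmetric])
    qed
    have "dim (fixed_space w) < dim (fixed_space ?w)"
      using x sub by (intro dim_psubset) (auto simp: span_eq_iff[THEN iffD2, OF fixed_space_subspace])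
    moreover have "dim (fixed_space ?w) \<le> CARD('n)" using dim_subset_UNIV[of "fixed_space ?w"] by simp
    ultimately obtain ts where ts: "set ts \<subseteq> reflections weyl_group_D" "mat_prod ts = ?w"
      "length ts + dim (fixed_space ?w) \<le> CARD('n)"
      using less.hyps[OF _ weyl_mult[OF tw w]] by (metis diff_less_mono2 less_le_trans)
    have "mat_prod (?t # ts) = w"
      by (simp add: mat_prod_Cons ts(2) matrix_mul_assoc reflection_along_square)
    then show ?thesis
      using ts tr \<open>dim (fixed_space w) < dim (fixed_space ?w)\<close> by (intro exI[of _ "?t # ts"]) simp
  qed
qed

text \<open>Carter's formula, written as a sum to avoid natural subtraction; one reflection changes
  the fixed dimension by at most one, and the factorization above attains the bound.\<close>

lemma reflection_length_eq:
  fixes w :: "real^'n^'n"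
  assumes w: "w \<in> weyl_group_D"
  shows "reflection_length weyl_group_D w + dim (fixed_space w) = CARD('n)"
proof -
  obtain ts where ts: "set ts \<subseteq> reflections weyl_group_D" "mat_prod ts = w" "length ts + dim (fixed_space w) \<le> CARD('n)"
    using weyl_reflection_factorization[OF w] by blast
  have "reflection_length weyl_group_D w = length ts"
    unfolding reflection_length_def
  proof (rule Least_equality)
    fix k assume "\<exists>us. length us = k \<and> set us \<subseteq> reflections weyl_group_D \<and> mat_prod us = w"
    then show "length ts \<le> k" using codim_fixed_space_le ts(3) by force
  qed (use ts in blast)
  moreover have "CARD('n) \<le> length ts + dim (fixed_space w)" using codim_fixed_space_le[OF ts(1)] ts(2) by simp
  ultimately show ?thesis using ts(3) by simp
qed

lemma transpose_fixedI:
  fixes w :: "real^'n^'n"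
  assumes "\<And>x. (w *v x - x) \<bullet> v = 0"
  shows "transpose w *v v = v"
proof -
  have "(transpose w *v v) \<bullet> x = v \<bullet> x" for x
    using assms[of x] unfolding inner_transpose inner_diff_left by (simp add: inner_commute)
  then show ?thesis by (metis vector_eq_rdot)
qed

text \<open>The image is the orthogonal complement of the kernel of the adjoint, and an orthogonal
  map and its transpose have the same fixed space.\<close>

lemma range_minus_id:
  fixes w :: "real^'n^'n"
  assumes w: "w \<in> weyl_group_D"
  shows "range (\<lambda>x. w *v x - x) = {y. \<forall>x. w *v x = x \<longrightarrow> x \<bullet> y = 0}"
proof -
  define f where "f x = transpose w *v x - x" for x
  have f: "f = (\<lambda>x. (transpose w - mat 1) *v x)" by (rule ext) (simp add: f_def matrix_vector_mult_diff_rdistrib)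
  have lin: "linear f" by (simp add: f)
  have "transpose (transpose w - mat 1) = w - mat 1"
    by (auto simp: transpose_def mat_def vec_eq_iff)
  then have adj: "adjoint f = (\<lambda>x. w *v x - x)"
    unfolding f adjoint_matrix by (simp add: fun_eq_iff matrix_vector_mult_diff_rdistrib)
  have "linear (\<lambda>x. w *v x - x)" using adjoint_linear[OF lin] adj by simp
  then have sub: "subspace (range (\<lambda>x. w *v x - x))"
    using linear_subspace_image subspace_UNIV by blast
  have "f -` {0} = fixed_space w"
  proof -
    have "f -` {0} = fixed_space (transpose w)" by (auto simp: f_def fixed_space_def)
    then show ?thesis by (simp only: fixed_space_transpose[OF w])
  qed
  then have "fixed_space w = (range (\<lambda>x. w *v x - x))\<^sup>\<bottom>" using ker_orthogonal_comp_adjoint[OF lin] adj by simp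
  then have "range (\<lambda>x. w *v x - x) = (fixed_space w)\<^sup>\<bottom>" using orthogonal_comp_self[OF sub] by simp
  then show ?thesis by (auto simp: orthogonal_comp_def fixed_space_def orthogonal_def)
qed

section \<open>The absolute order below the Coxeter element\<close>

context D_frame
begin

text \<open>The pairing of a fixed vector with \<open>e j\<close> does not depend on
  \<open>j\<close>, but changes sign after \<open>N\<close> steps.\<close>

lemma fixed_space_c: "fixed_space c = {0}"
proof -
  have "x = 0" if x: "c *v x = x" for x
  proof (rule signed_basis_ext)
    have step: "x \<bullet> e (j + 1) = x \<bullet> e j" for j
      using weyl_inner[OF c_weyl, of x "e j"] x by (simp add: c_e)
    have nat: "x \<bullet> e (j + int k) = x \<bullet> e j" for j k
    proof (induction k)
      case (Suc k)
      have "x \<bullet> e (j + int (Suc k)) = x \<bullet> e ((j + int k) + 1)" by (simp add: algebra_simps)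
      then show ?case using Suc step by simp
    qed simp
    have "x \<bullet> e (j + N) = x \<bullet> e j" for j using nat[of j "nat N"] N by simp
    then have e0: "x \<bullet> e j = 0" for j by (simp add: e_antiperiodic equal_neg_zero)
    have eta0: "x \<bullet> \<eta> = 0"
      using weyl_inner[OF c_weyl, of x \<eta>] x by (simp add: c_eta)
    fix a :: "real^'n" assume "a \<in> signed_basis"
    then show "x \<bullet> a = 0 \<bullet> a" using e0 eta0 by (auto simp: basis_cases circ_def)
  qed
  then show ?thesis by (auto simp: fixed_space_def)
qed

lemma range_c_minus_id: "range (\<lambda>x. c *v x - x) = UNIV"
proof -
  have "x = 0" if "c *v x = x" for x
  proof -
    have "x \<in> fixed_space c" using that by (simp add: fixed_space_def)
    then show ?thesis by (simp add: fixed_space_c)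
  qed
  then have "x \<bullet> y = 0" if "c *v x = x" for x y using that by (metis inner_zero_left)
  then show ?thesis unfolding range_minus_id[OF c_weyl] by blast
qed

text \<open>As \<open>c\<close> fixes only 0, Carter's formula turns the order relation into the
  decomposition of the space into the fixed space of \<open>w\<close> and the space on which
  \<open>w\<close> and \<open>c\<close> agree. On the latter the identity for \<open>w\<close> is
  the one for \<open>c\<close>; on the former \<open>w\<close> minus the identity vanishes.
  Conversely, for given \<open>u\<close> one solves \<open>c *v b - b = w *v u - u\<close>; the two
  identities make u - b orthogonal to the moved space of \<open>w\<close>, hence fixed, and u = (u -
  b) + b is the required decomposition.\<close>

lemma absolute_le_iff_nc:
  assumes w: "w \<in> weyl_group_D"
  shows "absolute_le weyl_group_D w c \<longleftrightarrow> nc w"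
proof -
  let ?A = "fixed_space w" and ?B = "fixed_space (transpose w ** c)"
  have B: "b \<in> ?B \<longleftrightarrow> w *v b = c *v b" for b
  proof -
    have "transpose w *v (c *v b) = b \<longleftrightarrow> w *v b = c *v b" by (metis w weyl_transpose_mult_vec)
    then show ?thesis by (simp add: fixed_space_def matrix_vector_mul_assoc[symmetric])
  qed
  have A: "a \<in> ?A \<longleftrightarrow> w *v a = a" for a by (simp add: fixed_space_def)
  have int: "?A \<inter> ?B = {0}"
  proof (intro equalityI subsetI)
    fix b assume "b \<in> ?A \<inter> ?B"
    then have "w *v b = b" "w *v b = c *v b" unfolding A[symmetric] B[symmetric] by blast+
    then have "b \<in> fixed_space c" by (simp add: fixed_space_def)
    then show "b \<in> {0}" by (simp add: fixed_space_c)
  qed (simp add: fixed_space_def)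
  have "absolute_le weyl_group_D w c \<longleftrightarrow> CARD('n) = dim ?A + dim ?B"
    using reflection_length_eq[OF w] reflection_length_eq[OF c_weyl]
      reflection_length_eq[OF weyl_mult[OF weyl_transpose[OF w] c_weyl]]
    by (auto simp: absolute_le_def weyl_matrix_inv[OF w] fixed_space_c)
  also have "\<dots> \<longleftrightarrow> {x + y |x y. x \<in> ?A \<and> y \<in> ?B} = UNIV"
  proof -
    define Z where "Z = {x + y |x y. x \<in> ?A \<and> y \<in> ?B}"
    have "dim Z + dim (?A \<inter> ?B) = dim ?A + dim ?B"
      unfolding Z_def by (rule dim_sums_Int[OF fixed_space_subspace fixed_space_subspace])
    then have dZ: "dim ?A + dim ?B = dim Z" by (simp add: int)
    have "subspace Z"
      unfolding Z_def by (rule subspace_sums[OF fixed_space_subspace fixed_space_subspace])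
    then have "span Z = Z" by (simp only: span_eq_iff)
    then have "dim Z = CARD('n) \<longleftrightarrow> Z = UNIV" using dim_eq_full[of Z] by (metis DIM_cart DIM_real mult.right_neutral)
    then have "CARD('n) = dim Z \<longleftrightarrow> Z = UNIV" by (simp only: eq_commute)
    then show ?thesis by (simp only: dZ Z_def)
  qed
  also have "\<dots> \<longleftrightarrow> nc w"
  proof
    assume sum: "{x + y |x y. x \<in> ?A \<and> y \<in> ?B} = UNIV"
    show "nc w"
      unfolding nc_def
    proof (intro allI)
      fix x y
      obtain a b where x: "x = a + b" "a \<in> ?A" "b \<in> ?B" using sum by blast
      obtain a' b' where y: "y = a' + b'" "a' \<in> ?A" "b' \<in> ?B" using sum by blast
      have eqs: "w *v a = a" "w *v a' = a'" "w *v b = c *v b" "w *v b' = c *v b'" using x y by (auto simp: A B)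
      have inv: "(w *v u) \<bullet> (w *v v) = u \<bullet> v" for u v using w by simp
      \<comment> \<open>Orthogonality of \<open>w\<close> cancels the mixed terms of the two
        summands.\<close>
      have cross: "a \<bullet> (c *v b') = a \<bullet> b'" "(c *v b) \<bullet> a' = b \<bullet> a'"
        using inv[of a b'] inv[of b a'] eqs by simp_all
      have "S (w *v x - x) (w *v y - y) = S (c *v b - b) (c *v b' - b')"
        by (simp add: x(1) y(1) matrix_vector_right_distrib eqs)
      also have "\<dots> = (c *v b) \<bullet> b' - b \<bullet> (c *v b')" by (rule ncD[OF nc_c])
      also have "\<dots> = (w *v x) \<bullet> y - x \<bullet> (w *v y)"
        using cross by (simp add: x(1) y(1) matrix_vector_right_distrib eqs inner_add_left inner_add_right)
      finally show "S (w *v x - x) (w *v y - y) = (w *v x) \<bullet> y - x \<bullet> (w *v y)" .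
    qed
  next
    assume nc: "nc w"
    have "u \<in> {x + y |x y. x \<in> ?A \<and> y \<in> ?B}" for u
    proof -
      define y where "y = w *v u - u"
      have "y \<in> range (\<lambda>x. c *v x - x)"
        by (simp only: range_c_minus_id UNIV_I)
      then obtain b where b: "c *v b - b = y" by auto
      \<comment> \<open>For orthogonal \<open>g\<close> the right side of the identity depends on
        \<open>x\<close> only through the displacement g x - x, so displacements arising from
        \<open>w\<close> and from \<open>c\<close> can be compared.\<close>
      have half: "2 * (yx \<bullet> v) + yx \<bullet> (g *v v - v) = (g *v x) \<bullet> v - x \<bullet> (g *v v)"
        if "g \<in> weyl_group_D" "yx = g *v x - x" for g yx x v
        using weyl_inner[OF that(1), of x v] by (simp add: that(2) inner_diff_left inner_diff_right)
      have orth: "(w *v x - x) \<bullet> (u - b) = 0" for x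
      proof -
        have "w *v x - x \<in> range (\<lambda>x. c *v x - x)"
          by (simp only: range_c_minus_id UNIV_I)
        then obtain x' where x': "w *v x - x = c *v x' - x'" by auto
        have "2 * ((w *v x - x) \<bullet> u) + (w *v x - x) \<bullet> y = S (w *v x - x) y"
          using half[OF w refl, of x u] ncD[OF nc, of x u] by (simp add: y_def)
        also have "\<dots> = S (c *v x' - x') (c *v b - b)" by (simp only: x' b)
        also have "\<dots> = 2 * ((w *v x - x) \<bullet> b) + (w *v x - x) \<bullet> y"
          using half[OF c_weyl x', of b] ncD[OF nc_c, of x' b] b by simp
        finally show ?thesis by (simp add: inner_diff_right)
      qed
      have "transpose w *v (u - b) = u - b"
        by (rule transpose_fixedI) (rule orth)
      then have a: "w *v (u - b) = u - b" by (metis w weyl_transpose_mult_vec(2))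
      then have "w *v b = c *v b" using b by (simp add: y_def matrix_vector_mult_diff_distrib algebra_simps)
      moreover have "u = (u - b) + b" by simp
      ultimately show ?thesis using a A B by blast
    qed
    then show "{x + y |x y. x \<in> ?A \<and> y \<in> ?B} = UNIV" by blast
  qed
  finally show ?thesis .
qed

text \<open>Equal fixed spaces give equal moved spaces. If w u - u = w' u' - u', comparing the
  identities for \<open>w\<close> and \<open>w'\<close> on the moved space shows that u - u' is
  orthogonal to it, hence fixed by both elements, and so w u = w' u.\<close>

lemma nc_fixed_space_inj:
  assumes w: "w \<in> weyl_group_D" "nc w" and w': "w' \<in> weyl_group_D" "nc w'"
    and eq: "fixed_space w = fixed_space w'"
  shows "w = w'"
proof -
  have fixed: "w *v x = x \<longleftrightarrow> w' *v x = x" for x using eq by (auto simp: fixed_space_def)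
  have range: "range (\<lambda>x. w *v x - x) = range (\<lambda>x. w' *v x - x)"
    unfolding range_minus_id[OF w(1)] range_minus_id[OF w'(1)] by (simp add: fixed)
  have "w *v u = w' *v u" for u
  proof -
    obtain u' where u': "w *v u - u = w' *v u' - u'" using range by blast
    have half: "2 * (yx \<bullet> v) + yx \<bullet> (g *v v - v) = (g *v x) \<bullet> v - x \<bullet> (g *v v)"
      if "g \<in> weyl_group_D" "yx = g *v x - x" for g yx x v
      using weyl_inner[OF that(1), of x v] by (simp add: that(2) inner_diff_left inner_diff_right)
    have "y \<bullet> (u - u') = 0" if y: "y \<in> range (\<lambda>x. w *v x - x)" for y
    proof -
      obtain x where x: "y = w *v x - x" using y by blast
      obtain x' where x': "y = w' *v x' - x'" using y range by blast
      have "2 * (y \<bullet> u) + y \<bullet> (w *v u - u) = S y (w *v u - u)"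
        using half[OF w(1) x, of u] ncD[OF w(2), of x u] x by simp
      moreover have "2 * (y \<bullet> u') + y \<bullet> (w' *v u' - u') = S y (w' *v u' - u')"
        using half[OF w'(1) x', of u'] ncD[OF w'(2), of x' u'] x' by simp
      ultimately show ?thesis using u' by (simp add: inner_diff_right)
    qed
    then have orth: "(w *v x - x) \<bullet> (u - u') = 0" for x by blast
    have "transpose w *v (u - u') = u - u'"
      by (rule transpose_fixedI) (rule orth)
    then have "w *v (u - u') = u - u'" by (metis w(1) weyl_transpose_mult_vec(2))
    then have "w' *v (u - u') = u - u'" using fixed by blast
    then have "w' *v u = (u - u') + w' *v u'" by (simp add: matrix_vector_mult_diff_distrib algebra_simps)
    also have "\<dots> = w *v u" using u' by (simp add: algebra_simps)
    finally show ?thesis by simp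
  qed
  then show ?thesis by (simp add: matrix_eq)
qed

end

section \<open>Simple systems of type D\<close>

text \<open>The roots of type D scaled to length 1, as \<open>unit_roots\<close> demands.
  Differences suffice because \<open>y\<close> may be replaced by \<open>- y\<close>.\<close>

definition unit_root :: "real^'n \<Rightarrow> real^'n \<Rightarrow> real^'n" where
  "unit_root x y = (1 / sqrt 2) *\<^sub>R (x - y)"

lemma unit_root_inner_self:
  assumes "x \<in> signed_basis" "y \<in> signed_basis" "x \<noteq> y" "x \<noteq> - y"
  shows "unit_root x y \<bullet> unit_root x y = 1"
  using norm_diff_xy[OF assms] by (simp add: unit_root_def)

lemma unit_root_in_unit_roots:
  assumes "x \<in> signed_basis" "y \<in> signed_basis" "x \<noteq> y" "x \<noteq> - y"
  shows "unit_root x y \<in> unit_roots weyl_group_D"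
proof -
  have "norm (unit_root x y) = 1" using unit_root_inner_self[OF assms] by (simp add: norm_eq_1)
  moreover have "reflection_along (unit_root x y) = reflection_along (x - y)"
    unfolding unit_root_def by (rule reflection_along_scaleR) simp
  ultimately show ?thesis using swap_in_weyl[OF assms] by (simp add: unit_roots_def)
qed

text \<open>The reflection moves some basis vector \<open>a\<close> to a basis vector
  \<open>b\<close>, and a - b is a multiple of the root. The case b = - a would be a single sign
  change.\<close>

lemma unit_rootsE:
  assumes "\<alpha> \<in> unit_roots weyl_group_D"
  obtains x y where "x \<in> signed_basis" "y \<in> signed_basis" "x \<noteq> y" "x \<noteq> - y" "\<alpha> = unit_root x y"
proof -
  let ?t = "reflection_along \<alpha>"
  have t: "?t \<in> weyl_group_D" and n: "\<alpha> \<bullet> \<alpha> = 1" using assms by (auto simp: unit_roots_def norm_eq_1)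
  have mult: "?t *v v = v - (2 * (v \<bullet> \<alpha>)) *\<^sub>R \<alpha>" for v by (simp add: reflection_along_mult_vec n)
  have "?t \<noteq> mat 1"
  proof
    assume "?t = mat 1"
    then have "?t *v \<alpha> = \<alpha>" by simp
    then have "\<alpha> = 0" by (simp add: mult n)
    then show False using n by simp
  qed
  then obtain a where a: "a \<in> signed_basis" "?t *v a \<noteq> a"
    using matrix_eq_on_signed_basis[of ?t "mat 1"] by auto
  define b where "b = ?t *v a"
  have b: "b \<in> signed_basis" unfolding b_def by (rule weyl_signed_basis[OF t a(1)])
  have ab: "a - b = (2 * (a \<bullet> \<alpha>)) *\<^sub>R \<alpha>" by (simp add: b_def mult)
  have "b \<noteq> - a"
  proof
    assume ba: "b = - a"
    have "?t *v v = v" if v: "v \<in> signed_basis" "v \<noteq> a" "v \<noteq> - a" for v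
    proof -
      have "(2 * (a \<bullet> \<alpha>)) * (v \<bullet> \<alpha>) = v \<bullet> (a - b)" by (simp add: ab)
      also have "\<dots> = v \<bullet> a + v \<bullet> a" unfolding ba inner_diff_right inner_minus_right by simp
      also have "\<dots> = 0" using v a inner_eq_0_iff[of v a] by simp
      finally have "v \<bullet> \<alpha> = 0" using ab a(2) by (auto simp: b_def)
      then show ?thesis by (simp add: mult)
    qed
    then show False using weyl_not_single_flip[OF t a(1)] ba by (simp add: b_def)
  qed
  then have neq: "a \<noteq> b" "a \<noteq> - b" "b \<noteq> a" using a(2) unfolding b_def by (metis, metis minus_minus, metis)
  have "(a - b) \<bullet> (a - b) = 2" by (rule norm_diff_xy[OF a(1) b neq(1,2)])
  then have "(2 * (a \<bullet> \<alpha>))\<^sup>2 = 2" by (simp add: ab n power2_eq_square)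
  then have "2 * (a \<bullet> \<alpha>) = sqrt 2 \<or> 2 * (a \<bullet> \<alpha>) = - sqrt 2"
    by (metis real_sqrt_abs abs_eq_iff' abs_minus_cancel real_sqrt_ge_zero zero_le_numeral abs_of_nonneg)
  then show thesis
  proof
    assume *: "2 * (a \<bullet> \<alpha>) = sqrt 2"
    have "\<alpha> = unit_root a b" unfolding unit_root_def ab * by simp
    then show thesis using that[OF a(1) b neq(1,2)] by blast
  next
    assume *: "2 * (a \<bullet> \<alpha>) = - sqrt 2"
    have "unit_root b a = (1 / sqrt 2) *\<^sub>R (- (a - b))" by (simp add: unit_root_def)
    also have "\<dots> = \<alpha>" unfolding ab * by simp
    finally have "\<alpha> = unit_root b a" by simp
    then show thesis using that[OF b a(1) neq(3) \<open>b \<noteq> - a\<close>] by blast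
  qed
qed

lemma unit_root_uminus: "unit_root (- y) (- x) = unit_root x y"
  by (simp add: unit_root_def)

lemma unit_root_add: "unit_root x y + unit_root y z = unit_root x z"
  by (simp add: unit_root_def scaleR_add_right[symmetric] del: scaleR_add_right)

text \<open>For a simple system there is a vector \<open>\<rho>\<close> pairing to 1 with every simple root; the simple roots
  are the differences of neighbours in the order that \<open>\<rho>\<close> induces on the signed basis.\<close>

context
  fixes \<Delta> :: "(real^'n) set"
  assumes simple: "simple_system weyl_group_D \<Delta>"
begin

lemma simple_indep: "independent \<Delta>" and simple_roots: "\<Delta> \<subseteq> unit_roots weyl_group_D"
  using simple by (auto simp: simple_system_def)

lemma simple_finite: "finite \<Delta>"
  using independent_imp_finite[OF simple_indep] .

definition rho :: "real^'n" where "rho = (SOME \<rho>. \<forall>\<alpha>\<in>\<Delta>. \<rho> \<bullet> \<alpha> = 1)"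

lemma rho: "\<alpha> \<in> \<Delta> \<Longrightarrow> rho \<bullet> \<alpha> = 1"
proof -
  obtain g :: "real^'n \<Rightarrow> real" where g: "linear g" "\<And>x. x \<in> \<Delta> \<Longrightarrow> g x = 1"
    using linear_independent_extend[OF simple_indep, of "\<lambda>_. 1"] by blast
  have "\<forall>\<alpha>\<in>\<Delta>. adjoint g 1 \<bullet> \<alpha> = 1"
    using g adjoint_works[OF g(1), of _ 1] by (simp add: inner_commute)
  then have "\<exists>\<rho>. \<forall>\<alpha>\<in>\<Delta>. \<rho> \<bullet> \<alpha> = 1" by blast
  then have "\<forall>\<alpha>\<in>\<Delta>. rho \<bullet> \<alpha> = 1" unfolding rho_def by (rule someI_ex)
  then show "\<alpha> \<in> \<Delta> \<Longrightarrow> rho \<bullet> \<alpha> = 1" by blast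
qed

text \<open>Pairing with \<open>rho\<close> gives the sum of the coefficients, whose sign tells
  positive from negative roots.\<close>

lemma root_expansion:
  assumes "\<beta> \<in> unit_roots weyl_group_D"
  shows "rho \<bullet> \<beta> \<noteq> 0"
    and "rho \<bullet> \<beta> > 0 \<Longrightarrow> \<exists>k. \<beta> = (\<Sum>\<alpha>\<in>\<Delta>. k \<alpha> *\<^sub>R \<alpha>) \<and> (\<forall>\<alpha>\<in>\<Delta>. k \<alpha> \<ge> 0)"
proof -
  obtain k where k: "\<beta> = (\<Sum>\<alpha>\<in>\<Delta>. k \<alpha> *\<^sub>R \<alpha>)" "(\<forall>\<alpha>\<in>\<Delta>. k \<alpha> \<ge> 0) \<or> (\<forall>\<alpha>\<in>\<Delta>. k \<alpha> \<le> 0)"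
    using simple assms unfolding simple_system_def by blast
  have r: "rho \<bullet> \<beta> = (\<Sum>\<alpha>\<in>\<Delta>. k \<alpha>)" by (simp add: k(1) inner_sum_right rho)
  have nz: "\<exists>\<alpha>\<in>\<Delta>. k \<alpha> \<noteq> 0"
  proof (rule ccontr)
    assume "\<not> ?thesis"
    then have "\<beta> = 0" by (simp add: k(1))
    then show False using assms by (simp add: unit_roots_def)
  qed
  from k(2) have "(rho \<bullet> \<beta> > 0 \<and> (\<forall>\<alpha>\<in>\<Delta>. k \<alpha> \<ge> 0)) \<or> rho \<bullet> \<beta> < 0"
  proof
    assume pos: "\<forall>\<alpha>\<in>\<Delta>. k \<alpha> \<ge> 0"
    then have "(\<Sum>\<alpha>\<in>\<Delta>. k \<alpha>) \<noteq> 0" using nz sum_nonneg_eq_0_iff[OF simple_finite, of k] by auto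
    then show ?thesis using sum_nonneg[of \<Delta> k] pos r by auto
  next
    assume neg: "\<forall>\<alpha>\<in>\<Delta>. k \<alpha> \<le> 0"
    then have "(\<Sum>\<alpha>\<in>\<Delta>. - k \<alpha>) \<noteq> 0" using nz sum_nonneg_eq_0_iff[OF simple_finite, of "\<lambda>\<alpha>. - k \<alpha>"] by auto
    then have "(\<Sum>\<alpha>\<in>\<Delta>. - k \<alpha>) > 0" using sum_nonneg[of \<Delta> "\<lambda>\<alpha>. - k \<alpha>"] neg by auto
    then show ?thesis using r by (simp add: sum_negf)
  qed
  then show "rho \<bullet> \<beta> \<noteq> 0" "rho \<bullet> \<beta> > 0 \<Longrightarrow> \<exists>k. \<beta> = (\<Sum>\<alpha>\<in>\<Delta>. k \<alpha> *\<^sub>R \<alpha>) \<and> (\<forall>\<alpha>\<in>\<Delta>. k \<alpha> \<ge> 0)"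
    using k(1) by auto
qed

text \<open>By independence the nonnegative coefficients of both summands vanish off \<delta>.
  Having length 1, \<beta> is then \<delta> itself, which leaves nothing for \<gamma>.\<close>

lemma simple_indecomposable:
  assumes \<delta>: "\<delta> \<in> \<Delta>" and \<beta>: "\<beta> \<in> unit_roots weyl_group_D" "rho \<bullet> \<beta> > 0"
    and \<gamma>: "\<gamma> \<in> unit_roots weyl_group_D" "rho \<bullet> \<gamma> > 0"
  shows "\<delta> \<noteq> \<beta> + \<gamma>"
proof
  assume eq: "\<delta> = \<beta> + \<gamma>"
  obtain k where k: "\<beta> = (\<Sum>\<alpha>\<in>\<Delta>. k \<alpha> *\<^sub>R \<alpha>)" "\<forall>\<alpha>\<in>\<Delta>. k \<alpha> \<ge> 0" using root_expansion(2)[OF \<beta>] by blast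
  obtain l where l: "\<gamma> = (\<Sum>\<alpha>\<in>\<Delta>. l \<alpha> *\<^sub>R \<alpha>)" "\<forall>\<alpha>\<in>\<Delta>. l \<alpha> \<ge> 0" using root_expansion(2)[OF \<gamma>] by blast
  have "(\<Sum>\<alpha>\<in>\<Delta>. (k \<alpha> + l \<alpha> - (if \<alpha> = \<delta> then 1 else 0)) *\<^sub>R \<alpha>) = \<beta> + \<gamma> - (\<Sum>\<alpha>\<in>\<Delta>. (if \<alpha> = \<delta> then 1 else 0) *\<^sub>R \<alpha>)"
    by (simp add: k(1) l(1) scaleR_diff_left scaleR_add_left sum.distrib sum_subtractf)
  also have "(\<Sum>\<alpha>\<in>\<Delta>. (if \<alpha> = \<delta> then 1 else 0) *\<^sub>R \<alpha>) = (\<Sum>\<alpha>\<in>\<Delta>. if \<alpha> = \<delta> then \<alpha> else 0)"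
    by (rule sum.cong) auto
  also have "\<dots> = \<delta>" using \<delta> simple_finite by simp
  finally have "(\<Sum>\<alpha>\<in>\<Delta>. (k \<alpha> + l \<alpha> - (if \<alpha> = \<delta> then 1 else 0)) *\<^sub>R \<alpha>) = 0" using eq by simp
  then have zero: "k \<alpha> + l \<alpha> - (if \<alpha> = \<delta> then 1 else 0) = 0" if "\<alpha> \<in> \<Delta>" for \<alpha>
    using independentD[OF simple_indep simple_finite subset_refl, of "\<lambda>\<alpha>. k \<alpha> + l \<alpha> - (if \<alpha> = \<delta> then 1 else 0)" \<alpha>] that
    by blast
  have k0: "k \<alpha> = 0" if "\<alpha> \<in> \<Delta>" "\<alpha> \<noteq> \<delta>" for \<alpha>
    using zero[OF that(1)] that(2) k(2) l(2) that(1) by (simp add: add_nonneg_eq_0_iff)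
  have "\<beta> = (\<Sum>\<alpha>\<in>\<Delta>. if \<alpha> = \<delta> then k \<delta> *\<^sub>R \<delta> else 0)"
    unfolding k(1) by (rule sum.cong) (use k0 in auto)
  then have \<beta>\<delta>: "\<beta> = k \<delta> *\<^sub>R \<delta>" using \<delta> simple_finite by simp
  have "norm \<beta> = 1" "norm \<delta> = 1" using \<beta> \<delta> simple_roots by (auto simp: unit_roots_def)
  then have "\<bar>k \<delta>\<bar> = 1" using \<beta>\<delta> by (metis norm_scaleR mult.right_neutral)
  then have "k \<delta> = 1" using k(2) \<delta> by auto
  then have "\<beta> = \<delta>" using \<beta>\<delta> by (metis scaleR_one)
  then have "\<gamma> = 0" using eq by (metis add_cancel_right_right)
  then show False using \<gamma> by simp
qed

text \<open>Some simple root \<delta> has positive inner product with x - y, hence shares an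
  endpoint with it. If \<delta> were different, its other endpoint would either lie between y and x,
  or make \<delta> a sum of two positive roots. Only vectors off the two lines count as lying in
  between: \<open>r 0\<close> may separate \<open>- r 0\<close> from \<open>r 1\<close>.\<close>

lemma neighbours_simple:
  assumes xy: "x \<in> signed_basis" "y \<in> signed_basis" "x \<noteq> y" "x \<noteq> - y" and less: "rho \<bullet> y < rho \<bullet> x"
    and nb: "\<And>b. b \<in> signed_basis \<Longrightarrow> b \<noteq> x \<Longrightarrow> b \<noteq> - x \<Longrightarrow> b \<noteq> y \<Longrightarrow> b \<noteq> - y \<Longrightarrow>
      \<not> (rho \<bullet> y < rho \<bullet> b \<and> rho \<bullet> b < rho \<bullet> x)"
  shows "unit_root x y \<in> \<Delta>"
proof -
  let ?\<alpha> = "unit_root x y"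
  have pos: "rho \<bullet> unit_root u v > 0 \<longleftrightarrow> rho \<bullet> v < rho \<bullet> u" for u v
    by (simp add: unit_root_def inner_diff_right zero_less_mult_iff zero_less_divide_iff)
  obtain k where k: "?\<alpha> = (\<Sum>\<delta>\<in>\<Delta>. k \<delta> *\<^sub>R \<delta>)" "\<forall>\<delta>\<in>\<Delta>. k \<delta> \<ge> 0"
    using root_expansion(2)[OF unit_root_in_unit_roots[OF xy]] less pos by blast
  have "?\<alpha> \<bullet> ?\<alpha> = (\<Sum>\<delta>\<in>\<Delta>. k \<delta> * (?\<alpha> \<bullet> \<delta>))" by (subst (2) k(1)) (simp add: inner_sum_right)
  then have "(\<Sum>\<delta>\<in>\<Delta>. k \<delta> * (?\<alpha> \<bullet> \<delta>)) > 0" using unit_root_inner_self[OF xy] by simp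
  then obtain \<delta> where \<delta>: "\<delta> \<in> \<Delta>" "k \<delta> * (?\<alpha> \<bullet> \<delta>) > 0"
    using sum_nonpos[of \<Delta> "\<lambda>\<delta>. k \<delta> * (?\<alpha> \<bullet> \<delta>)"] by (meson not_le)
  have "?\<alpha> \<bullet> \<delta> > 0" using \<delta> k(2) by (metis less_le not_le zero_less_mult_iff)
  obtain u0 v0 where uv0: "u0 \<in> signed_basis" "v0 \<in> signed_basis" "u0 \<noteq> v0" "u0 \<noteq> - v0" "\<delta> = unit_root u0 v0"
    using unit_rootsE[of \<delta>] \<delta>(1) simple_roots by blast
  have "(x - y) \<bullet> (u0 - v0) > 0"
    using \<open>?\<alpha> \<bullet> \<delta> > 0\<close> by (simp add: uv0(5) unit_root_def zero_less_divide_iff)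
  then have "x \<bullet> u0 > 0 \<or> x \<bullet> v0 < 0 \<or> y \<bullet> u0 < 0 \<or> y \<bullet> v0 > 0"
    by (simp add: inner_diff_left inner_diff_right) linarith
  then have "x = u0 \<or> x = - v0 \<or> y = - u0 \<or> y = v0"
    using xy uv0 by (auto simp: inner_signed_basis split: if_splits)
  \<comment> \<open>The root u0 - v0 is also (- v0) - (- u0), which reduces the four coincidences to
    a common first or a common second endpoint.\<close>
  moreover have flip: "- v0 \<in> signed_basis" "- u0 \<in> signed_basis" "- v0 \<noteq> - u0" "- v0 \<noteq> - (- u0)" "\<delta> = unit_root (- v0) (- u0)"
  proof -
    show "- v0 \<noteq> - (- u0)" using uv0(4) by (metis minus_minus)
    show "\<delta> = unit_root (- v0) (- u0)" by (simp only: uv0(5) unit_root_uminus)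
  qed (use uv0 in simp_all)
  ultimately have "\<exists>u v. u \<in> signed_basis \<and> v \<in> signed_basis \<and> u \<noteq> v \<and> u \<noteq> - v \<and> \<delta> = unit_root u v \<and> (x = u \<or> y = v)"
  proof (elim disjE)
    assume "x = u0" then show ?thesis using uv0 by blast
  next
    assume "y = v0" then show ?thesis using uv0 by blast
  next
    assume "x = - v0"
    then show ?thesis using flip by blast
  next
    assume "y = - u0"
    then show ?thesis using flip by blast
  qed
  then obtain u v where uv: "u \<in> signed_basis" "v \<in> signed_basis" "u \<noteq> v" "u \<noteq> - v" "\<delta> = unit_root u v"
    and or: "x = u \<or> y = v" by blast
  have inn: "(x - y) \<bullet> (u - v) > 0"
    using \<open>?\<alpha> \<bullet> \<delta> > 0\<close> by (simp add: uv(5) unit_root_def zero_less_divide_iff)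
  have less': "rho \<bullet> v < rho \<bullet> u" using pos[of u v] rho[OF \<delta>(1)] uv(5) by simp
  have distinct: "rho \<bullet> a \<noteq> rho \<bullet> b" if "a \<in> signed_basis" "b \<in> signed_basis" "a \<noteq> b" "a \<noteq> - b" for a b
    using root_expansion(1)[OF unit_root_in_unit_roots[OF that]] by (auto simp: unit_root_def inner_diff_right)
  have indec: False if "\<delta> = unit_root a b + unit_root b d"
    "a \<in> signed_basis" "b \<in> signed_basis" "d \<in> signed_basis" "a \<noteq> b" "a \<noteq> - b" "b \<noteq> d" "b \<noteq> - d"
    "rho \<bullet> b < rho \<bullet> a" "rho \<bullet> d < rho \<bullet> b" for a b d
    using simple_indecomposable[OF \<delta>(1) unit_root_in_unit_roots[of a b] _ unit_root_in_unit_roots[of b d]] that pos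
    by blast
  have "?\<alpha> = \<delta>"
  proof (rule ccontr)
    assume neq: "?\<alpha> \<noteq> \<delta>"
    from or show False
    proof
      assume xu: "x = u"
      have vy: "v \<noteq> y" using neq uv(5) xu by auto
      have vmy: "v \<noteq> - y"
      proof -
        have "y \<noteq> - x" using xy(4) by (metis minus_minus)
        then show ?thesis
          using inn xu xy by (auto simp: inner_diff_left inner_diff_right inner_signed_basis)
      qed
      have ymv: "y \<noteq> - v" using vmy by auto
      have vx: "v \<noteq> x" "v \<noteq> - x" using uv xu by auto
      have "\<not> rho \<bullet> y < rho \<bullet> v" using nb[OF uv(2) vx vy vmy] less' xu by simp
      then have "rho \<bullet> v < rho \<bullet> y" using distinct[OF uv(2) xy(2) vy vmy] by linarith
      then show False
        using indec[of x y v] xy uv xu vy ymv less unit_root_add[of x y v] by auto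
    next
      assume yv: "y = v"
      have ux: "u \<noteq> x" using neq uv(5) yv by auto
      have umx: "u \<noteq> - x"
      proof -
        have "y \<noteq> - x" using xy(4) by (metis minus_minus)
        then show ?thesis
          using inn yv xy by (auto simp: inner_diff_left inner_diff_right inner_signed_basis)
      qed
      have uy: "u \<noteq> y" "u \<noteq> - y" using uv yv by auto
      have "\<not> rho \<bullet> u < rho \<bullet> x" using nb[OF uv(1) ux umx uy] less' yv by simp
      then have "rho \<bullet> x < rho \<bullet> u" using distinct[OF uv(1) xy(1) ux umx] by linarith
      then show False
        using indec[of u x y] xy uv yv ux umx less unit_root_add[of u x y] by auto
    qed
  qed
  then show ?thesis using \<delta> by simp
qed

text \<open>From each line the vector with nonnegative value under \<open>rho\<close> is taken and
  these are sorted. There are no ties, as the difference of two tied vectors would be a root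
  orthogonal to \<open>rho\<close>.\<close>

lemma rho_ordered_basis:
  obtains r :: "nat \<Rightarrow> real^'n" where
    "\<And>j. j < CARD('n) \<Longrightarrow> r j \<in> signed_basis" "0 \<le> rho \<bullet> r 0"
    "\<And>i j. i < j \<Longrightarrow> j < CARD('n) \<Longrightarrow> rho \<bullet> r i < rho \<bullet> r j"
    "\<And>a. a \<in> signed_basis \<Longrightarrow> \<exists>j<CARD('n). a = r j \<or> a = - r j"
proof -
  define key where "key i = \<bar>rho $ i\<bar>" for i
  define p where "p i = (if rho $ i \<ge> 0 then axis i 1 else - axis i (1::real))" for i
  have p: "p i \<in> signed_basis" "rho \<bullet> p i = key i" for i
    by (auto simp: p_def key_def axis_in_signed_basis inner_axis)
  have pij: "p i \<noteq> p j \<and> p i \<noteq> - p j" if "i \<noteq> j" for i j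
  proof -
    have "p i \<bullet> p j = 0" using that by (auto simp: p_def inner_axis_axis)
    then show ?thesis using inner_eq_0_iff[OF p(1) p(1)] by blast
  qed
  have inj: "inj key"
  proof (rule injI, rule ccontr)
    fix i j assume "key i = key j" "i \<noteq> j"
    then have "rho \<bullet> unit_root (p i) (p j) = 0" by (simp add: unit_root_def inner_diff_right p(2))
    then show False
      using root_expansion(1)[OF unit_root_in_unit_roots[OF p(1) p(1)]] pij[OF \<open>i \<noteq> j\<close>] by blast
  qed
  define ks where "ks = sorted_list_of_set (range key)"
  have ks: "length ks = CARD('n)" "set ks = range key" "sorted_wrt (<) ks"
    using card_image[OF inj] strict_sorted_list_of_set[of "range key"] by (simp_all add: ks_def)
  define r where "r j = p (inv key (ks ! j))" for j
  have rr: "rho \<bullet> r j = ks ! j" if "j < CARD('n)" for j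
  proof -
    have "ks ! j \<in> range key" using that ks by (metis nth_mem)
    then show ?thesis by (simp add: r_def p(2) f_inv_into_f)
  qed
  show thesis
  proof (rule that[of r])
    show "r j \<in> signed_basis" for j by (simp add: r_def p(1))
    show "0 \<le> rho \<bullet> r 0" by (simp add: r_def p(2) key_def)
    show "rho \<bullet> r i < rho \<bullet> r j" if "i < j" "j < CARD('n)" for i j
      using that ks(1,3) rr by (simp add: sorted_wrt_nth_less)
    fix a :: "real^'n" assume "a \<in> signed_basis"
    then obtain i s where s: "s = 1 \<or> s = -1" "a = s *\<^sub>R axis i (1::real)" by (rule signed_basisE)
    have "key i \<in> set ks" by (simp add: ks(2))
    then obtain j where j: "j < length ks" "ks ! j = key i" by (metis in_set_conv_nth)
    then have "r j = p i" using inj by (simp add: r_def)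
    then show "\<exists>j<CARD('n). a = r j \<or> a = - r j" using j ks(1) s by (intro exI[of _ j]) (auto simp: p_def)
  qed
qed

end

text \<open>Coxeter--Dynkin diagram of type D: the end vertices 0 and 1 both attached to 2.\<close>

definition chain_root :: "(nat \<Rightarrow> real^'n) \<Rightarrow> nat \<Rightarrow> real^'n" where
  "chain_root r j = (if j = 0 then unit_root (r 1) (- r 0) else unit_root (r j) (r (j - 1)))"

text \<open>Neighbours in the order give n simple roots; \<open>- r 0\<close> and \<open>r 1\<close>
  are neighbours up to the line of \<open>r 0\<close>. An independent set has at most n elements, so
  there are no further ones.\<close>

lemma simple_system_chain:
  fixes \<Delta> :: "(real^'n) set"
  assumes simple: "simple_system weyl_group_D \<Delta>" and n: "CARD('n) \<ge> 2"
  obtains r :: "nat \<Rightarrow> real^'n" where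
    "\<And>j. j < CARD('n) \<Longrightarrow> r j \<in> signed_basis"
    "\<And>i j. i < CARD('n) \<Longrightarrow> j < CARD('n) \<Longrightarrow> i \<noteq> j \<Longrightarrow> r i \<noteq> r j \<and> r i \<noteq> - r j"
    "\<And>a. a \<in> signed_basis \<Longrightarrow> \<exists>j<CARD('n). a = r j \<or> a = - r j"
    "bij_betw (chain_root r) {..<CARD('n)} \<Delta>"
proof -
  define \<rho> where "\<rho> = rho \<Delta>"
  obtain r :: "nat \<Rightarrow> real^'n" where r: "\<And>j. j < CARD('n) \<Longrightarrow> r j \<in> signed_basis" "0 \<le> \<rho> \<bullet> r 0"
    "\<And>i j. i < j \<Longrightarrow> j < CARD('n) \<Longrightarrow> \<rho> \<bullet> r i < \<rho> \<bullet> r j"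
    and cover: "\<And>a. a \<in> signed_basis \<Longrightarrow> \<exists>j<CARD('n). a = r j \<or> a = - r j"
    using rho_ordered_basis[OF simple] unfolding \<rho>_def by metis
  have nonneg: "0 \<le> \<rho> \<bullet> r j" if "j < CARD('n)" for j
    using r(2) r(3)[of 0 j] that by (cases "j = 0") auto
  have neq: "r i \<noteq> r j \<and> r i \<noteq> - r j" if "i < j" "j < CARD('n)" for i j
  proof -
    have "\<rho> \<bullet> r i < \<rho> \<bullet> r j" "0 \<le> \<rho> \<bullet> r i" using r(3)[OF that] nonneg that by auto
    then show ?thesis by (auto simp: )
  qed
  have neq': "r i \<noteq> r j \<and> r i \<noteq> - r j" if "i < CARD('n)" "j < CARD('n)" "i \<noteq> j" for i j
  proof (cases "i < j")
    case False
    then have "r j \<noteq> r i \<and> r j \<noteq> - r i" using neq[of j i] that by simp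
    then show ?thesis by (metis minus_minus)
  qed (use neq that in blast)
  have mono: "\<rho> \<bullet> r i < \<rho> \<bullet> r j \<longleftrightarrow> i < j" if "i < CARD('n)" "j < CARD('n)" for i j
    using r(3)[of i j] r(3)[of j i] that by (cases i j rule: linorder_cases) auto
  have in_\<Delta>: "chain_root r j \<in> \<Delta>" if j: "j < CARD('n)" for j
  proof (cases "j = 0")
    case True
    have "unit_root (r 1) (- r 0) \<in> \<Delta>"
    proof (rule neighbours_simple[OF simple, folded \<rho>_def])
      show "r 1 \<in> signed_basis" "- r 0 \<in> signed_basis" using r(1) n by auto
      show "r 1 \<noteq> - r 0" "r 1 \<noteq> - (- r 0)" using neq'[of 1 0] n by auto
      show "\<rho> \<bullet> - r 0 < \<rho> \<bullet> r 1" using r(3)[of 0 1] r(2) n by simp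
      fix b :: "real^'n" assume b: "b \<in> signed_basis" "b \<noteq> r 1" "b \<noteq> - r 1" "b \<noteq> - r 0" "b \<noteq> - (- r 0)"
      obtain i where i: "i < CARD('n)" "b = r i \<or> b = - r i" using cover[OF b(1)] by blast
      have "i \<noteq> 0" "i \<noteq> 1" using i(2) b(2-5) by (metis minus_minus, metis)
      then have "\<rho> \<bullet> r 1 < \<rho> \<bullet> r i" "\<rho> \<bullet> r 0 < \<rho> \<bullet> r i" using r(3)[of 1 i] r(3)[of 0 i] i(1) by auto
      then show "\<not> (\<rho> \<bullet> - r 0 < \<rho> \<bullet> b \<and> \<rho> \<bullet> b < \<rho> \<bullet> r 1)" using i(2) by auto
    qed
    then show ?thesis using True by (simp add: chain_root_def)
  next
    case False
    define i where "i = j - 1"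
    have i: "i < CARD('n)" "j = Suc i" using False j by (auto simp: i_def)
    have "unit_root (r j) (r i) \<in> \<Delta>"
    proof (rule neighbours_simple[OF simple, folded \<rho>_def])
      show "r j \<in> signed_basis" "r i \<in> signed_basis" using r(1) i j by auto
      show "r j \<noteq> r i" "r j \<noteq> - r i" using neq'[of j i] i j by auto
      show "\<rho> \<bullet> r i < \<rho> \<bullet> r j" using r(3)[of i j] i j by simp
      fix b :: "real^'n" assume b: "b \<in> signed_basis"
      obtain l where l: "l < CARD('n)" "b = r l \<or> b = - r l" using cover[OF b(1)] by blast
      from l(2) show "\<not> (\<rho> \<bullet> r i < \<rho> \<bullet> b \<and> \<rho> \<bullet> b < \<rho> \<bullet> r j)"
      proof
        assume "b = r l" then show ?thesis using mono[OF i(1) l(1)] mono[OF l(1) j] i(2) by auto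
      next
        assume "b = - r l" then show ?thesis using nonneg[OF l(1)] nonneg[OF i(1)] by auto
      qed
    qed
    then show ?thesis using False by (simp add: chain_root_def i_def)
  qed
  have inj: "inj_on (chain_root r) {..<CARD('n)}"
  proof -
    \<comment> \<open>The pairing with \<open>r j\<close> separates root \<open>j\<close> from
      earlier ones, except that roots 0 and 1 agree on \<open>r 1\<close> and have to be separated
      by \<open>r 0\<close>.\<close>
    define f where "f j v = (if j = 0 then (v::real^'n) \<bullet> (r 1 + r 0) / sqrt 2 else v \<bullet> (r j - r (j - 1)) / sqrt 2)" for j v
    have rel: "v \<bullet> chain_root r j = f j v" for v j
      by (simp add: chain_root_def unit_root_def f_def inner_add_right inner_diff_right)
    have rij: "r i \<bullet> r j = (if i = j then 1 else 0)" if "i < CARD('n)" "j < CARD('n)" for i j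
      using inner_signed_basis[OF r(1)[OF that(1)] r(1)[OF that(2)]] neq'[OF that] by auto
    have "chain_root r i \<noteq> chain_root r j" if ij: "i < j" "j < CARD('n)" for i j
    proof
      assume eq: "chain_root r i = chain_root r j"
      show False
      proof (cases "i = 0 \<and> j = 1")
        case True
        have "f 0 (r 0) = f 1 (r 0)" using eq True rel[of "r 0" 0] rel[of "r 0" 1] by simp
        then show False using n rij by (simp add: f_def inner_add_right inner_diff_right)
      next
        case False
        have "f i (r j) = f j (r j)" using eq rel[of "r j" i] rel[of "r j" j] by simp
        then show False using n rij ij False by (auto simp: f_def inner_add_right inner_diff_right split: if_splits)
      qed
    qed
    then show ?thesis by (auto simp: inj_on_def) (metis linorder_neqE_nat)
  qed
  have "card \<Delta> \<le> CARD('n)"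
    using independent_bound[OF simple_indep[OF simple]] by simp
  then have "chain_root r ` {..<CARD('n)} = \<Delta>"
    using card_seteq[OF simple_finite[OF simple], of "chain_root r ` {..<CARD('n)}"] in_\<Delta> card_image[OF inj] by auto
  then have "bij_betw (chain_root r) {..<CARD('n)} \<Delta>" using inj by (simp add: bij_betw_def)
  then show thesis using that[of r] r(1) neq' cover by blast
qed

section \<open>The normal form of a Coxeter element\<close>

lemma two_element_list:
  fixes js :: "nat list"
  assumes "distinct js" "set js = {..1}"
  shows "js = [0, 1] \<or> js = [1, 0]"
proof -
  have "length js = 2" using distinct_card[OF assms(1)] assms(2) by simp
  then obtain a b where js: "js = [a, b]" by (auto simp: length_Suc_conv numeral_2_eq_2)
  have "{..1} = {0, 1 :: nat}" by auto
  then have "{a, b} = {0, 1}" using assms(2) js by simp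
  then show ?thesis by (simp add: js doubleton_eq_iff)
qed

locale signed_chain =
  fixes r :: "nat \<Rightarrow> real^'n"
  assumes r_basis: "\<And>j. j < CARD('n) \<Longrightarrow> r j \<in> signed_basis"
    and r_neq: "\<And>i j. i < CARD('n) \<Longrightarrow> j < CARD('n) \<Longrightarrow> i \<noteq> j \<Longrightarrow> r i \<noteq> r j \<and> r i \<noteq> - r j"
    and r_cover: "\<And>a. a \<in> signed_basis \<Longrightarrow> \<exists>j<CARD('n). a = r j \<or> a = - r j"
    and n2: "CARD('n) \<ge> 2"
begin

definition chain_refl :: "nat \<Rightarrow> real^'n^'n" where
  "chain_refl j = reflection_along (chain_root r j)"

definition chain_prod :: "nat list \<Rightarrow> real^'n^'n" where
  "chain_prod js = mat_prod (map chain_refl js)"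

lemma chain_refl_0: "chain_refl 0 = reflection_along (r 1 - (- r 0))"
  unfolding chain_refl_def chain_root_def unit_root_def by (simp add: reflection_along_scaleR)

lemma chain_refl_Suc: "chain_refl (Suc j) = reflection_along (r (Suc j) - r j)"
  unfolding chain_refl_def chain_root_def unit_root_def by (simp add: reflection_along_scaleR)

lemma r01: "r 1 \<in> signed_basis" "- r 0 \<in> signed_basis" "r 1 \<noteq> - r 0" "r 1 \<noteq> - (- r 0)"
  using r_basis[of 0] r_basis[of 1] r_neq[of 1 0] n2 by auto

lemma rSuc:
  assumes "Suc j < CARD('n)"
  shows "r (Suc j) \<in> signed_basis" "r j \<in> signed_basis" "r (Suc j) \<noteq> r j" "r (Suc j) \<noteq> - r j"
  using r_basis[of j] r_basis[of "Suc j"] r_neq[of "Suc j" j] assms by auto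

lemma chain_refl_weyl: "j < CARD('n) \<Longrightarrow> chain_refl j \<in> weyl_group_D"
  using swap_in_weyl[OF r01] swap_in_weyl[OF rSuc] by (cases j) (simp_all add: chain_refl_0 chain_refl_Suc)

lemma chain_prod_weyl: "set js \<subseteq> {..<CARD('n)} \<Longrightarrow> chain_prod js \<in> weyl_group_D"
  by (induction js) (auto simp: chain_prod_def mat_prod_Nil mat_prod_Cons mat_1_in_weyl intro!: weyl_mult chain_refl_weyl)

lemma chain_refl_fix:
  assumes "j < i" "i < CARD('n)" "j = 0 \<Longrightarrow> i \<noteq> 1"
  shows "chain_refl j *v r i = r i"
proof (cases j)
  case 0
  have n: "r i \<noteq> r 1 \<and> r i \<noteq> - r 1" "r i \<noteq> r 0 \<and> r i \<noteq> - r 0"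
    using r_neq[of i 1] r_neq[of i 0] assms 0 n2 by auto
  show ?thesis unfolding 0 chain_refl_0
    by (rule swap_other[OF r01]) (use n r_basis assms in auto)
next
  case (Suc l)
  have n: "r i \<noteq> r (Suc l) \<and> r i \<noteq> - r (Suc l)" "r i \<noteq> r l \<and> r i \<noteq> - r l"
    using r_neq[of i "Suc l"] r_neq[of i l] assms Suc by auto
  show ?thesis unfolding Suc chain_refl_Suc
    by (rule swap_other[OF rSuc]) (use n r_basis assms Suc in auto)
qed

lemma chain_prod_Cons: "chain_prod (j # js) *v x = chain_refl j *v (chain_prod js *v x)"
  by (simp add: chain_prod_def mat_prod_Cons matrix_vector_mul_assoc)

lemma chain_prod_append: "chain_prod (us @ vs) *v x = chain_prod us *v (chain_prod vs *v x)"
  by (simp add: chain_prod_def mat_prod_append matrix_vector_mul_assoc)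

text \<open>A chain reflection involves only its own index and the preceding one, apart from vertex
  0, which also involves \<open>r 1\<close>; hence the exception i = 1.\<close>

lemma chain_prod_fix:
  assumes "i < CARD('n)" "\<And>j. j \<in> set js \<Longrightarrow> j < i" "i \<noteq> 1"
  shows "chain_prod js *v r i = r i"
  using assms(2)
proof (induction js)
  case Nil then show ?case by (simp add: chain_prod_def mat_prod_Nil)
next
  case (Cons j js)
  then show ?case using chain_refl_fix[of j i] assms(1,3) by (simp add: chain_prod_Cons)
qed

text \<open>The letter \<open>M\<close> carries \<open>r M\<close> to \<open>r (M - 1)\<close>, and
  the letters on either side fix \<open>r M\<close>; a negation would identify the two lines. This
  will keep insertion points away from the negated line \<eta>.\<close>

lemma chain_prod_no_negation:
  assumes M: "M < CARD('n)" "M \<ge> 2" and js: "set us \<subseteq> {..<M}" "set vs \<subseteq> {..<M}"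
  shows "chain_prod (us @ M # vs) *v r M \<noteq> - r M"
proof
  assume eq: "chain_prod (us @ M # vs) *v r M = - r M"
  obtain l where l: "M = Suc l" using M by (cases M) auto
  have fix_us: "chain_prod us *v r M = r M" and fix_vs: "chain_prod vs *v r M = r M"
    using chain_prod_fix[of M] M js by auto
  have "chain_prod (us @ M # vs) *v r M = chain_prod us *v (chain_refl M *v r M)"
    by (simp add: chain_prod_append chain_prod_Cons fix_vs)
  also have "chain_refl M *v r M = r l" using swap_left[OF rSuc, of l] M l by (simp add: chain_refl_Suc)
  finally have "chain_prod us *v r l = - (chain_prod us *v r M)" using eq fix_us by metis
  then have "chain_prod us *v r l = chain_prod us *v (- r M)" by (simp only: matrix_vector_mult_uminus)
  moreover have "set us \<subseteq> {..<CARD('n)}" using js(1) M(1) by fastforce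
  then have "chain_prod us \<in> weyl_group_D" by (rule chain_prod_weyl)
  ultimately have "r l = - r M" using weyl_inj by blast
  then show False using r_neq[of l M] l M by auto
qed

text \<open>The normal form on the first M + 1 lines only: a negative cycle of length
  \<open>M\<close> through \<open>x\<close>, and one negated line. Nothing is said about the
  remaining lines, so that vertices can be added one at a time.\<close>

definition cox_frame :: "nat \<Rightarrow> real^'n^'n \<Rightarrow> real^'n \<Rightarrow> real^'n \<Rightarrow> bool" where
  "cox_frame M c x \<eta> \<longleftrightarrow> x \<in> signed_basis \<and> \<eta> \<in> signed_basis \<and> x \<noteq> \<eta> \<and> x \<noteq> - \<eta> \<and>
     ((*v) c ^^ M) x = - x \<and> c *v \<eta> = - \<eta> \<and>
     (\<forall>k. 0 < k \<and> k < M \<longrightarrow> ((*v) c ^^ k) x \<noteq> x \<and> ((*v) c ^^ k) x \<noteq> - x) \<and>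
     (\<forall>i\<le>M. (\<exists>k. r i = ((*v) c ^^ k) x \<or> r i = - ((*v) c ^^ k) x) \<or> r i = \<eta> \<or> r i = - \<eta>)"

lemma funpow_uminus: "((*v) c ^^ k) (- x) = - ((*v) (c :: real^'n^'n) ^^ k) x"
  by (induction k) (simp_all add: matrix_vector_mult_uminus)

lemma funpow_weyl_inj:
  assumes "c \<in> weyl_group_D"
  shows "((*v) c ^^ k) x = ((*v) c ^^ k) y \<longleftrightarrow> x = y"
  by (induction k) (simp_all add: weyl_inj[OF assms])

lemma funpow_weyl_basis:
  assumes "c \<in> weyl_group_D" "x \<in> signed_basis"
  shows "((*v) c ^^ k) x \<in> signed_basis"
  using assms by (induction k) (simp_all add: weyl_signed_basis)

lemma funpow_mod:
  assumes "((*v) c ^^ M) x = - x"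
  shows "((*v) c ^^ k) x = ((*v) c ^^ (k mod M)) x \<or> ((*v) c ^^ k) x = - ((*v) (c :: real^'n^'n) ^^ (k mod M)) x"
proof -
  have "((*v) c ^^ (a + M * d)) x = ((*v) c ^^ a) x \<or> ((*v) c ^^ (a + M * d)) x = - ((*v) c ^^ a) x" for a d
  proof (induction d)
    case (Suc d)
    have "a + M * Suc d = (a + M * d) + M" by simp
    then have "((*v) c ^^ (a + M * Suc d)) x = ((*v) c ^^ (a + M * d)) (((*v) c ^^ M) x)"
      by (simp only: funpow_add o_apply)
    also have "\<dots> = - ((*v) c ^^ (a + M * d)) x" by (simp add: assms funpow_uminus)
    finally show ?case using Suc by auto
  qed simp
  from this[of "k mod M" "k div M"] show ?thesis by simp
qed

text \<open>The element \<open>c\<close> is \<open>c0\<close> times the transposition of \<open>p\<close> and \<open>q\<close>, which inserts \<open>p\<close> into the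
  negative cycle of \<open>c0\<close>.\<close>

lemma cox_frame_insert:
  assumes M: "M \<ge> 1" "Suc M < CARD('n)" and c0: "c0 \<in> weyl_group_D" and c: "c \<in> weyl_group_D"
    and F: "cox_frame M c0 x \<eta>"
    and p: "p = r (Suc M)" "c0 *v p = p"
    and q: "q = ((*v) c0 ^^ l) x \<or> q = - ((*v) c0 ^^ l) x"
    and cp: "c *v p = c0 *v q" and cq: "c *v q = p"
    and other: "\<And>y. y \<in> signed_basis \<Longrightarrow> y \<noteq> p \<Longrightarrow> y \<noteq> - p \<Longrightarrow> y \<noteq> q \<Longrightarrow> y \<noteq> - q \<Longrightarrow> c *v y = c0 *v y"
  shows "cox_frame (Suc M) c (c0 *v q) \<eta>"
proof -
  let ?f = "\<lambda>k. (*v) c0 ^^ k" and ?g = "\<lambda>k. (*v) c ^^ k"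
  have Fx: "x \<in> signed_basis" "\<eta> \<in> signed_basis" "x \<noteq> \<eta>" "x \<noteq> - \<eta>" "?f M x = - x" "c0 *v \<eta> = - \<eta>"
    and Fk: "\<And>k. 0 < k \<Longrightarrow> k < M \<Longrightarrow> ?f k x \<noteq> x \<and> ?f k x \<noteq> - x"
    and Fr: "\<And>i. i \<le> M \<Longrightarrow> (\<exists>k. r i = ?f k x \<or> r i = - ?f k x) \<or> r i = \<eta> \<or> r i = - \<eta>"
    using F unfolding cox_frame_def by blast+
  have comm: "?f a (?f b y) = ?f b (?f a y)" for a b y
    by (metis add.commute comp_apply funpow_add)
  have pb: "p \<in> signed_basis" using p r_basis M by simp
  have qb: "q \<in> signed_basis" using q funpow_weyl_basis[OF c0 Fx(1), of l] by auto
  have qM: "?f M q = - q" using q Fx(5) comm[of M l x] by (auto simp: funpow_uminus)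
  have qk: "?f k q \<noteq> q \<and> ?f k q \<noteq> - q" if "0 < k" "k < M" for k
  proof -
    have 1: "?f l (?f k x) \<noteq> ?f l x" "?f l (?f k x) \<noteq> ?f l (- x)"
      using Fk[OF that] funpow_weyl_inj[OF c0] by blast+
    from q show ?thesis
    proof
      assume "q = ?f l x" then show ?thesis using 1 comm[of l k x] by (simp add: funpow_uminus)
    next
      assume "q = - ?f l x" then show ?thesis using 1 comm[of l k x]
        by (simp add: funpow_uminus) (metis minus_minus)
    qed
  qed
  have eta_k: "?f k \<eta> = \<eta> \<or> ?f k \<eta> = - \<eta>" for k
    by (induction k) (auto simp: Fx matrix_vector_mult_uminus)
  have eta_q: "\<eta> \<noteq> q" "\<eta> \<noteq> - q"
  proof -
    have "?f l x \<noteq> ?f l \<eta>" "?f l x \<noteq> ?f l (- \<eta>)" using Fx(3,4) funpow_weyl_inj[OF c0] by blast+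
    then have 1: "?f l x \<noteq> \<eta>" "?f l x \<noteq> - \<eta>" using eta_k[of l] by (auto simp: funpow_uminus)
    then have "- ?f l x \<noteq> \<eta>" "- ?f l x \<noteq> - \<eta>" by (metis minus_minus)+
    then show "\<eta> \<noteq> q" "\<eta> \<noteq> - q" using q 1 by (metis, metis minus_minus)
  qed
  have p_k: "?f k p = p" for k by (induction k) (simp_all add: p(2))
  have p_eta: "\<eta> \<noteq> p" "\<eta> \<noteq> - p"
    using p(2) Fx(6) signed_basis_neq_uminus[OF pb] by (auto simp: matrix_vector_mult_uminus)
  have p_f: "?f k q \<noteq> p" "?f k q \<noteq> - p" for k
  proof -
    have pq: "q \<noteq> p" "q \<noteq> - p"
    proof -
      have "?f M p = p" "?f M (- p) = - p" by (simp_all add: p_k funpow_uminus)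
      then show "q \<noteq> p" "q \<noteq> - p" using qM signed_basis_neq_uminus[OF pb] by (metis, metis minus_minus)
    qed
    have "?f k q \<noteq> ?f k p" "?f k q \<noteq> ?f k (- p)" using pq funpow_weyl_inj[OF c0] by blast+
    then show "?f k q \<noteq> p" "?f k q \<noteq> - p" by (simp_all add: p_k funpow_uminus)
  qed
  let ?x = "c0 *v q"
  have fx: "?f k ?x = ?f (Suc k) q" for k by (simp add: funpow_swap1)
  have gk: "?g k ?x = ?f k ?x" if "k < M" for k
    using that
  proof (induction k)
    case (Suc k)
    then have "?g (Suc k) ?x = c *v (?f (Suc k) q)" using fx by simp
    also have "\<dots> = c0 *v (?f (Suc k) q)"
      by (rule other) (use funpow_weyl_basis[OF c0 qb, of "Suc k"] p_f[of "Suc k"] qk[of "Suc k"] Suc.prems in auto)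
    also have "\<dots> = ?f (Suc k) ?x" using fx[of "Suc k"] by simp
    finally show ?case .
  qed simp
  obtain M' where M': "M = Suc M'" using M by (cases M) auto
  \<comment> \<open>The new cycle follows the old one for M - 1 steps to - q, makes a detour through
    - p, and closes at the negative of its starting vector.\<close>
  have gM': "?g M' ?x = - q" using gk[of M'] fx[of M'] qM M' by simp
  have gM: "?g M ?x = - p" using gM' cq by (simp add: M' matrix_vector_mult_uminus)
  have gSM: "?g (Suc M) ?x = - ?x" using gM cp by (simp add: matrix_vector_mult_uminus)
  show ?thesis
    unfolding cox_frame_def
  proof (intro conjI allI impI)
    show "?x \<in> signed_basis" using weyl_signed_basis[OF c0 qb] .
    show "\<eta> \<in> signed_basis" by (rule Fx(2))
    have "c0 *v q \<noteq> c0 *v \<eta>" "c0 *v q \<noteq> c0 *v (- \<eta>)" using eta_q weyl_inj[OF c0] by (metis, metis minus_minus)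
    then show "?x \<noteq> \<eta>" "?x \<noteq> - \<eta>" by (simp_all add: Fx(6) matrix_vector_mult_uminus)
    show "?g (Suc M) ?x = - ?x" by (rule gSM)
    show "c *v \<eta> = - \<eta>" using other[OF Fx(2) p_eta eta_q] Fx(6) by simp
  next
    fix k assume k: "0 < k \<and> k < Suc M"
    show "?g k ?x \<noteq> ?x"
    proof (cases "k = M")
      case True
      have "c0 *v q \<noteq> - p" using p_f[of 1] by simp
      then show ?thesis using gM True by metis
    next
      case False
      have "?f k ?x \<noteq> ?x"
      proof -
        have "c0 *v (?f k q) \<noteq> c0 *v q" using qk[of k] k False weyl_inj[OF c0] by auto
        then show ?thesis by (simp add: fx)
      qed
      then show ?thesis using gk[of k] k False by simp
    qed
    show "?g k ?x \<noteq> - ?x"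
    proof (cases "k = M")
      case True
      have "c0 *v q \<noteq> p" using p_f[of 1] by simp
      then show ?thesis using gM True by (metis minus_minus)
    next
      case False
      have "?f k ?x \<noteq> - ?x"
      proof -
        have "c0 *v (?f k q) \<noteq> c0 *v (- q)" using qk[of k] k False weyl_inj[OF c0] by auto
        then show ?thesis by (simp add: fx matrix_vector_mult_uminus)
      qed
      then show ?thesis using gk[of k] k False by simp
    qed
  next
    fix i assume i: "i \<le> Suc M"
    show "(\<exists>k. r i = ?g k ?x \<or> r i = - ?g k ?x) \<or> r i = \<eta> \<or> r i = - \<eta>"
    proof (cases "i = Suc M")
      case True
      then have "r i = - ?g M ?x" using p gM by simp
      then show ?thesis by blast
    next
      case False
      have orbit: "\<exists>k'. ?f k x = ?g k' ?x \<or> ?f k x = - ?g k' ?x" for k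
      proof -
        \<comment> \<open>A multiple of the period 2 M that is at least l + 1: going back l + 1
          steps becomes going forward, and the subtraction in \<open>b\<close> does not
          truncate.\<close>
        define a where "a = (l + 1) * (2 * M)"
        have xMM: "?f (2 * M) x = x" by (simp add: mult_2 funpow_add Fx(5) funpow_uminus)
        have "?f (d * (2 * M)) x = x" for d
          by (induction d) (simp_all add: funpow_add xMM)
        then have ax: "?f a x = x" unfolding a_def by blast
        have la: "l + 1 \<le> a" using M(1) mult_le_mono2[of 1 "2 * M" "l + 1"] by (simp add: a_def)
        define b where "b = k + a - (l + 1)"
        have "?f b ?x = ?f (b + 1) q" by (simp add: fx)
        moreover have "?f (b + 1) (?f l x) = ?f k x"
        proof -
          have "?f (b + 1) (?f l x) = ?f (b + 1 + l) x" by (simp only: funpow_add o_apply)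
          also have "b + 1 + l = k + a" using la by (simp add: b_def)
          also have "?f (k + a) x = ?f k x" by (simp add: funpow_add ax)
          finally show ?thesis .
        qed
        ultimately have "?f b ?x = ?f k x \<or> ?f b ?x = - ?f k x" using q by (auto simp: funpow_uminus matrix_vector_mult_uminus)
        moreover have "?f M ?x = - ?x" using qM comm[of M 1 q] by (simp add: matrix_vector_mult_uminus)
        then have "?f b ?x = ?f (b mod M) ?x \<or> ?f b ?x = - ?f (b mod M) ?x" by (rule funpow_mod)
        moreover have "?f (b mod M) ?x = ?g (b mod M) ?x" using gk[of "b mod M"] M(1) by simp
        ultimately show ?thesis by (metis minus_minus)
      qed
      show ?thesis using Fr[of i] i False orbit by (metis le_SucE minus_minus)
    qed
  qed
qed

text \<open>The two end reflections commute and their product negates both lines, so either line can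
  serve as the cycle of length 1.\<close>

lemma cox_frame_two:
  assumes "js = [0, 1] \<or> js = [1, 0]"
  shows "cox_frame 1 (chain_prod js) (r 0) (r 1)" "cox_frame 1 (chain_prod js) (r 1) (r 0)"
proof -
  have t0: "chain_refl 0 *v r 1 = - r 0" "chain_refl 0 *v r 0 = - r 1"
  proof -
    show "chain_refl 0 *v r 1 = - r 0" unfolding chain_refl_0 by (rule swap_left[OF r01])
    have "chain_refl 0 *v (- r 0) = r 1" unfolding chain_refl_0 by (rule swap_right[OF r01])
    then show "chain_refl 0 *v r 0 = - r 1" by (metis matrix_vector_mult_uminus minus_minus)
  qed
  have t1: "chain_refl 1 *v r 1 = r 0" "chain_refl 1 *v r 0 = r 1"
    using swap_left[OF rSuc, of 0] swap_right[OF rSuc, of 0] chain_refl_Suc[of 0] n2 by simp_all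
  have [simp]: "chain_prod [] *v y = y" for y by (simp add: chain_prod_def mat_prod_Nil)
  have neg: "chain_prod js *v r 0 = - r 0" "chain_prod js *v r 1 = - r 1"
    using assms t0 t1 by (auto simp: chain_prod_Cons matrix_vector_mult_uminus simp del: One_nat_def)
  have n01: "r 0 \<noteq> r 1 \<and> r 0 \<noteq> - r 1" "r 1 \<noteq> r 0 \<and> r 1 \<noteq> - r 0"
    using r_neq[of 0 1] r_neq[of 1 0] n2 by auto
  have rb: "r 0 \<in> signed_basis" "r 1 \<in> signed_basis" using r_basis n2 by auto
  have i01: "i = 0 \<or> i = 1" if "i \<le> 1" for i :: nat using that by auto
  have cov: "r i = r 0 \<or> r i = r 1" if "i \<le> 1" for i using i01[OF that] by metis
  have frame: "cox_frame 1 (chain_prod js) x y"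
    if "x \<in> signed_basis" "y \<in> signed_basis" "x \<noteq> y" "x \<noteq> - y" "chain_prod js *v x = - x" "chain_prod js *v y = - y"
      "\<And>i. i \<le> 1 \<Longrightarrow> r i = x \<or> r i = y" for x y
    unfolding cox_frame_def
  proof (intro conjI allI impI)
    fix i :: nat assume "i \<le> 1"
    then show "(\<exists>k. r i = ((*v) (chain_prod js) ^^ k) x \<or> r i = - ((*v) (chain_prod js) ^^ k) x) \<or> r i = y \<or> r i = - y"
      using that(7) funpow_0[of "(*v) (chain_prod js)" x] by metis
  qed (use that in simp_all)
  show "cox_frame 1 (chain_prod js) (r 0) (r 1)" by (rule frame) (use neg n01 rb cov in blast)+
  show "cox_frame 1 (chain_prod js) (r 1) (r 0)" by (rule frame) (use neg n01 rb cov in blast)+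
qed

text \<open>Deleting the letter M + 1 from the word A t B leaves c0 = A B. As c is c0 times the
  conjugate of t by the inverse of B, it is c0 times the reflection exchanging the new vector
  \<open>p\<close> with \<open>q\<close>, the preimage of \<open>r M\<close> under B, and
  \<open>p\<close> is inserted into the cycle.\<close>

lemma cox_frame_exists:
  assumes "1 \<le> M" "M < CARD('n)" "distinct js" "set js = {..M}"
  shows "\<exists>x \<eta>. cox_frame M (chain_prod js) x \<eta>"
  using assms
proof (induction M arbitrary: js rule: dec_induct)
  case base
  have "js = [0, 1] \<or> js = [1, 0]" using two_element_list base by blast
  then have "cox_frame 1 (chain_prod js) (r 0) (r 1)" using cox_frame_two by blast
  then show ?case by auto
next
  case (step M)
  note M = step.hyps(1) and SM = step.prems(1) and js = step.prems(2,3)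
  have "Suc M \<in> set js" using js by simp
  then obtain us vs where split: "js = us @ Suc M # vs" by (meson split_list)
  have dist: "distinct (us @ vs)" "Suc M \<notin> set (us @ vs)" using js(1) by (auto simp: split)
  have set: "set (us @ vs) = {..M}"
  proof -
    have "set js = insert (Suc M) (set (us @ vs))" by (auto simp: split)
    then have "set (us @ vs) = {..Suc M} - {Suc M}" using dist(2) js(2) by (metis Diff_insert_absorb)
    also have "\<dots> = {..M}" by auto
    finally show ?thesis .
  qed
  define A B c0 c where "A = chain_prod us" and "B = chain_prod vs"
    and "c0 = chain_prod (us @ vs)" and "c = chain_prod js"
  have sub: "set us \<subseteq> {..M}" "set vs \<subseteq> {..M}" unfolding set[symmetric] by auto
  have weyl: "A \<in> weyl_group_D" "B \<in> weyl_group_D" "c0 \<in> weyl_group_D" "c \<in> weyl_group_D"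
    unfolding A_def B_def c0_def c_def
    by (rule chain_prod_weyl; use sub set js SM in \<open>force simp: split\<close>)+
  define t where "t = chain_refl (Suc M)"
  have c: "c *v y = A *v (t *v (B *v y))" for y
    by (simp add: c_def split chain_prod_append chain_prod_Cons A_def B_def t_def)
  have c0: "c0 *v y = A *v (B *v y)" for y by (simp add: c0_def chain_prod_append A_def B_def)
  define p where "p = r (Suc M)"
  have pM: "p \<in> signed_basis" "r M \<in> signed_basis" "p \<noteq> r M" "p \<noteq> - r M"
    using rSuc[OF SM] by (simp_all add: p_def)
  have t_def': "t = reflection_along (p - r M)" by (simp add: t_def chain_refl_Suc p_def)
  have fix_far: "A *v r i = r i" "B *v r i = r i" if "M < i" "i < CARD('n)" for i
    unfolding A_def B_def using chain_prod_fix[of i us] chain_prod_fix[of i vs] sub that M by force+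
  have Ap: "A *v p = p" and Bp: "B *v p = p" using fix_far[of "Suc M"] SM by (auto simp: p_def)
  define q where "q = transpose B *v r M"
  have q: "q \<in> signed_basis" "B *v q = r M"
    using weyl(2) pM by (auto simp: q_def weyl_signed_basis weyl_transpose)
  have cp: "c *v p = c0 *v q"
    using swap_left[OF pM] by (simp add: c c0 Bp q t_def')
  have cq: "c *v q = p" using swap_right[OF pM] by (simp add: c q t_def' Ap)
  have other: "c *v y = c0 *v y"
    if y: "y \<in> signed_basis" "y \<noteq> p" "y \<noteq> - p" "y \<noteq> q" "y \<noteq> - q" for y
  proof -
    have "B *v y \<noteq> B *v p" "B *v y \<noteq> B *v (- p)" "B *v y \<noteq> B *v q" "B *v y \<noteq> B *v (- q)"
      using y weyl_inj[OF weyl(2)] by blast+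
    then have "t *v (B *v y) = B *v y"
      unfolding t_def' by (intro swap_other[OF pM weyl_signed_basis[OF weyl(2) y(1)]])
        (simp_all add: Bp q matrix_vector_mult_uminus)
    then show ?thesis by (simp add: c c0)
  qed
  have q_near: "\<exists>i\<le>M. q = r i \<or> q = - r i"
  proof -
    obtain i where i: "i < CARD('n)" "q = r i \<or> q = - r i" using r_cover[OF q(1)] by blast
    have "i \<le> M"
    proof (rule ccontr)
      assume "\<not> i \<le> M"
      then have "B *v r i = r i" using fix_far(2)[of i] i(1) by simp
      then have "r M = r i \<or> r M = - r i" using q(2) i(2) by (auto simp: matrix_vector_mult_uminus)
      then show False using r_neq[of M i] i(1) SM \<open>\<not> i \<le> M\<close> by auto
    qed
    then show ?thesis using i by blast
  qed
  \<comment> \<open>The vector \<open>q\<close> must lie on the cycle. For M = 1 the roles of the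
    two negated lines can be exchanged; for larger M a vector on the line of \<eta> is negated by
    \<open>c0\<close>, which the word excludes for \<open>q\<close>.\<close>
  have "\<exists>x \<eta>. cox_frame M c0 x \<eta> \<and> q \<noteq> \<eta> \<and> q \<noteq> - \<eta>"
  proof (cases "M = 1")
    case True
    have "us @ vs = [0, 1] \<or> us @ vs = [1, 0]" using two_element_list[OF dist(1)] set True by blast
    then have F: "cox_frame 1 c0 (r 0) (r 1)" "cox_frame 1 c0 (r 1) (r 0)"
      unfolding c0_def using cox_frame_two by blast+
    obtain i where i: "i \<le> 1" "q = r i \<or> q = - r i" using q_near True by blast
    have n01: "r 0 \<noteq> r 1 \<and> r 0 \<noteq> - r 1" "r 1 \<noteq> r 0 \<and> r 1 \<noteq> - r 0"
      using r_neq[of 0 1] r_neq[of 1 0] n2 by auto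
    have "q \<noteq> r (1 - i) \<and> q \<noteq> - r (1 - i)"
      using i n01 by (cases "i = 0") (auto simp: le_Suc_eq)
    moreover have "i = 0 \<or> i = 1" using i(1) by auto
    ultimately show ?thesis using F True by (elim disjE) auto
  next
    case False
    then have M2: "M \<ge> 2" using M by simp
    have Mn: "M < CARD('n)" using SM by simp
    obtain x \<eta> where F: "cox_frame M c0 x \<eta>" using step.IH[OF Mn dist(1) set] unfolding c0_def by blast
    have eta: "c0 *v \<eta> = - \<eta>" using F by (simp add: cox_frame_def)
    have "M \<in> set us \<or> M \<in> set vs" using set by auto
    have "c0 *v q \<noteq> - q"
    proof
      assume "c0 *v q = - q"
      then have Aq: "A *v r M = - q" by (simp add: c0 q)
      have no_neg: "chain_prod ks *v r M \<noteq> - r M" if ks: "M \<in> set ks" "distinct ks" "set ks \<subseteq> {..M}" for ks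
      proof -
        obtain k1 k2 where k: "ks = k1 @ M # k2" using ks(1) by (meson split_list)
        have "set k1 \<subseteq> {..<M}" "set k2 \<subseteq> {..<M}" using ks(2,3) by (auto simp: k le_less)
        then show ?thesis unfolding k by (rule chain_prod_no_negation[OF Mn M2])
      qed
      have fixM: "chain_prod ks *v r M = r M" if "M \<notin> set ks" "set ks \<subseteq> {..M}" for ks
        by (rule chain_prod_fix) (use that M2 Mn in \<open>auto simp: le_less\<close>)
      show False
      proof (cases "M \<in> set us")
        case True
        then have "M \<notin> set vs" using dist by auto
        then have "B *v r M = r M" using fixM sub by (simp add: B_def)
        then have "q = r M" using q(2) weyl_inj[OF weyl(2)] by metis
        then show False using Aq no_neg[OF True] dist sub by (simp add: A_def)
      next
        case False
        then have "A *v r M = r M" using fixM sub by (simp add: A_def)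
        then have "q = - r M" using Aq by (metis minus_minus)
        then have "B *v r M = - r M" using q(2) by (simp add: matrix_vector_mult_uminus) (metis minus_minus)
        moreover have "M \<in> set vs" using False \<open>M \<in> set us \<or> M \<in> set vs\<close> by blast
        ultimately show False using no_neg[of vs] dist sub by (simp add: B_def)
      qed
    qed
    then have "q \<noteq> \<eta>" "q \<noteq> - \<eta>" using eta by (auto simp: matrix_vector_mult_uminus)
    then show ?thesis using F by blast
  qed
  then obtain x \<eta> where F: "cox_frame M c0 x \<eta>" and qe: "q \<noteq> \<eta>" "q \<noteq> - \<eta>" by blast
  obtain i where i: "i \<le> M" "q = r i \<or> q = - r i" using q_near by blast
  have me: "- q \<noteq> \<eta>" "- q \<noteq> - \<eta>" using qe by (metis minus_minus)+
  have "(\<exists>k. r i = ((*v) c0 ^^ k) x \<or> r i = - ((*v) c0 ^^ k) x) \<or> r i = \<eta> \<or> r i = - \<eta>"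
    using F i(1) unfolding cox_frame_def by blast
  moreover have "r i \<noteq> \<eta>" "r i \<noteq> - \<eta>" using i(2) qe me by (metis minus_minus)+
  ultimately obtain l where "r i = ((*v) c0 ^^ l) x \<or> r i = - ((*v) c0 ^^ l) x" by blast
  then have l: "q = ((*v) c0 ^^ l) x \<or> q = - ((*v) c0 ^^ l) x" using i(2) by (metis minus_minus)
  have "c0 *v p = p" by (simp add: c0 Ap Bp)
  then have "cox_frame (Suc M) c (c0 *v q) \<eta>"
    using cox_frame_insert[OF M SM weyl(3,4) F p_def _ l cp cq other] by blast
  then show ?case unfolding c_def by blast
qed

end

section \<open>Powers and order of the Coxeter element\<close>

lemma mat_power_0: "mat_power w 0 = mat 1"
  and mat_power_Suc: "mat_power w (Suc d) = w ** mat_power w d"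
  by (simp_all add: mat_power_def mat_prod_Cons mat_prod_Nil)

lemma mat_power_weyl: "w \<in> weyl_group_D \<Longrightarrow> mat_power w d \<in> weyl_group_D"
  by (induction d) (simp_all add: mat_power_0 mat_power_Suc mat_1_in_weyl weyl_mult)

context D_frame
begin

lemma mat_power_e: "mat_power c d *v e j = e (j + int d)"
  by (induction d)
    (simp_all add: mat_power_0 mat_power_Suc matrix_vector_mul_assoc[symmetric] c_e ac_simps)

lemma mat_power_eta: "mat_power c d *v \<eta> = (if even d then \<eta> else - \<eta>)"
  by (induction d)
    (simp_all add: mat_power_0 mat_power_Suc matrix_vector_mul_assoc[symmetric] c_eta matrix_vector_mult_uminus)

text \<open>The cycle has exact period 2 N, and \<eta> returns after every even number of
  steps.\<close>

lemma mat_order_c: "mat_order c = nat (2 * N)"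
  unfolding mat_order_def
proof (rule Least_equality)
  have "mat_power c (nat (2 * N)) = mat 1"
  proof (rule matrix_eq_on_signed_basis)
    fix a :: "real^'n" assume "a \<in> signed_basis"
    moreover have "mat_power c (nat (2 * N)) *v e j = e j" for j
      using N e_add_mult[of j 2] by (simp add: mat_power_e)
    moreover have "mat_power c (nat (2 * N)) *v \<eta> = \<eta>" using N by (simp add: mat_power_eta even_nat_iff)
    ultimately show "mat_power c (nat (2 * N)) *v a = mat 1 *v a"
      by (auto simp: basis_cases circ_def matrix_vector_mult_uminus)
  qed
  then show "0 < nat (2 * N) \<and> mat_power c (nat (2 * N)) = mat 1" using N by simp
next
  fix k assume k: "0 < k \<and> mat_power c k = mat 1"
  then have "e (0 + int k) = e 0" using mat_power_e[of k 0] by simp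
  then have "2 * N dvd int k" by (simp add: e_eq_iff)
  then have "2 * N \<le> int k" using k by (intro zdvd_imp_le) auto
  then show "nat (2 * N) \<le> k" by simp
qed

end

lemma coxeter_element_D_frame:
  fixes c :: "real^'n^'n"
  assumes n: "CARD('n) \<ge> 3" and simple: "simple_system weyl_group_D \<Delta>" and cox: "coxeter_element \<Delta> c"
  obtains e \<eta> where "D_frame c e \<eta> (int (CARD('n) - 1))"
proof -
  define M where "M = CARD('n) - 1"
  have M: "2 \<le> M" "M < CARD('n)" "{..<CARD('n)} = {..M}" using n by (auto simp: M_def)
  obtain r :: "nat \<Rightarrow> real^'n" where r: "\<And>j. j < CARD('n) \<Longrightarrow> r j \<in> signed_basis"
    "\<And>i j. i < CARD('n) \<Longrightarrow> j < CARD('n) \<Longrightarrow> i \<noteq> j \<Longrightarrow> r i \<noteq> r j \<and> r i \<noteq> - r j"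
    "\<And>a. a \<in> signed_basis \<Longrightarrow> \<exists>j<CARD('n). a = r j \<or> a = - r j"
    and bij: "bij_betw (chain_root r) {..<CARD('n)} \<Delta>"
    using simple_system_chain[OF simple] n by auto
  interpret signed_chain r by unfold_locales (use r n in blast | use n in simp)+
  obtain \<alpha>s where \<alpha>s: "distinct \<alpha>s" "set \<alpha>s = \<Delta>" "c = mat_prod (map reflection_along \<alpha>s)"
    using cox by (auto simp: coxeter_element_def)
  define js where "js = map (inv_into {..M} (chain_root r)) \<alpha>s"
  have bij': "bij_betw (inv_into {..M} (chain_root r)) \<Delta> {..M}" using bij_betw_inv_into[OF bij] M(3) by simp
  have js: "distinct js" "set js = {..M}"
    using \<alpha>s(1,2) bij' by (simp_all add: js_def distinct_map bij_betw_def)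
  have "map chain_refl js = map reflection_along \<alpha>s"
    unfolding js_def map_map
  proof (rule map_cong[OF refl])
    fix \<alpha> assume "\<alpha> \<in> set \<alpha>s"
    then have "\<alpha> \<in> chain_root r ` {..M}" using \<alpha>s(2) bij M(3) by (simp add: bij_betw_def)
    then show "(chain_refl \<circ> inv_into {..M} (chain_root r)) \<alpha> = reflection_along \<alpha>"
      by (simp add: chain_refl_def f_inv_into_f)
  qed
  then have c: "c = chain_prod js" using \<alpha>s(3) by (simp add: chain_prod_def)
  have cw: "c \<in> weyl_group_D" unfolding c by (rule chain_prod_weyl) (use js M in auto)
  obtain x \<eta> where F: "cox_frame M c x \<eta>"
    using cox_frame_exists[OF _ M(2) js] M(1) c by auto
  define f where "f k = ((*v) c ^^ k) x" for k
  have x: "x \<in> signed_basis" "\<eta> \<in> signed_basis" "x \<noteq> \<eta>" "x \<noteq> - \<eta>" "f M = - x" "c *v \<eta> = - \<eta>"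
    and fk: "\<And>k. 0 < k \<Longrightarrow> k < M \<Longrightarrow> f k \<noteq> x \<and> f k \<noteq> - x"
    and fr: "\<And>i. i \<le> M \<Longrightarrow> (\<exists>k. r i = f k \<or> r i = - f k) \<or> r i = \<eta> \<or> r i = - \<eta>"
    using F unfolding cox_frame_def f_def by blast+
  have fM: "f (k + M) = - f k" for k
    using x(5) by (simp add: f_def funpow_add funpow_uminus)
  have fSuc: "c *v f k = f (k + 1)" for k by (simp add: f_def)
  have f2M: "((*v) c ^^ (2 * M)) x = x" using fM[of M] x(5) by (simp add: f_def mult_2)
  define N where "N = int M"
  \<comment> \<open>Iterates exist only for natural exponents; reduction modulo the period 2 N gives
    the integer indexing of the frame.\<close>
  define e where "e j = f (nat (j mod (2 * N)))" for j
  have e_f: "e j = f k" if "j mod (2 * N) = int k mod (2 * N)" for j k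
  proof -
    have "j mod (2 * N) = int (k mod (2 * M))" using that by (simp add: N_def zmod_int)
    then have "nat (j mod (2 * N)) = k mod (2 * M)" by simp
    then show ?thesis using funpow_mod_eq[OF f2M, of k] by (simp add: e_def f_def)
  qed
  have N2: "N \<ge> 2" using M by (simp add: N_def)
  have e_ex: "\<exists>k. j mod (2 * N) = int k \<and> e j = f k" for j
  proof -
    have "j mod (2 * N) = int (nat (j mod (2 * N)))" using N2 by simp
    then show ?thesis using e_def by blast
  qed
  have e_add: "e (j + int d) = f (k + d)" if "j mod (2 * N) = int k" for j k d
    by (rule e_f) (metis mod_add_left_eq of_nat_add that)
  have inj_x: "f k \<noteq> \<eta> \<and> f k \<noteq> - \<eta>" for k
  proof (induction k)
    case 0 then show ?case using x by (simp add: f_def)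
  next
    case (Suc k)
    have "c *v f k \<noteq> c *v (- \<eta>)" "c *v f k \<noteq> c *v \<eta>" using Suc weyl_inj[OF cw] by blast+
    then show ?case using fSuc[of k] x(6) by (simp add: matrix_vector_mult_uminus)
  qed
  have not_x: "f d \<noteq> x" if "0 < d" "d < 2 * M" for d
  proof -
    consider "d < M" | "d = M" | "M < d" by linarith
    then show ?thesis
    proof cases
      case 2 then show ?thesis using x signed_basis_neq_uminus[OF x(1)] by metis
    next
      case 3
      then have "f d = - f (d - M)" using fM[of "d - M"] by simp
      moreover have "f (d - M) \<noteq> - x" using fk[of "d - M"] 3 that by simp
      ultimately show ?thesis by (metis minus_minus)
    qed (use fk that in blast)
  qed
  have "D_frame c e \<eta> N"
  proof
    show "N \<ge> 2" by (rule N2)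
    show "c \<in> weyl_group_D" by (rule cw)
    show "\<eta> \<in> signed_basis" by (rule x(2))
    show "c *v \<eta> = - \<eta>" by (rule x(6))
    show "e j \<in> signed_basis" for j
      unfolding e_def f_def by (rule funpow_weyl_basis[OF cw x(1)])
    show "e (j + N) = - e j" for j
      using e_ex[of j] e_add[of j _ M] fM by (auto simp: N_def)
    show "c *v e j = e (j + 1)" for j
      using e_ex[of j] e_add[of j _ 1] fSuc by auto
    show "e j \<noteq> \<eta>" for j using inj_x by (simp add: e_def)
    show "2 * N dvd i - j" if eq: "e i = e j" for i j
    proof -
      have *: "a = b" if "a \<le> b" "b < 2 * M" "f a = f b" for a b
      proof (rule ccontr)
        assume "a \<noteq> b"
        then have d: "0 < b - a" "b - a < 2 * M" using that by auto
        have "b = a + (b - a)" using that by simp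
        then have "f b = ((*v) c ^^ a) (f (b - a))" unfolding f_def by (metis comp_apply funpow_add)
        then have "((*v) c ^^ a) (f (b - a)) = ((*v) c ^^ a) x" using that(3) by (simp add: f_def)
        then show False using not_x[OF d] funpow_weyl_inj[OF cw] by blast
      qed
      obtain a b where ab: "i mod (2 * N) = int a" "e i = f a" "j mod (2 * N) = int b" "e j = f b"
        using e_ex by metis
      have "int a < 2 * N" "int b < 2 * N" using ab N2 by (metis pos_mod_bound zero_less_mult_iff zero_less_numeral
            less_le_trans)+
      then have "a < 2 * M" "b < 2 * M" by (simp_all add: N_def)
      then have "a = b" using *[of a b] *[of b a] eq ab by (cases "a \<le> b") auto
      then have "i mod (2 * N) = j mod (2 * N)" using ab by simp
      then show ?thesis by (simp add: mod_eq_dvd_iff)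
    qed
    fix a :: "real^'n" assume "a \<in> signed_basis"
    then obtain i where i: "i < CARD('n)" "a = r i \<or> a = - r i" using r(3) by blast
    have "i \<le> M" using i(1) by (simp add: M_def)
    moreover have "f k \<in> range e" "- f k \<in> range e" for k
    proof -
      show "f k \<in> range e" using e_f[of "int k" k] by (metis rangeI)
      have "e (int (k + M)) = - f k" using e_f[of "int (k + M)" "k + M"] fM by simp
      then show "- f k \<in> range e" by (metis rangeI)
    qed
    ultimately show "a = \<eta> \<or> a = - \<eta> \<or> a \<in> range e"
      using fr[of i] i(2) by (metis minus_minus)
  qed
  then show thesis using that by (simp add: N_def M_def)
qed

context D_frame
begin

subsection \<open>The base point\<close>

text \<open>Gives \<open>e j\<close> the value exp (pi i j / N), a power of \<omega> since h = 2 N,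
  and \<eta> the value 0. Half of the cycle suffices, as \<open>e\<close> and the exponential both
  change sign after \<open>N\<close> steps.\<close>

definition zeta :: "complex^'n" where
  "zeta = (\<chi> i. \<Sum>j\<in>{0..<N}. cis (pi * of_int j / of_int N) * of_real (e j $ i))"

abbreviation lam :: "real^'n \<Rightarrow> complex" where "lam \<equiv> coord zeta"

lemma coord_zeta: "lam a = (\<Sum>j\<in>{0..<N}. cis (pi * of_int j / of_int N) * of_real (e j \<bullet> a))"
proof -
  have "lam a = (\<Sum>i\<in>UNIV. \<Sum>j\<in>{0..<N}. cis (pi * of_int j / of_int N) * (of_real (e j $ i) * of_real (a $ i)))"
    by (simp add: coord_def zeta_def sum_distrib_right mult.assoc)
  also have "\<dots> = (\<Sum>j\<in>{0..<N}. \<Sum>i\<in>UNIV. cis (pi * of_int j / of_int N) * (of_real (e j $ i) * of_real (a $ i)))"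
    by (rule sum.swap)
  also have "\<dots> = (\<Sum>j\<in>{0..<N}. cis (pi * of_int j / of_int N) * of_real (e j \<bullet> a))"
    by (simp add: inner_vec_def sum_distrib_left)
  finally show ?thesis .
qed

lemma lam_eta [simp]: "lam \<eta> = 0"
  by (simp add: coord_zeta)

lemma lam_e: "lam (e k) = cis (pi * of_int k / of_int N)"
proof -
  define r q where "r = k mod N" and "q = k div N"
  have k: "k = r + q * N" by (simp add: r_def q_def)
  have r: "0 \<le> r" "r < N" using N by (auto simp: r_def)
  have "e j \<bullet> e r = (if j = r then 1 else 0)" if "j \<in> {0..<N}" for j
  proof (cases "j = r")
    case False
    then have "\<not> N dvd r - j" using that r zdvd_imp_le[of N "\<bar>r - j\<bar>"] by auto
    then show ?thesis using False by (simp add: inner_e_e cdelta_def)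
  qed simp
  then have "lam (e r) = (\<Sum>j\<in>{0..<N}. if j = r then cis (pi * of_int j / of_int N) else 0)"
    unfolding coord_zeta by (intro sum.cong refl) simp
  also have "\<dots> = cis (pi * of_int r / of_int N)" using r by simp
  finally have 1: "lam (e r) = cis (pi * of_int r / of_int N)" .
  have "cis (pi * of_int k / of_int N) = cis (pi * of_int r / of_int N) * cis (pi * of_int q)"
    using N by (simp add: k cis_mult field_simps)
  moreover have "cis (pi * of_int q) = (if even q then 1 else -1)"
    by (simp add: complex_eq_iff cos_npi_int sin_npi_int)
  ultimately show ?thesis using 1 by (simp add: k e_add_mult)
qed

lemma lam_inj:
  assumes "a \<in> circ" "b \<in> circ" "lam a = lam b"
  shows "a = b"
proof -
  obtain i j where a: "a = e i" and b: "b = e j" using assms by (auto simp: circ_def)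
  have "cis (pi * of_int i / of_int N) = cis (pi * of_int j / of_int N)"
    using assms(3) by (simp add: a b lam_e)
  then have "cis (pi * of_int i / of_int N - pi * of_int j / of_int N) = 1"
    using cis_divide[of "pi * of_int i / of_int N" "pi * of_int j / of_int N"] by simp
  then have "cos (pi * of_int i / of_int N - pi * of_int j / of_int N) = 1"
    by (metis cis.sel(1) one_complex.sel(1))
  then obtain m :: int where "pi * of_int i / of_int N - pi * of_int j / of_int N = of_int m * 2 * pi"
    using cos_one_2pi_int by blast
  then have "pi * (of_int i - of_int j) = pi * (of_int m * 2 * of_int N)" using N by (simp add: field_simps)
  then have "real_of_int (i - j) = real_of_int (m * 2 * N)" by simp
  then have "i - j = m * 2 * N" by (simp only: of_int_eq_iff)
  then have "2 * N dvd i - j" by simp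
  then show ?thesis by (simp add: a b e_eq_iff)
qed

lemma lam_nonzero: "a \<in> circ \<Longrightarrow> lam a \<noteq> 0"
  by (auto simp: circ_def lam_e)

lemma lam_eq_iff: "a \<in> circ \<Longrightarrow> b \<in> circ \<Longrightarrow> lam a = lam b \<longleftrightarrow> a = b"
  using lam_inj by blast

lemma c_circ: "c *v a \<in> circ \<longleftrightarrow> a \<in> circ"
proof
  assume "a \<in> circ" then show "c *v a \<in> circ" by (auto simp: circ_def c_e)
next
  assume "c *v a \<in> circ"
  then obtain j where "c *v a = e j" by (auto simp: circ_def)
  then have "c *v a = c *v e (j - 1)" by (simp add: c_e)
  then show "a \<in> circ" using weyl_inj[OF c_weyl] by simp
qed

lemma lam_c:
  assumes "a \<in> signed_basis"
  shows "lam (c *v a) = cis (pi / of_int N) * lam a"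
proof -
  have "lam (c *v e j) = cis (pi / of_int N) * lam (e j)" for j
    by (simp add: c_e lam_e cis_mult add_divide_distrib[symmetric] algebra_simps)
  then show ?thesis using assms by (auto simp: basis_cases circ_def c_eta matrix_vector_mult_uminus)
qed

subsection \<open>Cyclic order\<close>

lemma S_circ:
  assumes "a \<in> circ" "b \<in> circ"
  shows "S a b = 1 \<or> S a b = 0 \<or> S a b = -1" "S a b = 0 \<longleftrightarrow> a = b \<or> a = - b"
proof -
  obtain i j where a: "a = e i" and b: "b = e j" using assms by (auto simp: circ_def)
  show "S a b = 1 \<or> S a b = 0 \<or> S a b = -1" by (simp add: a b S_e csign_def)
  have "a = b \<or> a = - b \<longleftrightarrow> a \<bullet> b \<noteq> 0" using assms inner_eq_0_iff[of a b] by (auto simp: circ_basis)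
  then show "S a b = 0 \<longleftrightarrow> a = b \<or> a = - b" by (simp add: a b S_e inner_e_e csign_def cdelta_def)
qed

lemma S_basis:
  assumes "a \<in> signed_basis" "b \<in> signed_basis"
  shows "S a b = 1 \<or> S a b = 0 \<or> S a b = -1" "S a b \<noteq> 0 \<Longrightarrow> a \<in> circ" "S a b \<noteq> 0 \<Longrightarrow> b \<in> circ"
  using assms S_circ(1)[of a b] by (auto simp: basis_cases)

definition idx :: "real^'n \<Rightarrow> int" where "idx a = (SOME j. e j = a)"

text \<open>The number of forward steps from \<open>a\<close> to \<open>b\<close>, between 0 and 2 N
  - 1; reduction modulo 2 N makes it independent of the indices chosen by \<open>idx\<close>. It
  measures chords in the descents below.\<close>

definition dst :: "real^'n \<Rightarrow> real^'n \<Rightarrow> nat" where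
  "dst a b = nat ((idx b - idx a) mod (2 * N))"

lemma e_idx: "a \<in> circ \<Longrightarrow> e (idx a) = a"
  unfolding idx_def circ_def by (rule someI_ex) auto

lemma S_eq_1_iff_dst:
  assumes "a \<in> circ" "b \<in> circ"
  shows "S a b = 1 \<longleftrightarrow> 0 < dst a b \<and> int (dst a b) < N"
  using assms S_e[of "idx a" "idx b"] csign_eq_1_iff(1)[of N "idx b - idx a"] N
  by (auto simp: e_idx dst_def)

lemma dst_add:
  assumes "a \<in> circ" "b \<in> circ" "r \<in> circ" "S a b = 1" "S a r = 1" "S r b = 1"
  shows "dst a b = dst a r + dst r b" "0 < dst a r" "0 < dst r b"
proof -
  have 1: "0 < dst a r" "int (dst a r) < N" "0 < dst r b" "int (dst r b) < N"
    using assms by (auto simp: S_eq_1_iff_dst)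
  have eq: "int (dst x y) = (idx y - idx x) mod (2 * N)" for x y using N by (simp add: dst_def)
  have "int (dst a b) = (int (dst a r) + int (dst r b)) mod (2 * N)"
    unfolding eq by (simp add: mod_add_eq)
  also have "\<dots> = int (dst a r) + int (dst r b)" using 1 by simp
  finally show "dst a b = dst a r + dst r b" by simp
qed (use assms in \<open>auto simp: S_eq_1_iff_dst\<close>)

section \<open>Symmetric subsets of the cycle and their shortest chords\<close>

definition sym_circ :: "(real^'n) set \<Rightarrow> bool" where
  "sym_circ P \<longleftrightarrow> P \<subseteq> circ \<and> (\<forall>x\<in>P. - x \<in> P)"

text \<open>\<open>q\<close> is the next element of \<open>P\<close> after \<open>k\<close>, less
  than a half turn ahead.\<close>

definition adj :: "(real^'n) set \<Rightarrow> real^'n \<Rightarrow> real^'n \<Rightarrow> bool" where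
  "adj P k q \<longleftrightarrow> k \<in> P \<and> q \<in> P \<and> S k q = 1 \<and> (\<forall>r\<in>P. \<not> (S k r = 1 \<and> S r q = 1))"

text \<open>\<eta> is deliberately left unconstrained: it absorbs the sign changes that parity
  forces.\<close>

definition fixes_off :: "(real^'n) set \<Rightarrow> real^'n^'n \<Rightarrow> bool" where
  "fixes_off P w \<longleftrightarrow> (\<forall>d\<in>circ - P. w *v d = d)"

lemma sym_circD: "sym_circ P \<Longrightarrow> x \<in> P \<Longrightarrow> x \<in> circ" "sym_circ P \<Longrightarrow> - x \<in> P \<longleftrightarrow> x \<in> P"
  by (auto simp: sym_circ_def)

lemma sym_circ_basis: "sym_circ P \<Longrightarrow> x \<in> P \<Longrightarrow> x \<in> signed_basis"
  using sym_circD circ_basis by blast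

lemma sym_circ_diff: "sym_circ P \<Longrightarrow> sym_circ (P - {k, - k})"
  by (auto simp: sym_circ_def)

lemma sym_circ_finite: "sym_circ P \<Longrightarrow> finite P"
  using finite_subset[of P circ] by (auto simp: sym_circ_def)

lemma card_diff_less: "sym_circ P \<Longrightarrow> k \<in> P \<Longrightarrow> card (P - {k, - k}) < card P"
  by (intro psubset_card_mono sym_circ_finite) auto

lemma adj_neq:
  assumes "sym_circ P" "adj P k q"
  shows "k \<noteq> q" "k \<noteq> - q" "q \<noteq> k" "q \<noteq> - k"
  using assms by (auto simp: adj_def)

text \<open>No element of \<open>P\<close> separates \<open>k\<close> from \<open>q\<close>. Applied
  to \<open>x\<close> and to \<open>- x\<close>, this puts both on the same side of the line of
  \<open>x\<close>.\<close>

lemma adj_S: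
  assumes P: "sym_circ P" and adj: "adj P k q" and x: "x \<in> P \<or> x = \<eta> \<or> x = - \<eta>"
    and neq: "x \<noteq> k" "x \<noteq> - k" "x \<noteq> q" "x \<noteq> - q"
  shows "S x k = S x q"
proof (cases "x \<in> P")
  case True
  have c: "k \<in> circ" "q \<in> circ" "x \<in> circ" using adj True P by (auto simp: adj_def dest: sym_circD(1))
  have n: "\<And>r. r \<in> P \<Longrightarrow> S k r = 1 \<Longrightarrow> S r q \<noteq> 1" using adj by (auto simp: adj_def)
  have k: "S x k = - S k x" by (rule S_skew)
  have "S k x \<noteq> 0" "S x q \<noteq> 0" using neq S_circ(2)[of k x] S_circ(2)[of x q] c by auto
  then have "S k x = 1 \<or> S k x = -1" "S x q = 1 \<or> S x q = -1" using S_circ(1)[of k x] S_circ(1)[of x q] c by auto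
  moreover have "S k x = 1 \<Longrightarrow> S x q \<noteq> 1" using n True by simp
  moreover have "S k x = -1 \<Longrightarrow> S x q \<noteq> -1" using n[of "- x"] True P by (auto dest: sym_circD(2))
  ultimately show ?thesis using k by auto
qed (use x in auto)

text \<open>A chord that skips an element of \<open>P\<close> is subdivided there; one part inherits
  the property \<open>R\<close>, and both parts are shorter.\<close>

lemma adj_exists:
  assumes P: "sym_circ P"
    and kq: "k \<in> P" "q \<in> P" "S k q = 1" "R k q"
    and R: "\<And>k q r. k \<in> P \<Longrightarrow> q \<in> P \<Longrightarrow> r \<in> P \<Longrightarrow> R k q \<Longrightarrow> S k r = 1 \<Longrightarrow> S r q = 1 \<Longrightarrow> R k r \<or> R r q"
  shows "\<exists>k q. adj P k q \<and> R k q"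
  using kq
proof (induction "dst k q" arbitrary: k q rule: less_induct)
  case less
  show ?case
  proof (cases "adj P k q")
    case False
    then obtain r where r: "r \<in> P" "S k r = 1" "S r q = 1" using less by (auto simp: adj_def)
    have "dst k r < dst k q" "dst r q < dst k q"
      using dst_add[of k q r] less r sym_circD(1)[OF P] by simp_all
    then show ?thesis using R[of k q r] less r by blast
  qed (use less in blast)
qed

lemma fixes_off_invariant:
  assumes w: "w \<in> weyl_group_D" "fixes_off P w" and x: "x \<in> P \<or> x = \<eta> \<or> x = - \<eta>" and P: "sym_circ P"
  shows "w *v x \<in> P \<or> w *v x = \<eta> \<or> w *v x = - \<eta>"
proof -
  have xb: "x \<in> signed_basis" using x P sym_circ_basis by auto
  have "w *v x \<notin> circ - P"
  proof
    assume *: "w *v x \<in> circ - P"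
    then have "w *v (w *v x) = w *v x" using w(2) by (auto simp: fixes_off_def)
    then have "w *v x = x" using weyl_inj[OF w(1)] by blast
    then show False using * x by auto
  qed
  moreover have "w *v x \<in> signed_basis" using weyl_signed_basis[OF w(1) xb] .
  ultimately show ?thesis by (auto simp: basis_cases)
qed

text \<open>If no element of \<open>P\<close> is fixed or sent to its successor, then noncrossing
  excludes in turn forward chords, negations and backward chords. All of \<open>P\<close> would be
  sent to the line of \<eta>, but \<open>P\<close> contains two different lines.\<close>

lemma nc_short_chord:
  assumes w: "w \<in> weyl_group_D" "nc w" "fixes_off P w" and P: "sym_circ P"
    and k12: "k1 \<in> P" "k2 \<in> P" "k2 \<noteq> k1" "k2 \<noteq> - k1"
  shows "\<exists>k\<in>P. w *v k = k \<or> adj P k (w *v k)"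
proof (rule ccontr)
  assume neg: "\<not> ?thesis"
  then have nofix: "w *v k \<noteq> k" if "k \<in> P" for k using that by blast
  note nc = ncD'[OF w(2)]
  have circ: "x \<in> circ" and bas: "x \<in> signed_basis" if "x \<in> P" for x
    using that P sym_circD(1) sym_circ_basis by blast+
  have wbas: "w *v x \<in> signed_basis" if "x \<in> signed_basis" for x using weyl_signed_basis[OF w(1) that] .
  have wP: "w *v x \<in> P" if "x \<in> P" "w *v x \<in> circ" for x
    using fixes_off_invariant[OF w(1,3) _ P, of x] that eta_notin_circ by metis
  have wu: "w *v (- x) = - (w *v x)" for x by (rule matrix_vector_mult_uminus)
  have S1: "S a b = 1 \<or> S a b = -1" if "a \<in> circ" "b \<in> circ" "a \<noteq> b" "a \<noteq> - b" for a b
    using S_circ[of a b] that by auto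
  have ineq: "a \<bullet> b = (if a = b then 1 else if a = - b then -1 else 0)"
    if "a \<in> signed_basis" "b \<in> signed_basis" for a b
    by (rule inner_signed_basis[OF that])
  \<comment> \<open>Descent on the length of a forward chord from \<open>k\<close>: let
    \<open>r\<close> be the nearest element of \<open>P\<close> inside it. Noncrossing puts the
    image \<open>s\<close> of \<open>r\<close> inside as well, necessarily beyond \<open>r\<close>,
    and the chord from \<open>r\<close> to \<open>s\<close> is shorter.\<close>
  have no_chord: "\<not> (k \<in> P \<and> w *v k \<in> P \<and> S k (w *v k) = 1)" for k
  proof (induction "dst k (w *v k)" arbitrary: k rule: less_induct)
    case less
    show ?case
    proof
      assume k: "k \<in> P \<and> w *v k \<in> P \<and> S k (w *v k) = 1"
      let ?B = "{r \<in> P. S k r = 1 \<and> S r (w *v k) = 1}"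
      have "?B \<noteq> {}" using neg k by (auto simp: adj_def)
      moreover have "finite ?B" using sym_circ_finite[OF P] by simp
      ultimately obtain r where r: "r \<in> ?B" and min: "\<And>r'. r' \<in> ?B \<Longrightarrow> dst k r \<le> dst k r'"
        using ex_is_arg_min_if_finite[of ?B "dst k"] unfolding is_arg_min_linorder by blast
      define s where "s = w *v r"
      have rP: "r \<in> P" "S k r = 1" "S r (w *v k) = 1" using r by auto
      have neq: "r \<noteq> k" "r \<noteq> - k" using rP by auto
      have sb: "s \<in> signed_basis" unfolding s_def using wbas bas rP by blast
      have eq: "S (w *v k) s - S (w *v k) r - S k s + S k r = (w *v k) \<bullet> r - k \<bullet> s"
        using nc[of k r] by (simp add: s_def)
      have "w *v k \<noteq> r" "w *v k \<noteq> - r" using rP by auto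
      then have "(w *v k) \<bullet> r = 0" using ineq[of "w *v k" r] bas k rP by simp
      moreover have "S (w *v k) r = -1" using S_skew[of "w *v k" r] rP by simp
      ultimately have eq: "S (w *v k) s - S k s + 2 = - (k \<bullet> s)" using eq rP by simp
      have sk: "s \<noteq> k"
      proof
        assume "s = k"
        then have "S (w *v k) k + 2 = -1" using eq bas k by simp
        then show False using S_skew[of "w *v k" k] k by simp
      qed
      have smk: "s \<noteq> - k"
      proof
        assume "s = - k"
        then have "- S (w *v k) k + 2 = 1" using eq bas k by simp
        then show False using S_skew[of "w *v k" k] k by simp
      qed
      have "k \<bullet> s = 0" using ineq[of k s] bas k sb sk smk by (auto simp: minus_equation_iff)
      then have "S k s = 1" "S (w *v k) s = -1"
        using eq S_basis(1)[of "w *v k" s] S_basis(1)[of k s] sb bas k by auto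
      then have s: "S k s = 1" "S s (w *v k) = 1" using S_skew[of s "w *v k"] by auto
      have sP: "s \<in> P" using wP[of r] S_basis(3)[of k s] s sb bas k rP by (simp add: s_def)
      then have le: "dst k r \<le> dst k s" using min s by auto
      have "s \<noteq> r" using nofix[OF rP(1)] by (simp add: s_def)
      moreover have "s \<noteq> - r" using s rP by auto
      moreover have "S s r \<noteq> 1"
      proof
        assume "S s r = 1"
        then have "dst k r = dst k s + dst s r" "0 < dst s r"
          using dst_add[of k r s] circ k rP s sP by auto
        then show False using le by simp
      qed
      ultimately have "S s r = -1" using S1[of s r] circ sP rP by blast
      then have Srs: "S r s = 1" using S_skew[of r s] by simp
      have "dst r s < dst k s" using dst_add[of k s r] circ k rP s sP Srs by auto
      also have "dst k s < dst k (w *v k)" using dst_add[of k "w *v k" s] circ k s sP by auto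
      finally show False using less[of r] rP sP Srs by (simp add: s_def)
    qed
  qed
  \<comment> \<open>If \<open>k\<close> were negated, the identity would keep the vectors ahead of
    \<open>k\<close> ahead of it. The nearest of them would then have to move forward, which is
    already excluded.\<close>
  have no_neg: "w *v k \<noteq> - k" if k: "k \<in> P" for k
  proof
    assume wk: "w *v k = - k"
    obtain q where q: "q \<in> P" "q \<noteq> k" "q \<noteq> - k" using k12 by (cases "k1 = k \<or> k1 = - k") (metis minus_minus)+
    have side: "S k (w *v q) = S k q" if q: "q \<in> P" "q \<noteq> k" "q \<noteq> - k" for q
    proof -
      have "w *v q \<noteq> - k" "w *v q \<noteq> k"
        using q wk weyl_inj[OF w(1)] wu by (metis, metis minus_minus)
      then have "k \<bullet> (w *v q) = 0" "k \<bullet> q = 0"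
        using ineq[of k "w *v q"] ineq[of k q] bas k q wbas by (auto simp: minus_equation_iff)
      then show ?thesis using nc[of k q] by (simp add: wk)
    qed
    define q1 where "q1 = (if S k q = 1 then q else - q)"
    have "k \<noteq> - q" using q(3) by (metis minus_minus)
    then have q1: "q1 \<in> P" "S k q1 = 1"
      using q S1[of k q] circ[of q] circ[of k] k P by (auto simp: q1_def sym_circD(2))
    let ?B = "{r \<in> P. S k r = 1}"
    have "?B \<noteq> {}" "finite ?B" using q1 sym_circ_finite[OF P] by auto
    then obtain r where r: "r \<in> P" "S k r = 1" and min: "\<And>r'. r' \<in> P \<Longrightarrow> S k r' = 1 \<Longrightarrow> dst k r \<le> dst k r'"
      using ex_is_arg_min_if_finite[of ?B "dst k"] unfolding is_arg_min_linorder by blast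
    have "r \<noteq> k" "r \<noteq> - k" using r by auto
    then have 1: "S k (w *v r) = 1" using side r by simp
    then have wr: "w *v r \<in> P" using wP[of r] S_basis(3)[of k "w *v r"] bas k wbas r by auto
    have "w *v r \<noteq> r" "w *v r \<noteq> - r" using nofix r 1 by auto
    moreover have "S (w *v r) r \<noteq> 1"
    proof
      assume "S (w *v r) r = 1"
      then have "dst k r = dst k (w *v r) + dst (w *v r) r" "0 < dst (w *v r) r"
        using dst_add[of k r "w *v r"] circ k r wr 1 by auto
      then show False using min[OF wr 1] by simp
    qed
    ultimately have "S (w *v r) r = -1" using S1[of "w *v r" r] circ wr r by blast
    then have "S r (w *v r) = 1" using S_skew[of r "w *v r"] by simp
    then show False using no_chord[of r] r wr by blast
  qed
  \<comment> \<open>A backward chord from \<open>k\<close> to \<open>a\<close> is followed by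
    another backward chord or by a step to the line of \<eta>. The identity for \<open>a\<close> and
    \<open>k\<close> then asks for a value 3 of \<open>S\<close>, or equates 1 with -1.\<close>
  have only_eta: "w *v k = \<eta> \<or> w *v k = - \<eta>" if k: "k \<in> P" for k
  proof (rule ccontr)
    assume "\<not> ?thesis"
    then have aP: "w *v k \<in> P" using fixes_off_invariant[OF w(1,3) _ P, of k] k by auto
    define a where "a = w *v k"
    have "k \<noteq> - (w *v k)" using no_neg[OF k] by (metis minus_minus)
    then have ka: "S k a = -1"
      using S1[of k a] no_chord[of k] nofix[OF k] no_neg[OF k] circ k aP
      by (auto simp: a_def)
    have a: "a \<in> P" "w *v a \<noteq> a" "w *v a \<noteq> - a" using aP nofix no_neg by (auto simp: a_def)
    have neq: "w *v a \<noteq> k \<or> S (w *v a) a \<noteq> 1" using ka by auto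
    have eq: "S (w *v a) a - S (w *v a) k + S a k = (w *v a) \<bullet> k - 1"
      using nc[of a k] bas a by (simp add: a_def)
    have ak: "S a k = 1" using ka S_skew[of a k] by simp
    show False
    proof (cases "w *v a \<in> circ")
      case False
      then have wa: "w *v a = \<eta> \<or> w *v a = - \<eta>" using wbas[OF bas[OF a(1)]] by (auto simp: basis_cases)
      then have "S (w *v a) x = 0" for x
        by (elim disjE) (simp_all only: S_eta S_uminus_left minus_zero)
      moreover have "k \<noteq> \<eta>" "k \<noteq> - \<eta>" using circ[OF k] by auto
      then have "\<eta> \<bullet> k = 0" using inner_eq_0_iff[of \<eta> k] bas[OF k] by (auto simp: minus_equation_iff)
      then have "(w *v a) \<bullet> k = 0" using wa by (elim disjE) (simp_all only: inner_minus_left minus_zero)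
      ultimately show False using eq ak by simp
    next
      case True
      then have waP: "w *v a \<in> P" using wP a by blast
      then have "S a (w *v a) \<noteq> 1" using no_chord[of a] a by blast
      moreover have "a \<noteq> - (w *v a)" using a by (metis minus_minus)
      ultimately have "S a (w *v a) = -1" using S1[of a "w *v a"] a circ waP by auto
      then have wa: "S (w *v a) a = 1" using S_skew[of "w *v a" a] by simp
      have "w *v a \<noteq> k" using wa ka ak S_skew[of k a] eq bas k by auto
      moreover have "w *v a \<noteq> - k" using wa ak eq bas k by auto
      ultimately have "(w *v a) \<bullet> k = 0" using ineq[of "w *v a" k] bas waP k by simp
      then have "S (w *v a) k = 3" using eq wa ak by simp
      then show False using S_circ(1)[OF True circ[OF k]] by auto
    qed
  qed
  show False
  proof -
    have "w *v k2 = w *v k1 \<or> w *v k2 = w *v (- k1)"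
      using only_eta[OF k12(1)] only_eta[OF k12(2)] wu by auto
    then show False using weyl_inj[OF w(1)] k12 by blast
  qed
qed

end

context D_frame
begin

subsection \<open>Shortening a chord\<close>

lemma swap_adj:
  assumes P: "sym_circ P" and adj: "adj P k q"
  shows "k \<in> signed_basis" "q \<in> signed_basis" "k \<noteq> q" "k \<noteq> - q" "k \<in> circ" "q \<in> circ"
  using assms adj_neq[OF assms] sym_circD(1)[OF P] circ_basis by (auto simp: adj_def)

text \<open>With \<open>w\<close> fixing \<open>q\<close>, the product sends \<open>k\<close> to
  \<open>q\<close> and \<open>q\<close> to \<open>w *v k\<close>. Adjacency makes pairing through
  \<open>S\<close> with b = k - q agree up to sign with the inner product on every relevant vector
  off the line of \<open>q\<close>; this makes the defect of the identity invariant when the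
  arguments are also reflected.\<close>

lemma nc_mult_swap:
  assumes P: "sym_circ P" and adj: "adj P k q"
    and w: "w \<in> weyl_group_D" "fixes_off P w" "w *v q = q"
  shows "nc (w ** reflection_along (k - q)) \<longleftrightarrow> nc w"
proof -
  note kq = swap_adj[OF P adj]
  let ?t = "reflection_along (k - q)" and ?b = "k - q"
  have chord: "S v ?b = - (v \<bullet> ?b)" if v: "v \<in> P \<or> v = \<eta> \<or> v = - \<eta>" "v \<noteq> q" "v \<noteq> - q" for v
  proof -
    have S: "S k q = 1" using adj by (simp add: adj_def)
    have vb: "v \<in> signed_basis" using v P sym_circ_basis by auto
    consider "v = k" | "v = - k" | "v \<noteq> k" "v \<noteq> - k" by blast
    then show ?thesis
    proof cases
      case 3
      then have "S v k = S v q" using adj_S[OF P adj v(1)] v by blast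
      moreover have "v \<bullet> k = 0" "v \<bullet> q = 0" using 3 v vb kq inner_eq_0_iff by blast+
      ultimately show ?thesis by (simp add: S_simps inner_diff_right)
    qed (use kq S in \<open>simp_all add: S_simps inner_diff_right inner_signed_basis\<close>)
  qed
  \<comment> \<open>On a basis vector moved by \<open>w\<close>, neither it nor its image lies on
    the line of \<open>q\<close>, so the formula for chords applies to both; fixed vectors are
    trivial.\<close>
  have f: "S (w *v x - x) ?b + (w *v x) \<bullet> ?b = x \<bullet> ?b" for x
  proof (induction x rule: signed_basis_induct)
    fix a :: "real^'n" assume a: "a \<in> signed_basis"
    show "S (w *v a - a) ?b + (w *v a) \<bullet> ?b = a \<bullet> ?b"
    proof (cases "w *v a = a")
      case False
      then have a1: "a \<in> P \<or> a = \<eta> \<or> a = - \<eta>" using a w(2) by (auto simp: basis_cases fixes_off_def)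
      have a2: "a \<noteq> q" "a \<noteq> - q" using False w(3) by (auto simp: matrix_vector_mult_uminus)
      have "w *v a \<noteq> w *v q" "w *v a \<noteq> w *v (- q)" using a2 weyl_inj[OF w(1)] by blast+
      then have a3: "w *v a \<noteq> q" "w *v a \<noteq> - q" using w(3) by (auto simp: matrix_vector_mult_uminus)
      have "S (w *v a) ?b = - ((w *v a) \<bullet> ?b)" "S a ?b = - (a \<bullet> ?b)"
        using chord[OF a1 a2] chord[OF fixes_off_invariant[OF w(1,2) a1 P] a3] by auto
      then show ?thesis by (simp add: S_diff_left)
    qed simp
  next
    fix r x assume "S (w *v x - x) ?b + (w *v x) \<bullet> ?b = x \<bullet> ?b"
    then have "r * (S (w *v x - x) ?b + (w *v x) \<bullet> ?b) = r * (x \<bullet> ?b)" by simp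
    then show "S (w *v (r *\<^sub>R x) - r *\<^sub>R x) ?b + (w *v (r *\<^sub>R x)) \<bullet> ?b = (r *\<^sub>R x) \<bullet> ?b"
      unfolding matrix_vector_mult_scaleR scaleR_diff_right[symmetric] S_scaleR_left inner_scaleR_left
      by (simp only: distrib_left)
  next
    fix x y assume "S (w *v x - x) ?b + (w *v x) \<bullet> ?b = x \<bullet> ?b" "S (w *v y - y) ?b + (w *v y) \<bullet> ?b = y \<bullet> ?b"
    then show "S (w *v (x + y) - (x + y)) ?b + (w *v (x + y)) \<bullet> ?b = (x + y) \<bullet> ?b"
      unfolding matrix_vector_right_distrib S_diff_left S_add_left inner_add_left by linarith
  qed simp
  define D where "D v x y = S (v *v x - x) (v *v y - y) - ((v *v x) \<bullet> y - x \<bullet> (v *v y))" for v :: "real^'n^'n" and x y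
  have nc_D: "nc v \<longleftrightarrow> (\<forall>x y. D v x y = 0)" for v by (simp add: D_def nc_def)
  have D: "D (w ** ?t) (?t *v x) (?t *v y) = D w x y" for x y
  proof -
    define bx Bx where "bx = x \<bullet> ?b" and "Bx = w *v x - x"
    define b_y By where "b_y = y \<bullet> ?b" and "By = w *v y - y"
    have t: "?t *v x = x - bx *\<^sub>R ?b" "?t *v y = y - b_y *\<^sub>R ?b"
      using swap_mult_vec[OF kq(1-4)] by (auto simp: bx_def b_y_def)
    have wt: "(w ** ?t) *v (?t *v z) = w *v z" for z
      by (simp add: matrix_vector_mul_assoc[symmetric] reflection_along_involution)
    have SB: "S Bx ?b = bx - (w *v x) \<bullet> ?b" "S By ?b = b_y - (w *v y) \<bullet> ?b"
      using f[of x] f[of y] by (simp_all add: Bx_def By_def bx_def b_y_def)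
    have eq: "w *v x - (x - bx *\<^sub>R ?b) = Bx + bx *\<^sub>R ?b" "w *v y - (y - b_y *\<^sub>R ?b) = By + b_y *\<^sub>R ?b"
      by (simp_all add: Bx_def By_def)
    have "S (Bx + bx *\<^sub>R ?b) (By + b_y *\<^sub>R ?b) = S Bx By + b_y * S Bx ?b - bx * S By ?b"
      using S_skew[of ?b By] by (simp only: S_add_left S_add_right S_scaleR_left S_scaleR_right S_self) simp
    then have "D (w ** ?t) (?t *v x) (?t *v y) = S Bx By + b_y * S Bx ?b - bx * S By ?b
      - ((w *v x) \<bullet> (y - b_y *\<^sub>R ?b) - (x - bx *\<^sub>R ?b) \<bullet> (w *v y))"
      unfolding D_def wt unfolding t eq by simp
    also have "\<dots> = S Bx By - ((w *v x) \<bullet> y - x \<bullet> (w *v y))"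
      unfolding SB inner_diff_left[of x] inner_diff_right[of _ y] inner_scaleR_left inner_scaleR_right
        inner_commute[of ?b "w *v y"]
      by (simp only: algebra_simps)
    finally show ?thesis by (simp add: D_def Bx_def By_def)
  qed
  have "(\<forall>x y. D (w ** ?t) x y = 0) \<longleftrightarrow> (\<forall>x y. D w x y = 0)"
    using D reflection_along_involution by metis
  then show ?thesis by (simp add: nc_D)
qed

subsection \<open>Labelled points\<close>

text \<open>\<open>fits w z\<close> says that \<open>z\<close> is the point labelling the blocks of \<open>w\<close>: on a block on which \<open>w\<close> acts
  as a positive cycle, \<open>z\<close> takes the value attached to the first element (the opener) of the block;
  on the remaining blocks it vanishes.\<close>

definition opens :: "real^'n^'n \<Rightarrow> real^'n \<Rightarrow> bool" where
  "opens w i \<longleftrightarrow> S i (w *v i) \<noteq> 1 \<and> w *v i \<noteq> - i"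

text \<open>Blocks are never constructed: two vectors are in the same block if no fixed vector of
  \<open>w\<close> separates them, and the last clause puts vanishing cycle vectors, together with
  \<eta>, where all fixed vectors vanish. In \<open>opens\<close>, a chord that does not run forward
  by less than a half turn returns to the first element; the case \<open>w *v i = - i\<close>, where
  \<open>S\<close> also vanishes, belongs to a negative cycle and is excluded.\<close>

definition fits :: "real^'n^'n \<Rightarrow> complex^'n \<Rightarrow> bool" where
  "fits w z \<longleftrightarrow>
     (\<forall>a\<in>signed_basis. coord z (w *v a) = coord z a) \<and>
     (\<forall>i\<in>signed_basis. w *v i \<in> circ \<longrightarrow> (coord z (w *v i) = lam (w *v i) \<longleftrightarrow> opens w i)) \<and>
     (\<forall>b\<in>signed_basis. coord z b \<noteq> 0 \<longrightarrow> (\<exists>a\<in>circ. coord z b = lam a \<and> coord z a = lam a)) \<and>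
     (\<forall>a\<in>signed_basis. \<forall>b\<in>signed_basis. coord z a = coord z b \<and> coord z a \<noteq> 0 \<longrightarrow>
        (\<forall>x. w *v x = x \<longrightarrow> x \<bullet> a = x \<bullet> b)) \<and>
     (\<forall>a\<in>circ. coord z a = 0 \<longrightarrow> (\<forall>x. w *v x = x \<longrightarrow> x \<bullet> a = 0 \<and> x \<bullet> \<eta> = 0))"

lemma
  assumes fits: "fits w z"
  shows fits_invariant: "a \<in> signed_basis \<Longrightarrow> coord z (w *v a) = coord z a"
    and fits_opens: "i \<in> signed_basis \<Longrightarrow> w *v i \<in> circ \<Longrightarrow>
    coord z (w *v i) = lam (w *v i) \<longleftrightarrow> opens w i"
    and fits_label: "b \<in> signed_basis \<Longrightarrow> coord z b \<noteq> 0 \<Longrightarrow>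
    \<exists>a\<in>circ. coord z b = lam a \<and> coord z a = lam a"
    and fits_block: "a \<in> signed_basis \<Longrightarrow> b \<in> signed_basis \<Longrightarrow> coord z a = coord z b \<Longrightarrow>
    coord z a \<noteq> 0 \<Longrightarrow> w *v x = x \<Longrightarrow> x \<bullet> a = x \<bullet> b"
    and fits_zero: "a \<in> circ \<Longrightarrow> coord z a = 0 \<Longrightarrow> w *v x = x \<Longrightarrow> x \<bullet> a = 0 \<and> x \<bullet> \<eta> = 0"
proof -
  note f = fits[unfolded fits_def]
  show "a \<in> signed_basis \<Longrightarrow> coord z (w *v a) = coord z a" using f by blast
  show "i \<in> signed_basis \<Longrightarrow> w *v i \<in> circ \<Longrightarrow> coord z (w *v i) = lam (w *v i) \<longleftrightarrow> opens w i"
    using f by blast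
  show "b \<in> signed_basis \<Longrightarrow> coord z b \<noteq> 0 \<Longrightarrow> \<exists>a\<in>circ. coord z b = lam a \<and> coord z a = lam a"
    using f by blast
  show "a \<in> signed_basis \<Longrightarrow> b \<in> signed_basis \<Longrightarrow> coord z a = coord z b \<Longrightarrow>
    coord z a \<noteq> 0 \<Longrightarrow> w *v x = x \<Longrightarrow> x \<bullet> a = x \<bullet> b" using f[THEN conjunct2, THEN conjunct2, THEN conjunct2, THEN conjunct1] by blast
  show "a \<in> circ \<Longrightarrow> coord z a = 0 \<Longrightarrow> w *v x = x \<Longrightarrow> x \<bullet> a = 0 \<and> x \<bullet> \<eta> = 0"
    using f[THEN conjunct2, THEN conjunct2, THEN conjunct2, THEN conjunct2] by blast
qed

lemma opens_uminus [simp]: "opens w (- i) \<longleftrightarrow> opens w i"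
proof -
  have "w *v - i \<noteq> - (- i) \<longleftrightarrow> w *v i \<noteq> - i"
    by (metis matrix_vector_mult_uminus minus_minus)
  moreover have "S (- i) (w *v - i) = S i (w *v i)" by (simp add: matrix_vector_mult_uminus)
  ultimately show ?thesis unfolding opens_def by (simp only:)
qed

lemma opens_fixed: "i \<in> signed_basis \<Longrightarrow> w *v i = i \<Longrightarrow> opens w i"
  by (simp add: opens_def)

text \<open>The real and imaginary parts of a fitting point are fixed by \<open>w\<close>.\<close>

lemma fits_same_block:
  assumes w: "w \<in> weyl_group_D" and fits: "fits w z"
    and ab: "\<And>x. w *v x = x \<Longrightarrow> x \<bullet> a = x \<bullet> b"
  shows "coord z a = coord z b"
proof -
  define x where "x = (\<chi> i. Re (z $ i))"
  define y where "y = (\<chi> i. Im (z $ i))"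
  have x: "x \<bullet> a = Re (coord z a)" and y: "y \<bullet> a = Im (coord z a)" for a
    by (simp_all add: x_def y_def coord_def inner_vec_def)
  have *: "coord z (transpose w *v a) = coord z a" if "a \<in> signed_basis" for a
    using fits_invariant[OF fits, of "transpose w *v a"] that w by (simp add: weyl_signed_basis weyl_transpose)
  have "(w *v x) \<bullet> a = x \<bullet> a" "(w *v y) \<bullet> a = y \<bullet> a" if "a \<in> signed_basis" for a
  proof -
    have "(w *v u) \<bullet> a = u \<bullet> (transpose w *v a)" for u
      by (metis inner_commute inner_transpose)
    then show "(w *v x) \<bullet> a = x \<bullet> a" "(w *v y) \<bullet> a = y \<bullet> a" using *[OF that] by (simp_all add: x y)
  qed
  then have "w *v x = x" "w *v y = y" using signed_basis_ext by blast+
  then show ?thesis using ab[of x] ab[of y] by (simp add: x y complex_eq_iff)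
qed

text \<open>A nonzero value at \<open>b\<close> is the label of some \<open>a\<close> in the same
  block, and that \<open>a\<close> carries its own label depends on \<open>w\<close> alone. So
  another fitting point has the same value at \<open>a\<close>, and hence at
  \<open>b\<close>.\<close>

lemma fits_unique:
  assumes w: "w \<in> weyl_group_D" and z: "fits w z" and z': "fits w z'"
  shows "z = z'"
proof -
  have *: "coord z' b = coord z b"
    if z: "fits w z" "fits w z'" and b: "b \<in> signed_basis" "coord z b \<noteq> 0" for z z' b
  proof -
    obtain a where a: "a \<in> circ" "coord z b = lam a" "coord z a = lam a"
      using fits_label[OF z(1) b] by blast
    have ab: "x \<bullet> a = x \<bullet> b" if "w *v x = x" for x
      using fits_block[OF z(1), of a b x] a b that circ_basis by auto
    define i where "i = transpose w *v a"
    have i: "i \<in> signed_basis" "w *v i = a"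
      using w a circ_basis by (auto simp: i_def weyl_signed_basis weyl_transpose)
    have "opens w i" using fits_opens[OF z(1) i(1)] i a by simp
    then have "coord z' a = lam a" using fits_opens[OF z(2) i(1)] i a by simp
    then show ?thesis using fits_same_block[OF w z(2) ab] a by simp
  qed
  show ?thesis
  proof (rule coord_ext)
    fix b :: "real^'n" assume b: "b \<in> signed_basis"
    show "coord z b = coord z' b"
      using *[OF z z' b] *[OF z' z b] by metis
  qed
qed

text \<open>A fixed vector opens its own block, and as a fixed vector it separates itself from every
  other basis vector.\<close>

lemma fits_fixed:
  assumes "fits w z" "d \<in> circ" "w *v d = d"
  shows "coord z d = lam d" "b \<in> signed_basis \<Longrightarrow> coord z b = lam d \<Longrightarrow> b = d"
proof -
  show d: "coord z d = lam d"
    using fits_opens[OF assms(1), of d] opens_fixed assms circ_basis by auto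
  assume b: "b \<in> signed_basis" "coord z b = lam d"
  then have "d \<bullet> b = d \<bullet> d"
    using fits_block[OF assms(1), of b d d] d assms lam_nonzero circ_basis by auto
  then show "b = d" using inner_eq_1_iff[of d b] b assms circ_basis by auto
qed

text \<open>The product inserts \<open>q\<close> directly behind \<open>k\<close> into the block of
  \<open>k\<close>, so \<open>q\<close> takes over the value of \<open>k\<close>. The other openers
  are unaffected because \<open>adj_S\<close> makes \<open>k\<close> and \<open>q\<close>
  indistinguishable from elsewhere.\<close>

lemma fits_mult_swap:
  assumes P: "sym_circ P" and adj: "adj P k q"
    and w: "w \<in> weyl_group_D" "fixes_off P w" "w *v q = q" and fits: "fits w z"
  shows "fits (w ** reflection_along (k - q)) (upd z q (coord z k))"
proof -
  note kq = swap_adj[OF P adj]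
  let ?t = "reflection_along (k - q)" and ?z = "upd z q (coord z k)"
  let ?w = "w ** ?t"
  have Skq: "S k q = 1" using adj by (simp add: adj_def)
  have wt: "?w *v x = w *v (?t *v x)" for x by (simp add: matrix_vector_mul_assoc)
  note t_simps = swap_left[OF kq(1-4)] swap_right[OF kq(1-4)]
  have t_other: "?t *v a = a" if "a \<in> signed_basis" "a \<noteq> k" "a \<noteq> - k" "a \<noteq> q" "a \<noteq> - q" for a
    using swap_other[OF kq(1-4) that(1)] that by blast
  \<comment> \<open>Pulls the new point back to the old one without changing inner products with
    vectors fixed by the product; this reduces the clauses about labels and blocks to those for
    \<open>z\<close>.\<close>
  define \<rho> where "\<rho> a = (if a = q then k else if a = - q then - k else a)" for a
  have \<rho>_basis: "\<rho> a \<in> signed_basis" if "a \<in> signed_basis" for a using that kq by (simp add: \<rho>_def)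
  have \<rho>_circ: "\<rho> a \<in> circ" if "a \<in> circ" for a using that kq by (simp add: \<rho>_def)
  have mk: "- k \<noteq> q" "- k \<noteq> - q" using kq(3,4) by (metis minus_minus)+
  have \<rho>_neq: "\<rho> a \<noteq> q" "\<rho> a \<noteq> - q" for a
    unfolding \<rho>_def using kq(3,4) mk by presburger+
  have \<rho>: "coord ?z a = coord z (\<rho> a)" if "a \<in> signed_basis" for a
    using that kq coord_upd_other[of q a z] by (auto simp: \<rho>_def)
  have fixed: "w *v x = x" "x \<bullet> k = x \<bullet> q" if "?w *v x = x" for x
  proof -
    have "x \<bullet> q = (w *v (?t *v x)) \<bullet> (w *v q)" using that w(3) by (simp add: wt)
    also have "\<dots> = (?t *v x) \<bullet> q" using w(1) by simp
    also have "\<dots> = x \<bullet> (?t *v q)"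
      by (metis inner_transpose reflection_along_transpose)
    finally show "x \<bullet> k = x \<bullet> q" using t_simps by simp
    then have "?t *v x = x" by (simp add: swap_mult_vec[OF kq(1-4)] inner_diff_right)
    then show "w *v x = x" using that by (simp add: wt)
  qed
  have \<rho>_inner: "x \<bullet> \<rho> a = x \<bullet> a" if "?w *v x = x" for x a
    using fixed(2)[OF that] by (simp add: \<rho>_def)
  have q_fix: "b = q" if "b \<in> signed_basis" "coord z b = lam q" for b
    using fits_fixed(2)[OF fits kq(6) w(3) that] .
  have mq_fix: "b = - q" if "b \<in> signed_basis" "coord z b = lam (- q)" for b
    using fits_fixed(2)[OF fits, of "- q" b] w(3) that kq by (simp add: matrix_vector_mult_uminus)
  have w_neq: "w *v a \<noteq> q" "w *v a \<noteq> - q" if "a \<noteq> q" "a \<noteq> - q" for a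
  proof -
    have "w *v a \<noteq> w *v q" "w *v a \<noteq> w *v (- q)" using that weyl_inj[OF w(1)] by blast+
    then show "w *v a \<noteq> q" "w *v a \<noteq> - q" using w(3) by (auto simp: matrix_vector_mult_uminus)
  qed
  show ?thesis
    unfolding fits_def
  proof (intro conjI ballI impI allI)
    fix a :: "real^'n" assume a: "a \<in> signed_basis"
    have wb: "w *v b \<in> signed_basis" if "b \<in> signed_basis" for b using weyl_signed_basis[OF w(1) that] .
    have inv: "coord ?z (?w *v k) = coord ?z k" "coord ?z (?w *v q) = coord ?z q"
    proof -
      have "coord z k = coord ?z k" using kq \<rho>[of k] by (auto simp: \<rho>_def)
      then show "coord ?z (?w *v k) = coord ?z k" using kq w(3) by (simp add: wt t_simps)
      have "coord ?z (w *v k) = coord z (w *v k)" using w_neq[of k] kq \<rho>[of "w *v k"] wb by (simp add: \<rho>_def)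
      then show "coord ?z (?w *v q) = coord ?z q" using fits_invariant[OF fits kq(1)] kq by (simp add: wt t_simps)
    qed
    consider "a = k" | "a = - k" | "a = q" | "a = - q" | "a \<noteq> k" "a \<noteq> - k" "a \<noteq> q" "a \<noteq> - q" by blast
    then show "coord ?z (?w *v a) = coord ?z a"
    proof cases
      case 5
      then have "?w *v a = w *v a" using t_other[OF a] by (simp add: wt)
      then show ?thesis using w_neq[of a] 5 \<rho>[of a] \<rho>[of "w *v a"] a wb fits_invariant[OF fits a] by (simp add: \<rho>_def)
    qed (use inv in \<open>simp_all add: matrix_vector_mult_uminus\<close>)
  next
    fix i :: "real^'n" assume i: "i \<in> signed_basis" and wi: "?w *v i \<in> circ"
    have 1: "coord ?z (?w *v k) = lam (?w *v k) \<longleftrightarrow> opens ?w k"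
    proof -
      have "?w *v k = q" using w(3) by (simp add: wt t_simps)
      moreover have "coord ?z q \<noteq> lam q" using q_fix[of k] kq by auto
      ultimately show ?thesis using Skq by (simp add: opens_def)
    qed
    have 2: "coord ?z (?w *v q) = lam (?w *v q) \<longleftrightarrow> opens ?w q" if wq: "?w *v q \<in> circ"
    proof -
      let ?a = "w *v k"
      have a: "?w *v q = ?a" by (simp add: wt t_simps)
      have ac: "?a \<in> circ" using wq a by simp
      have an: "?a \<noteq> q" "?a \<noteq> - q" using w_neq[of k] kq by auto
      have aP: "?a \<in> P"
        using fixes_off_invariant[OF w(1,2) _ P, of k] adj ac eta_notin_circ by (metis adj_def)
      have "coord ?z ?a = coord z ?a" using \<rho>[of ?a] an ac circ_basis by (simp add: \<rho>_def)
      moreover have "coord z ?a = lam ?a \<longleftrightarrow> opens w k" using fits_opens[OF fits kq(1) ac] .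
      moreover have "opens w k \<longleftrightarrow> opens ?w q"
      proof -
        consider "?a = k" | "?a = - k" | "?a \<noteq> k" "?a \<noteq> - k" by blast
        then show ?thesis
        proof cases
          case 1 then show ?thesis using kq Skq S_skew[of q k] by (auto simp: opens_def a)
        next
          case 2 then show ?thesis using kq Skq S_skew[of q k] by (auto simp: opens_def a)
        next
          case 3
          then have "S ?a k = S ?a q" using adj_S[OF P adj, of ?a] aP an by blast
          then show ?thesis using 3 an S_skew[of k ?a] S_skew[of q ?a] by (simp add: opens_def a)
        qed
      qed
      ultimately show ?thesis by (simp add: a)
    qed
    consider "i = k" | "i = - k" | "i = q" | "i = - q" | "i \<noteq> k" "i \<noteq> - k" "i \<noteq> q" "i \<noteq> - q" by blast
    then show "coord ?z (?w *v i) = lam (?w *v i) \<longleftrightarrow> opens ?w i"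
    proof cases
      case 5
      then have "?w *v i = w *v i" using t_other[OF i] by (simp add: wt)
      moreover from this have "coord ?z (w *v i) = coord z (w *v i)"
        using w_neq[of i] 5 \<rho>[of "w *v i"] wi circ_basis by (simp add: \<rho>_def)
      ultimately show ?thesis using fits_opens[OF fits i] wi by (simp add: opens_def)
    qed (use 1 2 wi in \<open>simp_all add: matrix_vector_mult_uminus\<close>)
  next
    fix b :: "real^'n" assume b: "b \<in> signed_basis" "coord ?z b \<noteq> 0"
    then obtain a where a: "a \<in> circ" "coord z (\<rho> b) = lam a" "coord z a = lam a"
      using fits_label[OF fits \<rho>_basis[OF b(1)]] \<rho>[OF b(1)] by auto
    have "a \<noteq> q" "a \<noteq> - q"
      using a q_fix[OF \<rho>_basis[OF b(1)]] mq_fix[OF \<rho>_basis[OF b(1)]] \<rho>_neq[of b] by auto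
    then have "coord ?z a = lam a" using a \<rho>[of a] circ_basis by (simp add: \<rho>_def)
    then show "\<exists>a\<in>circ. coord ?z b = lam a \<and> coord ?z a = lam a" using a \<rho>[OF b(1)] by auto
  next
    fix a b x :: "real^'n"
    assume ab: "a \<in> signed_basis" "b \<in> signed_basis" "coord ?z a = coord ?z b \<and> coord ?z a \<noteq> 0"
      and x: "?w *v x = x"
    have "coord z (\<rho> a) = coord z (\<rho> b)" "coord z (\<rho> a) \<noteq> 0" using ab \<rho> by auto
    then have "x \<bullet> \<rho> a = x \<bullet> \<rho> b"
      using fits_block[OF fits \<rho>_basis[OF ab(1)] \<rho>_basis[OF ab(2)] _ _ fixed(1)[OF x]] by blast
    then show "x \<bullet> a = x \<bullet> b" using \<rho>_inner[OF x] by simp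
  next
    fix a x :: "real^'n" assume a: "a \<in> circ" "coord ?z a = 0" and x: "?w *v x = x"
    have "x \<bullet> \<rho> a = 0 \<and> x \<bullet> \<eta> = 0"
      using fits_zero[OF fits \<rho>_circ[OF a(1)], of x] a fixed(1)[OF x] circ_basis by (simp add: \<rho>)
    then show "x \<bullet> a = 0" "x \<bullet> \<eta> = 0" using \<rho>_inner[OF x] by auto
  qed
qed

subsection \<open>The base cases\<close>

lemma fits_id: "fits (mat 1) zeta"
proof -
  have "b \<in> circ" if "b \<in> signed_basis" "lam b \<noteq> 0" for b using that by (auto simp: basis_cases)
  then show ?thesis
    unfolding fits_def
  proof (intro conjI ballI impI allI, goal_cases)
    case (4 a b x)
    then have "a = b" using lam_inj by metis
    then show ?case by simp
  next
    case (5 a x) then show ?case using lam_nonzero by blast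
  next
    case (6 a x) then show ?case using lam_nonzero by blast
  qed (auto simp: opens_fixed)
qed

lemma nc_id: "nc (mat 1)"
  by (simp add: nc_def)

lemma nc_reflection: "nc (reflection_along b)"
  by (rule nc_if_symmetric) (simp_all add: reflection_along_transpose reflection_along_mult_vec S_scaleR_left S_scaleR_right)

context
  fixes k y :: "real^'n"
  assumes k: "k \<in> circ" and y: "y = \<eta> \<or> y = - \<eta>"
begin

lemma ky: "k \<in> signed_basis" "y \<in> signed_basis" "k \<noteq> y" "k \<noteq> - y" "y \<notin> circ"
  using k y eta_notin_circ by (auto simp: circ_basis)

text \<open>The chord from \<open>y\<close> to \<open>k\<close> opens because \<open>S\<close>
  vanishes on \<eta>; so \<open>k\<close> labels the block that it forms with
  \<open>y\<close>.\<close>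

lemma fits_reflection_eta: "fits (reflection_along (k - y)) (upd zeta y (lam k))"
proof -
  let ?w = "reflection_along (k - y)" and ?z = "upd zeta y (lam k)"
  define \<rho> where "\<rho> a = (if a = y then k else if a = - y then - k else a)" for a
  have \<rho>: "coord ?z a = lam (\<rho> a)" if "a \<in> signed_basis" for a
    using that ky coord_upd_other[of y a zeta] by (auto simp: \<rho>_def)
  have \<rho>_circ: "\<rho> a \<in> circ" if "a \<in> signed_basis" for a
    using that k y by (auto simp: \<rho>_def basis_cases)
  have \<rho>_id: "\<rho> a = a" if "a \<in> circ" for a using that ky by (auto simp: \<rho>_def)
  have w_other: "?w *v a = a" if "a \<in> signed_basis" "a \<noteq> k" "a \<noteq> - k" "a \<noteq> y" "a \<noteq> - y" for a
    using swap_other[OF ky(1-4) that(1)] that by blast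
  note w_simps = swap_left[OF ky(1-4)] swap_right[OF ky(1-4)] matrix_vector_mult_uminus
  have inner: "x \<bullet> \<rho> a = x \<bullet> a" if "?w *v x = x" for x a
  proof -
    have "(x \<bullet> (k - y)) *\<^sub>R (k - y) = 0" using that swap_mult_vec[OF ky(1-4), of x] by simp
    then have "x \<bullet> k = x \<bullet> y" using ky by (simp add: inner_diff_right)
    then show ?thesis by (simp add: \<rho>_def)
  qed
  have S_y: "S y x = 0" for x using y by auto
  have nz: "coord ?z a \<noteq> 0" if "a \<in> signed_basis" for a using \<rho>[OF that] \<rho>_circ[OF that] lam_nonzero by auto
  show ?thesis
    unfolding fits_def
  proof (intro conjI ballI impI allI)
    fix a :: "real^'n" assume a: "a \<in> signed_basis"
    have "- y \<noteq> y" using signed_basis_neq_uminus[OF ky(2)] by metis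
    then have "\<rho> y = k" "\<rho> (- y) = - k" by (simp_all only: \<rho>_def if_True if_False simp_thms)
    moreover have "\<rho> k = k" "\<rho> (- k) = - k" using \<rho>_id k by simp_all
    ultimately have "\<rho> (?w *v a) = \<rho> a"
      using w_other[OF a] w_simps(1,2) matrix_vector_mult_uminus by metis
    then show "coord ?z (?w *v a) = coord ?z a"
      using \<rho>[OF a] \<rho>[OF weyl_signed_basis[OF swap_in_weyl[OF ky(1-4)] a]] by simp
  next
    fix i :: "real^'n" assume i: "i \<in> signed_basis" "?w *v i \<in> circ"
    have "opens ?w i"
    proof (cases "i = k \<or> i = - k \<or> i = y \<or> i = - y")
      case True
      then have "i = y \<or> i = - y" using i ky by (auto simp: w_simps)
      moreover have "opens ?w y" using S_y ky by (auto simp: opens_def w_simps)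
      ultimately show ?thesis by auto
    next
      case False then show ?thesis using w_other[of i] i by (auto simp: opens_fixed)
    qed
    moreover have "coord ?z (?w *v i) = lam (?w *v i)" using \<rho> \<rho>_id i circ_basis by simp
    ultimately show "coord ?z (?w *v i) = lam (?w *v i) \<longleftrightarrow> opens ?w i" by simp
  next
    fix b :: "real^'n" assume b: "b \<in> signed_basis"
    show "\<exists>a\<in>circ. coord ?z b = lam a \<and> coord ?z a = lam a"
      using \<rho>[OF b] \<rho>_circ[OF b] \<rho>[of "\<rho> b"] \<rho>_id[of "\<rho> b"] circ_basis by (intro bexI[of _ "\<rho> b"]) auto
  next
    fix a b x :: "real^'n"
    assume ab: "a \<in> signed_basis" "b \<in> signed_basis" "coord ?z a = coord ?z b \<and> coord ?z a \<noteq> 0"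
      and x: "?w *v x = x"
    have "\<rho> a = \<rho> b" using ab \<rho> \<rho>_circ lam_inj by simp
    then show "x \<bullet> a = x \<bullet> b" using inner[OF x] by metis
  qed (use nz circ_basis in auto)
qed

text \<open>The lines of \<open>k\<close> and \<eta> form the zero block, and all other vectors keep
  their own labels.\<close>

lemma fits_neg2_eta: "fits (neg2 k y) (upd zeta k 0)"
proof -
  let ?w = "neg2 k y" and ?z = "upd zeta k 0"
  define Z where "Z = {k, - k, y, - y}"
  have z0: "coord ?z a = 0" if "a \<in> Z" for a
  proof -
    have "k \<bullet> \<eta> = 0" using k by (auto simp: circ_def)
    then have "coord ?z \<eta> = 0" "coord ?z k = 0" using ky by (simp_all add: coord_upd)
    then show ?thesis using that y by (auto simp: Z_def)
  qed
  have z1: "coord ?z a = lam a" if "a \<in> signed_basis" "a \<notin> Z" for a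
    using that ky coord_upd_other[of k a zeta] by (auto simp: Z_def)
  have w0: "?w *v a = - a" if "a \<in> Z" for a
    using that neg2_left[OF ky(1-4)] neg2_right[OF ky(1-4)] by (auto simp: Z_def matrix_vector_mult_uminus)
  have w1: "?w *v a = a" if "a \<in> signed_basis" "a \<notin> Z" for a
    using neg2_other[OF ky(1-4) that(1)] that by (auto simp: Z_def)
  have Zm: "- a \<in> Z \<longleftrightarrow> a \<in> Z" for a by (auto simp: Z_def minus_equation_iff)
  have circ: "a \<in> circ" if "a \<in> signed_basis" "a \<notin> Z" for a using that y by (auto simp: Z_def basis_cases)
  have x0: "x \<bullet> a = 0" if "?w *v x = x" "a \<in> Z" for x a
  proof -
    have "x \<bullet> a = (?w *v x) \<bullet> (?w *v a)" using neg2_in_weyl[OF ky(1-4)] by simp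
    also have "\<dots> = - (x \<bullet> a)" using that w0 by simp
    finally show ?thesis by simp
  qed
  have nz: "a \<notin> Z \<and> coord ?z a = lam a" if "a \<in> signed_basis" "coord ?z a \<noteq> 0" for a
    using that z0 z1 by blast
  show ?thesis
    unfolding fits_def
  proof (intro conjI ballI impI allI)
    fix a :: "real^'n" assume a: "a \<in> signed_basis"
    show "coord ?z (?w *v a) = coord ?z a"
      using a w0 w1 z0 Zm by (cases "a \<in> Z") auto
  next
    fix i :: "real^'n" assume i: "i \<in> signed_basis" "?w *v i \<in> circ"
    show "coord ?z (?w *v i) = lam (?w *v i) \<longleftrightarrow> opens ?w i"
    proof (cases "i \<in> Z")
      case True
      then show ?thesis using w0[of i] z0[of i] i lam_nonzero[of "- i"] by (simp add: opens_def)
    next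
      case False then show ?thesis using w1[of i] z1[of i] i by (simp add: opens_fixed)
    qed
  next
    fix b :: "real^'n" assume b: "b \<in> signed_basis" "coord ?z b \<noteq> 0"
    then show "\<exists>a\<in>circ. coord ?z b = lam a \<and> coord ?z a = lam a"
      using nz[OF b] circ by (intro bexI[of _ b]) auto
  next
    fix a b x :: "real^'n"
    assume ab: "a \<in> signed_basis" "b \<in> signed_basis" "coord ?z a = coord ?z b \<and> coord ?z a \<noteq> 0"
      and x: "?w *v x = x"
    have "a = b" using nz[of a] nz[of b] ab circ lam_inj by auto
    then show "x \<bullet> a = x \<bullet> b" by simp
  next
    fix a x :: "real^'n" assume a: "a \<in> circ" "coord ?z a = 0" and x: "?w *v x = x"
    have "a \<in> Z" using a z1[of a] circ_basis lam_nonzero by force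
    then show "x \<bullet> a = 0" using x0[OF x] by simp
    have "y \<in> Z" by (simp add: Z_def)
    then show "x \<bullet> \<eta> = 0" using x0[OF x, of y] y by auto
  qed
qed

lemma nc_neg2: "nc (neg2 k y)"
proof (rule nc_if_symmetric)
  have yS: "S y x = 0" "S x y = 0" for x using y by auto
  fix x z
  have "(transpose (neg2 k y) *v x) \<bullet> z = (neg2 k y *v x) \<bullet> z" for z
    unfolding inner_transpose
    by (simp add: neg2_mult_vec[OF ky(1-4)] inner_diff_left inner_diff_right inner_commute)
  then show "transpose (neg2 k y) *v x = neg2 k y *v x" by (metis vector_eq_rdot)
  show "S (neg2 k y *v x - x) (neg2 k y *v z - z) = 0"
    by (simp add: neg2_mult_vec[OF ky(1-4)] S_simps yS)
qed

end

end

section \<open>Elements supported on one line, removal of chords, existence of the labelled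
  point\<close>

context D_frame
begin

text \<open>Only \<eta> could still move, to its negative, and that is a single sign change.\<close>

lemma fixes_circ_imp_id:
  assumes w: "w \<in> weyl_group_D" and fix_c: "\<And>d. d \<in> circ \<Longrightarrow> w *v d = d"
  shows "w = mat 1"
proof -
  have eta: "w *v \<eta> = \<eta>"
  proof (rule ccontr)
    assume "w *v \<eta> \<noteq> \<eta>"
    moreover have "w *v \<eta> \<notin> circ"
    proof
      assume "w *v \<eta> \<in> circ"
      then have "w *v (w *v \<eta>) = w *v \<eta>" by (rule fix_c)
      then have "w *v \<eta> = \<eta>" using weyl_inj[OF w] by blast
      then show False using \<open>w *v \<eta> \<in> circ\<close> by simp
    qed
    ultimately have eta: "w *v \<eta> = - \<eta>"
      using weyl_signed_basis[OF w eta_basis] by (auto simp: basis_cases)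
    define z :: "complex^'n" where "z = (\<chi> i. 1)"
    have nz: "coord z a \<noteq> 0" if "a \<in> signed_basis" for a
      using signed_basisE[OF that] by (metis coord_axis coord_scaleR mult_cancel_right1 mult_eq_0_iff
          neg_equal_0_iff_equal of_real_1 of_real_minus vec_lambda_beta zero_neq_one z_def)
    have "complexify w *v z = upd z \<eta> (- coord z \<eta>)"
    proof (rule coord_ext)
      fix a :: "real^'n" assume a: "a \<in> signed_basis"
      show "coord (complexify w *v z) a = coord (upd z \<eta> (- coord z \<eta>)) a"
      proof (cases "a \<in> circ")
        case True
        have "coord (complexify w *v z) (w *v a) = coord z a" by (rule coord_complexify_mult_vec[OF w])
        moreover have "a \<noteq> \<eta>" "a \<noteq> - \<eta>" using True eta_notin_circ by metis+
        ultimately show ?thesis using fix_c[OF True] coord_upd_other[OF eta_basis a] by simp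
      next
        case False
        have "coord (complexify w *v z) (w *v \<eta>) = coord z \<eta>" by (rule coord_complexify_mult_vec[OF w])
        then have "coord (complexify w *v z) \<eta> = - coord z \<eta>" by (simp add: eta) (metis minus_minus)
        then show ?thesis using False a by (auto simp: basis_cases)
      qed
    qed
    then show False using weyl_flip_imp_zero[OF w eta_basis] nz by blast
  qed
  show ?thesis
    by (rule matrix_eq_on_signed_basis) (auto simp: basis_cases fix_c eta matrix_vector_mult_uminus)
qed

text \<open>The base of all inductions. The image of \<open>k\<close> is on the line of
  \<open>k\<close> or of \<eta>; composing with the listed involution that brings it back leaves an
  element fixing the whole cycle.\<close>

lemma weyl_supported_on_line:
  assumes w: "w \<in> weyl_group_D" and k: "k \<in> circ" and off: "fixes_off {k, - k} w"
  shows "w = mat 1 \<or> w = neg2 k \<eta> \<or> (\<exists>y. (y = \<eta> \<or> y = - \<eta>) \<and> w = reflection_along (k - y))"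
proof -
  have P: "sym_circ {k, - k}" using k by (simp add: sym_circ_def)
  have fix_w: "w *v d = d" if "d \<in> circ" "d \<noteq> k" "d \<noteq> - k" for d
    using off that by (simp add: fixes_off_def)
  have g: "w = g" if g: "g \<in> weyl_group_D" "transpose g = g" "g ** g = mat 1" "g *v (w *v k) = k"
    "\<And>d. d \<in> circ \<Longrightarrow> d \<noteq> k \<Longrightarrow> d \<noteq> - k \<Longrightarrow> g *v d = d" for g
  proof -
    have "g ** w = mat 1"
    proof (rule fixes_circ_imp_id[OF weyl_mult[OF g(1) w]])
      fix d assume d: "d \<in> circ"
      show "(g ** w) *v d = d"
        using g(4,5) fix_w d
        by (cases "d = k \<or> d = - k") (auto simp: matrix_vector_mul_assoc[symmetric] matrix_vector_mult_uminus)
    qed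
    then have "g ** (g ** w) = g" by simp
    then show ?thesis using g(3) by (simp add: matrix_mul_assoc)
  qed
  have "w *v k = k \<or> w *v k = - k \<or> w *v k = \<eta> \<or> w *v k = - \<eta>"
    using fixes_off_invariant[OF w off _ P, of k] by auto
  then consider "w *v k = k" | "w *v k = - k" | y where "y = \<eta> \<or> y = - \<eta>" "w *v k = y" by blast
  then show ?thesis
  proof cases
    case 1
    then have "w = mat 1" using fix_w by (intro fixes_circ_imp_id[OF w]) (metis matrix_vector_mult_uminus)
    then show ?thesis by simp
  next
    case 2
    have ky: "k \<in> signed_basis" "\<eta> \<in> signed_basis" "k \<noteq> \<eta>" "k \<noteq> - \<eta>" using ky[OF k, of \<eta>] by auto
    let ?g = "neg2 k \<eta>"
    have gg: "?g *v (?g *v x) = x" for x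
      using ky inner_xy[OF ky]
      by (simp add: neg2_mult_vec[OF ky] inner_diff_left vec_eq_iff)
    have "w = ?g"
    proof (rule g)
      show "?g ** ?g = mat 1" by (simp add: matrix_eq matrix_vector_mul_assoc[symmetric] gg)
      then show "transpose ?g = ?g"
        by (metis neg2_in_weyl[OF ky] weyl_transpose_mult(1) matrix_mul_assoc matrix_mul_lid matrix_mul_rid)
      show "?g *v (w *v k) = k" using 2 neg2_left[OF ky] by (simp add: matrix_vector_mult_uminus)
      show "?g *v d = d" if "d \<in> circ" "d \<noteq> k" "d \<noteq> - k" for d
        using neg2_other[OF ky, of d] that circ_basis eta_notin_circ by blast
    qed (use neg2_in_weyl[OF ky] in simp)
    then show ?thesis by simp
  next
    case 3
    note ky = ky[OF k 3(1)]
    let ?g = "reflection_along (k - y)"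
    have "w = ?g"
    proof (rule g)
      show "?g *v (w *v k) = k" using 3 swap_right[OF ky(1-4)] by simp
      show "?g *v d = d" if "d \<in> circ" "d \<noteq> k" "d \<noteq> - k" for d
        using swap_other[OF ky(1-4), of d] that circ_basis ky(5) circ_uminus by metis
    qed (use swap_in_weyl[OF ky(1-4)] in \<open>auto simp: reflection_along_transpose reflection_along_square\<close>)
    then show ?thesis using 3 by blast
  qed
qed

lemma small_sym_circ:
  assumes P: "sym_circ P" and small: "\<not> (\<exists>k1\<in>P. \<exists>k2\<in>P. k2 \<noteq> k1 \<and> k2 \<noteq> - k1)"
  shows "\<exists>k\<in>circ. P \<subseteq> {k, - k}"
proof (cases "P = {}")
  case False
  then obtain k where "k \<in> P" by blast
  then show ?thesis using small P sym_circD(1) by blast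
qed (use e_circ[of 0] in blast)

lemma fixes_off_mono: "fixes_off P w \<Longrightarrow> P \<subseteq> P' \<Longrightarrow> fixes_off P' w"
  by (auto simp: fixes_off_def)

lemma fixes_off_diff: "fixes_off P w \<Longrightarrow> w *v k = k \<Longrightarrow> fixes_off (P - {k, - k}) w"
  by (auto simp: fixes_off_def matrix_vector_mult_uminus)

lemma fixes_off_mult: "fixes_off P v \<Longrightarrow> fixes_off P w \<Longrightarrow> fixes_off P (v ** w)"
  by (simp add: fixes_off_def matrix_vector_mul_assoc[symmetric])

lemma fixes_off_swap:
  assumes "sym_circ P" "adj P k q"
  shows "fixes_off P (reflection_along (k - q))"
  unfolding fixes_off_def
proof
  fix d assume d: "d \<in> circ - P"
  have "k \<in> P" "- k \<in> P" "q \<in> P" "- q \<in> P" using assms by (auto simp: adj_def sym_circD(2))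
  then show "reflection_along (k - q) *v d = d"
    using swap_other[OF swap_adj(1-4)[OF assms], of d] d circ_basis by blast
qed

text \<open>Cuts the chord: \<open>q\<close> becomes fixed and leaves the support, and the same
  reflection restores \<open>w\<close>.\<close>

lemma mult_swap_short_chord:
  assumes P: "sym_circ P" and adj: "adj P k q" and w: "w \<in> weyl_group_D" "nc w" "fixes_off P w" "w *v k = q"
  defines "v \<equiv> w ** reflection_along (k - q)"
  shows "v \<in> weyl_group_D" "nc v" "fixes_off (P - {q, - q}) v" "v *v q = q" "v ** reflection_along (k - q) = w"
proof -
  note kq = swap_adj[OF P adj]
  show v: "v \<in> weyl_group_D" unfolding v_def using weyl_mult[OF w(1) swap_in_weyl[OF kq(1-4)]] .
  show vq: "v *v q = q" using w(4) swap_right[OF kq(1-4)] by (simp add: v_def matrix_vector_mul_assoc[symmetric])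
  have off: "fixes_off P v" unfolding v_def using fixes_off_mult[OF w(3) fixes_off_swap[OF P adj]] .
  show "fixes_off (P - {q, - q}) v" using fixes_off_diff[OF off vq] .
  show vw: "v ** reflection_along (k - q) = w"
    by (simp add: v_def matrix_mul_assoc[symmetric] reflection_along_square)
  show "nc v" using nc_mult_swap[OF P adj v off vq] vw w(2) by simp
qed

text \<open>A fixed vector is dropped from \<open>P\<close>; a shortest chord is cut, and the point
  of the shorter element is extended by \<open>fits_mult_swap\<close>.\<close>

lemma nc_imp_fits:
  assumes "sym_circ P" "w \<in> weyl_group_D" "nc w" "fixes_off P w"
  shows "\<exists>z. fits w z"
  using assms
proof (induction "card P" arbitrary: P w rule: less_induct)
  case less
  note P = less.prems(1) and w = less.prems(2-4)
  show ?case
  proof (cases "\<exists>k1\<in>P. \<exists>k2\<in>P. k2 \<noteq> k1 \<and> k2 \<noteq> - k1")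
    case False
    then obtain k where k: "k \<in> circ" "P \<subseteq> {k, - k}" using small_sym_circ[OF P] by blast
    then show ?thesis
      using weyl_supported_on_line[OF w(1) k(1) fixes_off_mono[OF w(3) k(2)]]
        fits_id fits_neg2_eta[OF k(1), of \<eta>] fits_reflection_eta[OF k(1)] by blast
  next
    case True
    then obtain k where k: "k \<in> P" "w *v k = k \<or> adj P k (w *v k)"
      using nc_short_chord[OF w P] by blast
    show ?thesis
    proof (cases "w *v k = k")
      case True
      then show ?thesis
        using less.hyps[OF card_diff_less[OF P k(1)] sym_circ_diff[OF P] w(1,2) fixes_off_diff[OF w(3)]] by blast
    next
      case False
      define q where "q = w *v k"
      have adj: "adj P k q" using k False by (simp add: q_def)
      then have q: "q \<in> P" by (simp add: adj_def)
      note v = mult_swap_short_chord[OF P adj w q_def[symmetric]]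
      obtain z where "fits (w ** reflection_along (k - q)) z"
        using less.hyps[OF card_diff_less[OF P q] sym_circ_diff[OF P] v(1-3)] by blast
      then show ?thesis
        using fits_mult_swap[OF P adj v(1) fixes_off_mono[OF v(3)] v(4)] v(5) by (metis Diff_subset)
    qed
  qed
qed

text \<open>The converse of \<open>fits_mult_swap\<close> without a second verification: the
  shortened element has some fitting point, whose extension must be \<open>z\<close> by uniqueness,
  and resetting \<open>q\<close> undoes the extension.\<close>

lemma fits_mult_swap_short_chord:
  assumes P: "sym_circ P" and adj: "adj P k q" and w: "w \<in> weyl_group_D" "nc w" "fixes_off P w" "w *v k = q"
    and fits: "fits w z"
  shows "fits (w ** reflection_along (k - q)) (upd z q (lam q))"
proof -
  note v = mult_swap_short_chord[OF P adj w]
  note kq = swap_adj[OF P adj]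
  obtain y where y: "fits (w ** reflection_along (k - q)) y"
    using nc_imp_fits[OF sym_circ_diff[OF P] v(1-3)] by blast
  have "fits w (upd y q (coord y k))"
    using fits_mult_swap[OF P adj v(1) fixes_off_mono[OF v(3)] v(4) y] v(5) by simp
  then have z: "z = upd y q (coord y k)" using fits_unique[OF w(1) fits] by blast
  have "coord y q = lam q" using fits_fixed(1)[OF y kq(6) v(4)] .
  then have "upd z q (lam q) = y" using kq(2) by (simp add: z upd_upd upd_triv)
  then show ?thesis using y by simp
qed

subsection \<open>Multiplicities\<close>

text \<open>An orbit invariant. For a fitting point, 1 means that \<open>k\<close> is fixed, at
  least 2 that \<open>k\<close> labels a larger block, and 0 that \<open>k\<close> labels
  nothing.\<close>

definition mult :: "complex^'n \<Rightarrow> real^'n \<Rightarrow> nat" where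
  "mult z k = card {b \<in> signed_basis. coord z b = lam k}"

text \<open>Membership in the zero locus, in terms of the labels; \<open>valued_iff\<close> proves
  the equivalence.\<close>

definition valued :: "complex^'n \<Rightarrow> bool" where
  "valued z \<longleftrightarrow> (\<forall>a\<in>signed_basis. coord z a = 0 \<or> (\<exists>b\<in>circ. coord z a = lam b))"

text \<open>The counterpart of \<open>fixes_off\<close> for points: off \<open>P\<close> each cycle
  vector carries its own label, and nothing else carries it.\<close>

definition pinned :: "(real^'n) set \<Rightarrow> complex^'n \<Rightarrow> bool" where
  "pinned P z \<longleftrightarrow> (\<forall>d\<in>circ - P. coord z d = lam d \<and> (\<forall>b\<in>signed_basis. coord z b = lam d \<longrightarrow> b = d))"

lemma finite_mult_set [simp]: "finite {b \<in> signed_basis. coord z b = v}"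
  by (rule finite_subset[OF _ finite_signed_basis]) auto

lemma card_coord_weyl:
  assumes "g \<in> weyl_group_D"
  shows "card {b \<in> signed_basis. coord (complexify g *v z) b = v} = card {b \<in> signed_basis. coord z b = v}"
proof -
  have "bij_betw ((*v) g) {b \<in> signed_basis. coord z b = v} {b \<in> signed_basis. coord (complexify g *v z) b = v}"
    by (rule bij_betw_byWitness[where f' = "(*v) (transpose g)"])
      (use assms in \<open>auto simp: coord_complexify weyl_signed_basis weyl_transpose\<close>)
  then show ?thesis by (rule bij_betw_same_card[symmetric])
qed

lemma mult_weyl: "g \<in> weyl_group_D \<Longrightarrow> mult (complexify g *v z) k = mult z k"
  by (simp add: mult_def card_coord_weyl)

lemma mult_uminus: "mult z (- k) = mult z k"
proof -
  have "bij_betw uminus {b \<in> signed_basis. coord z b = lam k} {b \<in> signed_basis. coord z b = lam (- k)}"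
    by (rule bij_betw_byWitness[where f' = uminus]) auto
  then show ?thesis unfolding mult_def by (rule bij_betw_same_card[symmetric])
qed

lemma mult_eq_0: "mult z k = 0 \<longleftrightarrow> (\<forall>b\<in>signed_basis. coord z b \<noteq> lam k)"
  by (auto simp: mult_def)

lemma mult_eq_1: "mult z k = 1 \<longleftrightarrow> (\<exists>!b. b \<in> signed_basis \<and> coord z b = lam k)"
  by (auto simp: mult_def card_1_singleton_iff) (metis (mono_tags, lifting) mem_Collect_eq singletonD singletonI)+

lemma mult_ge_2:
  assumes "mult z k \<ge> 2" "b \<in> signed_basis"
  shows "\<exists>b'\<in>signed_basis. b' \<noteq> b \<and> coord z b' = lam k"
proof (rule ccontr)
  assume "\<not> ?thesis"
  then have "{b \<in> signed_basis. coord z b = lam k} \<subseteq> {b}" by auto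
  then have "mult z k \<le> 1" unfolding mult_def by (metis card_mono finite.emptyI finite_insert is_singletonI is_singleton_altdef)
  then show False using assms by simp
qed

text \<open>Otherwise all multiplicities on \<open>P\<close> are at least 2. They add up to at most
  the number of basis vectors, which exceeds the size of the cycle by the two vectors on the line of
  \<eta>. This forces \<open>P\<close> to have at most 2 elements, but two different lines give at
  least 3.\<close>

lemma mult_cases:
  assumes z: "valued z" and P: "sym_circ P"
    and off: "\<And>d. d \<in> circ - P \<Longrightarrow> mult z d = 1"
    and k12: "k1 \<in> P" "k2 \<in> P" "k2 \<noteq> k1" "k2 \<noteq> - k1"
  shows "(\<exists>k\<in>P. mult z k = 1) \<or> (\<exists>k q. adj P k q \<and> mult z k \<ge> 2 \<and> mult z q = 0) \<or> (\<forall>k\<in>P. mult z k = 0)"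
proof (rule ccontr)
  assume neg: "\<not> ?thesis"
  then have n1: "mult z k \<noteq> 1" if "k \<in> P" for k using that by blast
  obtain k0 where k0: "k0 \<in> P" "mult z k0 \<ge> 2" using neg n1 by (metis One_nat_def Suc_1 less_2_cases not_less)
  have all2: "mult z q \<ge> 2" if q: "q \<in> P" for q
  proof (rule ccontr)
    assume "\<not> mult z q \<ge> 2"
    then have q0: "mult z q = 0" using n1[OF q] by linarith
    define q' where "q' = (if S k0 q = 1 then q else - q)"
    have "k0 \<noteq> q" "k0 \<noteq> - q" using k0 q0 mult_uminus[of z q] by auto
    then have "S k0 q = 1 \<or> S k0 q = -1" using S_circ[of k0 q] k0 q sym_circD(1)[OF P] by auto
    then have q': "q' \<in> P" "S k0 q' = 1" "mult z q' = 0"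
      using q q0 sym_circD(2)[OF P] by (auto simp: q'_def mult_uminus)
    \<comment> \<open>Along a chord from multiplicity at least 2 to multiplicity 0, an intermediate
      element is of one of the two kinds, so the pattern persists on one part.\<close>
    have "\<exists>k q. adj P k q \<and> (mult z k \<ge> 2 \<and> mult z q = 0)"
    proof (rule adj_exists[OF P k0(1) q'(1,2)])
      show "2 \<le> mult z k0 \<and> mult z q' = 0" using k0 q' by simp
      fix k q r assume "r \<in> P" "2 \<le> mult z k \<and> mult z q = 0"
      then show "(2 \<le> mult z k \<and> mult z r = 0) \<or> (2 \<le> mult z r \<and> mult z q = 0)"
        using n1[of r] by linarith
    qed
    then show False using neg by blast
  qed
  have fin: "finite P" using sym_circ_finite[OF P] .
  have Pc: "P \<subseteq> circ" using P by (simp add: sym_circ_def)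
  have "(\<Sum>a\<in>circ. mult z a) = card (\<Union>a\<in>circ. {b \<in> signed_basis. coord z b = lam a})"
    unfolding mult_def by (subst card_UN_disjoint) (auto simp: lam_eq_iff)
  also have "\<dots> \<le> card (signed_basis :: (real^'n) set)" by (rule card_mono) auto
  also have "signed_basis = circ \<union> {\<eta>, - \<eta>}" by (auto simp: basis_cases)
  also have "card (circ \<union> {\<eta>, - \<eta>}) \<le> card circ + 2"
    by (rule order_trans[OF card_Un_le]) (simp add: card_insert_if)
  finally have 1: "(\<Sum>a\<in>circ. mult z a) \<le> card circ + 2" .
  have "(\<Sum>a\<in>circ. mult z a) = (\<Sum>a\<in>circ - P. mult z a) + (\<Sum>a\<in>P. mult z a)"
    by (rule sum.subset_diff[OF Pc finite_circ])
  also have "(\<Sum>a\<in>circ - P. mult z a) = card (circ - P)" using off by simp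
  also have "card (circ - P) = card circ - card P" by (rule card_Diff_subset[OF fin Pc])
  finally have "card circ - card P + (\<Sum>a\<in>P. mult z a) \<le> card circ + 2" using 1 by simp
  moreover have "(\<Sum>a\<in>P. 2) \<le> (\<Sum>a\<in>P. mult z a)" by (rule sum_mono) (rule all2)
  moreover have "card P \<le> card circ" by (rule card_mono[OF finite_circ Pc])
  ultimately have "card P \<le> 2" by simp
  moreover have "card {k1, - k1, k2} \<le> card P"
    by (rule card_mono[OF fin]) (use k12 P sym_circD(2) in auto)
  moreover have "card {k1, - k1, k2} = 3" using k12 sym_circ_basis[OF P k12(1)] by auto
  ultimately show False by simp
qed

lemma valued_weyl:
  assumes "g \<in> weyl_group_D" "valued z"
  shows "valued (complexify g *v z)"
  using assms by (auto simp: valued_def coord_complexify weyl_signed_basis weyl_transpose)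

lemma valued_upd:
  assumes "valued z" "q \<in> circ"
  shows "valued (upd z q (lam q))"
  unfolding valued_def
proof
  fix a :: "real^'n" assume a: "a \<in> signed_basis"
  consider "a = q" | "a = - q" | "a \<noteq> q" "a \<noteq> - q" by blast
  then show "coord (upd z q (lam q)) a = 0 \<or> (\<exists>b\<in>circ. coord (upd z q (lam q)) a = lam b)"
  proof cases
    case 1 then show ?thesis using assms circ_basis by auto
  next
    case 2 then show ?thesis using assms circ_basis by (intro disjI2 bexI[of _ "- q"]) auto
  next
    case 3 then show ?thesis using assms a circ_basis coord_upd_other[of q a z] by (auto simp: valued_def)
  qed
qed

lemma fits_valued: "fits w z \<Longrightarrow> valued z"
  using fits_label[of w z] by (auto simp: valued_def)

lemma pinned_weyl:
  assumes g: "g \<in> weyl_group_D" "fixes_off P g" and z: "pinned P z"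
  shows "pinned P (complexify g *v z)"
  unfolding pinned_def
proof (intro ballI conjI impI)
  fix d assume d: "d \<in> circ - P"
  then have gd: "g *v d = d" using g(2) by (simp add: fixes_off_def)
  have "coord (complexify g *v z) (g *v d) = coord z d" by (rule coord_complexify_mult_vec[OF g(1)])
  then show "coord (complexify g *v z) d = lam d" using z d gd by (simp add: pinned_def)
  fix b :: "real^'n" assume b: "b \<in> signed_basis" "coord (complexify g *v z) b = lam d"
  then have "transpose g *v b = d"
    using z d g(1) by (auto simp: pinned_def coord_complexify weyl_signed_basis weyl_transpose)
  then have "b = g *v d" using g(1) by (metis weyl_transpose_mult_vec(2))
  then show "b = d" using gd by simp
qed

lemma pinned_mult: "pinned P z \<Longrightarrow> d \<in> circ - P \<Longrightarrow> mult z d = 1"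
  unfolding mult_eq_1 pinned_def using circ_basis by blast

lemma pinned_diff:
  assumes "pinned P z" "k \<in> circ" "coord z k = lam k" "\<And>b. b \<in> signed_basis \<Longrightarrow> coord z b = lam k \<Longrightarrow> b = k"
  shows "pinned (P - {k, - k}) z"
  unfolding pinned_def
proof (intro ballI conjI impI)
  fix d assume d: "d \<in> circ - (P - {k, - k})"
  show "coord z d = lam d" using d assms by (auto simp: pinned_def)
  fix b :: "real^'n" assume b: "b \<in> signed_basis" "coord z b = lam d"
  consider "d = k" | "d = - k" | "d \<in> circ - P" using d by blast
  then show "b = d"
  proof cases
    case 2
    then have "- b = k" using assms(4)[of "- b"] b by simp
    then show ?thesis using 2 by auto
  qed (use assms b in \<open>auto simp: pinned_def\<close>)
qed

text \<open>Permuting vectors within \<open>P\<close> and the line of \<eta> costs no parity;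
  reversing \<open>q\<close> is paired with a sign change of \<eta>.\<close>

lemma move:
  assumes P: "sym_circ P" and q: "q \<in> P" and b: "b \<in> P \<or> b = \<eta> \<or> b = - \<eta>"
  shows "\<exists>g. g \<in> weyl_group_D \<and> fixes_off P g \<and> g *v b = q"
proof -
  have qc: "q \<in> circ" "q \<in> signed_basis" using q P sym_circD(1) sym_circ_basis by blast+
  have bb: "b \<in> signed_basis" using b P sym_circ_basis by auto
  have Pm: "- q \<in> P" using q P sym_circD(2) by blast
  consider "b = q" | "b = - q" | "b \<noteq> q" "b \<noteq> - q" by blast
  then show ?thesis
  proof cases
    case 1
    then show ?thesis using mat_1_in_weyl by (intro exI[of _ "mat 1"]) (simp add: fixes_off_def)
  next
    case 2
    note ky = ky[OF qc(1), of \<eta>, OF disjI1[OF refl]]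
    have "neg2 q \<eta> *v d = d" if "d \<in> circ - P" for d
      using neg2_other[OF ky(1-4), of d] that q Pm circ_basis eta_notin_circ by blast
    then show ?thesis
      using 2 neg2_in_weyl[OF ky(1-4)] neg2_left[OF ky(1-4)]
      by (intro exI[of _ "neg2 q \<eta>"]) (simp add: fixes_off_def matrix_vector_mult_uminus)
  next
    case 3
    have "b \<notin> circ - P \<and> - b \<notin> circ - P"
      using b by (elim disjE) (use P in \<open>auto simp: sym_circ_def\<close>)
    then have "reflection_along (b - q) *v d = d" if "d \<in> circ - P" for d
      using swap_other[OF bb qc(2) 3, of d] that q Pm circ_basis by blast
    then show ?thesis
      using 3 swap_in_weyl[OF bb qc(2) 3] swap_left[OF bb qc(2) 3]
      by (intro exI[of _ "reflection_along (b - q)"]) (simp add: fixes_off_def)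
  qed
qed

end

context D_frame
begin

subsection \<open>Every orbit has a labelled representative\<close>

lemma fits_exists_in_orbit:
  assumes "sym_circ P" "valued z" "pinned P z"
  shows "\<exists>w g. w \<in> weyl_group_D \<and> nc w \<and> fixes_off P w \<and> g \<in> weyl_group_D \<and> fits w (complexify g *v z)"
  using assms
proof (induction "card P" arbitrary: P z rule: less_induct)
  case less
  note P = less.prems(1) and z = less.prems(2) and pin = less.prems(3)
  define G where "G P z \<longleftrightarrow> (\<exists>w g. w \<in> weyl_group_D \<and> nc w \<and> fixes_off P w \<and> g \<in> weyl_group_D \<and>
    fits w (complexify g *v z))" for P z
  have GI: "G P z" if "w \<in> weyl_group_D" "nc w" "fixes_off P w" "g \<in> weyl_group_D" "fits w (complexify g *v z)"
    for P z w g using that unfolding G_def by blast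
  have IH: "G (P - {k, - k}) z" if "k \<in> P" "valued z" "pinned (P - {k, - k}) z" for k z
    using less.hyps[OF card_diff_less[OF P that(1)] sym_circ_diff[OF P] that(2,3)] unfolding G_def .
  have G_move: "G P z" if "g \<in> weyl_group_D" "G P (complexify g *v z)" for P g z
    using that weyl_mult[of _ g] unfolding G_def complexify_mult[symmetric] by blast
  have G_mono: "G P z" if "G (P - A) z" for z A
    using that fixes_off_mono[of "P - A" _ P] unfolding G_def by blast
  have in_P: "b \<in> P \<or> b = \<eta> \<or> b = - \<eta>"
    if "pinned P z" "b \<in> signed_basis" "coord z b = lam k \<or> coord z b = 0" "k \<in> P" for b k z
  proof -
    have "b \<notin> circ - P"
    proof
      assume b: "b \<in> circ - P"
      then have "coord z b = lam b" using that by (simp add: pinned_def)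
      then have "b = k" using that b lam_nonzero lam_inj sym_circD(1)[OF P] by auto
      then show False using b that by blast
    qed
    then show ?thesis using that by (auto simp: basis_cases)
  qed
  have step: "G P z"
    if adj: "adj P k q" and z: "valued z" and pin: "pinned P z"
      and avoid: "\<forall>b\<in>signed_basis. coord z b \<noteq> lam q"
      and val: "\<And>w g. fixes_off (P - {q, - q}) w \<Longrightarrow> fits w (complexify g *v upd z q (lam q)) \<Longrightarrow> g \<in> weyl_group_D \<Longrightarrow>
        coord (complexify g *v upd z q (lam q)) k = coord z q"
    for k q z
  proof -
    note kq = swap_adj[OF P adj]
    have qP: "q \<in> P" using adj by (simp add: adj_def)
    let ?z = "upd z q (lam q)"
    have other: "coord ?z b = coord z b" if "b \<in> signed_basis" "b \<noteq> q" "b \<noteq> - q" for b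
      using coord_upd_other[OF kq(2) that] .
    have uniq: "b = q" if b: "b \<in> signed_basis" "coord ?z b = lam q" for b
    proof (rule ccontr)
      assume bq: "b \<noteq> q"
      show False
      proof (cases "b = - q")
        case True then show False using b kq lam_nonzero[OF kq(6)] by simp
      next
        case False then show False using other[OF b(1) bq] b avoid by auto
      qed
    qed
    have pin1: "pinned (P - {q, - q}) ?z"
    proof (rule pinned_diff[OF _ kq(6) _ uniq])
      show "pinned P ?z"
        unfolding pinned_def
      proof (intro ballI conjI impI)
        fix d assume d: "d \<in> circ - P"
        have dq: "d \<noteq> q" "d \<noteq> - q" using d qP P by (auto simp: sym_circ_def)
        show "coord ?z d = lam d" using d dq pin other circ_basis by (simp add: pinned_def)
        fix b :: "real^'n" assume b: "b \<in> signed_basis" "coord ?z b = lam d"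
        consider "b = q" | "b = - q" | "b \<noteq> q" "b \<noteq> - q" by blast
        then show "b = d"
        proof cases
          case 1 then show ?thesis using b kq d lam_inj by auto
        next
          case 2
          then have "lam (- q) = lam d" using b kq by simp
          then show ?thesis using 2 d lam_inj[of "- q" d] kq by auto
        next
          case 3 then show ?thesis using pin other b d by (simp add: pinned_def)
        qed
      qed
    qed (use kq in simp_all)
    obtain w g where w: "w \<in> weyl_group_D" "nc w" "fixes_off (P - {q, - q}) w" "g \<in> weyl_group_D"
      and fits: "fits w (complexify g *v ?z)"
      using IH[OF qP valued_upd[OF z kq(6)] pin1] unfolding G_def by blast
    let ?y = "complexify g *v ?z"
    have wq: "w *v q = q" using w(3) kq by (simp add: fixes_off_def)
    have off: "fixes_off P w" using fixes_off_mono[OF w(3)] by blast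
    have "coord ?y (g *v q) = lam q" using coord_complexify_mult_vec[OF w(4), of ?z q] kq by simp
    then have gq: "g *v q = q" using fits_fixed(2)[OF fits kq(6) wq weyl_signed_basis[OF w(4) kq(2)]] by blast
    have "upd ?y q (coord ?y k) = upd ?y q (coord z q)" using val[OF w(3) fits w(4)] by simp
    also have "\<dots> = complexify g *v upd ?z q (coord z q)" using complexify_upd[OF w(4) kq(2)] gq by simp
    also have "upd ?z q (coord z q) = z" using kq(2) by (simp add: upd_upd upd_triv)
    finally have "fits (w ** reflection_along (k - q)) (complexify g *v z)"
      using fits_mult_swap[OF P adj w(1) off wq fits] by simp
    moreover have "nc (w ** reflection_along (k - q))" using nc_mult_swap[OF P adj w(1) off wq] w(2) by simp
    moreover have "w ** reflection_along (k - q) \<in> weyl_group_D" using weyl_mult[OF w(1) swap_in_weyl[OF kq(1-4)]] .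
    moreover have "fixes_off P (w ** reflection_along (k - q))" using fixes_off_mult[OF off fixes_off_swap[OF P adj]] .
    ultimately show ?thesis using GI w(4) by blast
  qed
  have "G P z"
  proof (cases "\<exists>k1\<in>P. \<exists>k2\<in>P. k2 \<noteq> k1 \<and> k2 \<noteq> - k1")
    case False
    then obtain k where k: "k \<in> circ" "P \<subseteq> {k, - k}" using small_sym_circ[OF P] by blast
    then have "P = {} \<or> P = {k, - k}" using P unfolding sym_circ_def by auto
    then show ?thesis
    proof
      assume P0: "P = {}"
      have eta: "coord z \<eta> = 0"
      proof (rule ccontr)
        assume "coord z \<eta> \<noteq> 0"
        then obtain a where "a \<in> circ" "coord z \<eta> = lam a" using z by (auto simp: valued_def)
        then have "\<eta> = a" using pin P0 by (auto simp: pinned_def)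
        then show False using \<open>a \<in> circ\<close> eta_notin_circ(1) by simp
      qed
      have "z = zeta"
        by (rule coord_ext) (use pin P0 eta in \<open>auto simp: basis_cases pinned_def\<close>)
      moreover have "fixes_off P (mat 1)" by (simp add: fixes_off_def)
      ultimately show ?thesis using GI[OF mat_1_in_weyl nc_id _ mat_1_in_weyl] fits_id by simp
    next
      assume Pk: "P = {k, - k}"
      then have kP: "k \<in> P" by simp
      have kb: "k \<in> signed_basis" "k \<noteq> \<eta>" "k \<noteq> - \<eta>" using ky[OF k(1), of \<eta>] by auto
      have dP: "d \<notin> P \<longleftrightarrow> d \<noteq> k \<and> d \<noteq> - k" for d using Pk by auto
      have eqI: "z = z'" if pin: "pinned P z" and z': "coord z' k = coord z k" "coord z' \<eta> = coord z \<eta>"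
        "\<And>d. d \<in> circ \<Longrightarrow> d \<noteq> k \<Longrightarrow> d \<noteq> - k \<Longrightarrow> coord z' d = lam d" for z z'
      proof (rule coord_ext)
        fix a :: "real^'n" assume a: "a \<in> signed_basis"
        consider "a = k" | "a = - k" | "a = \<eta>" | "a = - \<eta>" | "a \<in> circ" "a \<noteq> k" "a \<noteq> - k"
          using a by (auto simp: basis_cases)
        then show "coord z a = coord z' a"
        proof cases
          case 5
          then have "coord z a = lam a" using pin dP unfolding pinned_def by blast
          then show ?thesis using z'(3)[OF 5] by simp
        qed (simp_all add: z'(1,2))
      qed
      \<comment> \<open>With \<open>k\<close> correctly labelled only the value at \<eta> is open: 0
        gives the identity, and the label of \<open>k\<close>, at \<eta> or at its negative, gives a
        reflection.\<close>
      have lam_k: "G P z" if pin: "pinned P z" and z: "valued z" and zk: "coord z k = lam k" for z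
      proof -
        have "coord z \<eta> = 0 \<or> (\<exists>y. (y = \<eta> \<or> y = - \<eta>) \<and> coord z y = lam k)"
        proof (rule ccontr)
          assume neg: "\<not> ?thesis"
          then obtain a where a: "a \<in> circ" "coord z \<eta> = lam a" using z by (auto simp: valued_def)
          have "a \<in> P"
          proof (rule ccontr)
            assume "a \<notin> P"
            then have "a \<in> circ - P" using a(1) by simp
            then have "\<eta> = a" using pin a(2) eta_basis unfolding pinned_def by blast
            then show False using a(1) eta_notin_circ(1) by simp
          qed
          then have "coord z \<eta> = lam k \<or> coord z (- \<eta>) = lam k" using a Pk by auto
          then show False using neg by blast
        qed
        then consider "coord z \<eta> = 0" | y where "y = \<eta> \<or> y = - \<eta>" "coord z y = lam k" by blast
        then show ?thesis
        proof cases
          case 1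
          have "z = zeta" by (rule eqI[OF pin]) (use 1 zk in auto)
          moreover have "fixes_off P (mat 1)" by (simp add: fixes_off_def)
          ultimately show ?thesis using GI[OF mat_1_in_weyl nc_id _ mat_1_in_weyl] fits_id by simp
        next
          case 2
          note ky = ky[OF k(1) 2(1)]
          have "z = upd zeta y (lam k)"
          proof (rule eqI[OF pin])
            show "coord (upd zeta y (lam k)) k = coord z k" using coord_upd_other[OF ky(2,1,3,4)] zk by simp
            have "coord (upd zeta y (lam k)) y = coord z y" using 2 ky by simp
            then show "coord (upd zeta y (lam k)) \<eta> = coord z \<eta>" using 2(1) by auto
            show "coord (upd zeta y (lam k)) d = lam d" if "d \<in> circ" for d
              using coord_upd_other[OF ky(2), of d] that circ_basis ky(5) circ_uminus by metis
          qed
          moreover have "fixes_off P (reflection_along (k - y))"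
            using swap_other[OF ky(1-4)] Pk circ_basis ky(5) circ_uminus unfolding fixes_off_def
            by (metis DiffD1 DiffD2 insertCI)
          ultimately show ?thesis
            using GI[OF swap_in_weyl[OF ky(1-4)] nc_reflection _ mat_1_in_weyl] fits_reflection_eta[OF k(1) 2(1)] by simp
        qed
      qed
      show ?thesis
      proof (cases "\<exists>b. (b \<in> P \<or> b = \<eta> \<or> b = - \<eta>) \<and> coord z b = lam k")
        case True
        then obtain b where b: "b \<in> P \<or> b = \<eta> \<or> b = - \<eta>" "coord z b = lam k" by blast
        obtain g where g: "g \<in> weyl_group_D" "fixes_off P g" "g *v b = k" using move[OF P kP b(1)] by blast
        have "coord (complexify g *v z) k = lam k" using coord_complexify_mult_vec[OF g(1), of z b] g b by simp
        then show ?thesis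
          using lam_k[OF pinned_weyl[OF g(1,2) pin] valued_weyl[OF g(1) z]] G_move[OF g(1)] by blast
      next
        case False
        have z0: "coord z x = 0" if x: "x = k \<or> x = \<eta>" for x
        proof (rule ccontr)
          assume nz: "coord z x \<noteq> 0"
          have xb: "x \<in> signed_basis" using x kb by auto
          then obtain a where a: "a \<in> circ" "coord z x = lam a" using z nz by (auto simp: valued_def)
          have "a \<in> P"
          proof (rule ccontr)
            assume "a \<notin> P"
            then have "a \<in> circ - P" using a(1) by simp
            then have "x = a" using pin a(2) xb unfolding pinned_def by blast
            then show False using a x kP \<open>a \<notin> P\<close> by auto
          qed
          then have "coord z x = lam k \<or> coord z (- x) = lam k" using a Pk by auto
          moreover have "x \<in> P \<or> x = \<eta> \<or> x = - \<eta>" "- x \<in> P \<or> - x = \<eta> \<or> - x = - \<eta>" using x Pk by auto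
          ultimately show False using False by blast
        qed
        have "z = upd zeta k 0"
        proof (rule eqI[OF pin])
          have "k \<bullet> \<eta> = 0" using k by (auto simp: circ_def)
          then show "coord (upd zeta k 0) \<eta> = coord z \<eta>" using z0 by (simp add: coord_upd)
          show "coord (upd zeta k 0) d = lam d" if "d \<in> circ" "d \<noteq> k" "d \<noteq> - k" for d
            using coord_upd_other[OF kb(1), of d] that circ_basis by blast
        qed (use z0 kb in simp)
        moreover have "fixes_off P (neg2 k \<eta>)"
          using neg2_other[OF kb(1) eta_basis kb(2,3)] Pk circ_basis eta_notin_circ unfolding fixes_off_def
          by (metis DiffD1 DiffD2 insertCI)
        ultimately show ?thesis
          using GI[OF neg2_in_weyl[OF kb(1) eta_basis kb(2,3)] nc_neg2[OF k(1)] _ mat_1_in_weyl]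
            fits_neg2_eta[OF k(1)] by simp
      qed
    qed
  next
    case True
    then obtain k1 k2 where k12: "k1 \<in> P" "k2 \<in> P" "k2 \<noteq> k1" "k2 \<noteq> - k1" by blast
    consider k where "k \<in> P" "mult z k = 1" | k q where "adj P k q" "mult z k \<ge> 2" "mult z q = 0"
      | "\<forall>k\<in>P. mult z k = 0"
      using mult_cases[OF z P pinned_mult[OF pin] k12] by blast
    then show ?thesis
    proof cases
      case 1
      then obtain b where b: "b \<in> signed_basis" "coord z b = lam k"
        and uniq: "\<And>b'. b' \<in> signed_basis \<Longrightarrow> coord z b' = lam k \<Longrightarrow> b' = b"
        unfolding mult_eq_1 by blast
      obtain g where g: "g \<in> weyl_group_D" "fixes_off P g" "g *v b = k"
        using move[OF P 1(1) in_P[OF pin b(1) disjI1[OF b(2)] 1(1)]] by blast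
      have "coord (complexify g *v z) k = lam k"
        using coord_complexify_mult_vec[OF g(1), of z b] g(3) b by simp
      moreover have "b' = k" if "b' \<in> signed_basis" "coord (complexify g *v z) b' = lam k" for b'
      proof -
        have "transpose g *v b' = b"
          using uniq[of "transpose g *v b'"] that g(1) by (simp add: coord_complexify weyl_signed_basis weyl_transpose)
        then show ?thesis using g by (metis weyl_transpose_mult_vec(2))
      qed
      ultimately have "pinned (P - {k, - k}) (complexify g *v z)"
        using pinned_diff[OF pinned_weyl[OF g(1,2) pin]] 1(1) sym_circD(1)[OF P] by blast
      then have "G (P - {k, - k}) (complexify g *v z)" using IH[OF 1(1) valued_weyl[OF g(1) z]] by blast
      then show ?thesis using G_move[OF g(1)] G_mono by blast
    next
      case 2
      note kq = swap_adj[OF P 2(1)]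
      have kP: "k \<in> P" "q \<in> P" using 2 by (auto simp: adj_def)
      have "mult z k \<noteq> 0" using 2 by simp
      then obtain b where b: "b \<in> signed_basis" "coord z b = lam k" unfolding mult_eq_0 by blast
      \<comment> \<open>A second vector with the label of \<open>k\<close> keeps this label in use
        after \<open>q\<close> has received its own value; hence the multiplicity at least
        2.\<close>
      obtain b2 where b2: "b2 \<in> signed_basis" "b2 \<noteq> b" "coord z b2 = lam k" using mult_ge_2[OF 2(2) b(1)] by blast
      obtain g where g: "g \<in> weyl_group_D" "fixes_off P g" "g *v b = q"
        using move[OF P kP(2) in_P[OF pin b(1) disjI1[OF b(2)] kP(1)]] by blast
      let ?z = "complexify g *v z"
      have zq: "coord ?z q = lam k" using coord_complexify_mult_vec[OF g(1), of z b] g(3) b by simp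
      have b3: "g *v b2 \<in> signed_basis" "g *v b2 \<noteq> q" "coord ?z (g *v b2) = lam k"
        using b2 g weyl_inj[OF g(1)] coord_complexify_mult_vec[OF g(1), of z b2] weyl_signed_basis[OF g(1)] by auto
      have b3': "g *v b2 \<noteq> - q" using b3(3) zq lam_nonzero[OF kq(5)] by auto
      have "G P ?z"
      proof (rule step[OF 2(1) valued_weyl[OF g(1) z] pinned_weyl[OF g(1,2) pin]])
        show "\<forall>b\<in>signed_basis. coord ?z b \<noteq> lam q" using 2(3) mult_weyl[OF g(1), of z q] mult_eq_0 by metis
        fix w g1
        assume fits: "fits w (complexify g1 *v upd ?z q (lam q))" "g1 \<in> weyl_group_D"
        let ?y = "complexify g1 *v upd ?z q (lam q)"
        have "coord ?y (g1 *v (g *v b2)) = lam k"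
          using coord_complexify_mult_vec[OF fits(2)] coord_upd_other[OF kq(2) b3(1,2) b3'] b3(3) by simp
        then obtain a where "a \<in> circ" "lam k = lam a" "coord ?y a = lam a"
          using fits_label[OF fits(1), of "g1 *v (g *v b2)"] weyl_signed_basis[OF fits(2) b3(1)] lam_nonzero[OF kq(5)] by auto
        then have "coord ?y k = lam k" using lam_inj kq by metis
        then show "coord ?y k = coord ?z q" using zq by simp
      qed
      then show ?thesis using G_move[OF g(1)] by blast
    next
      case 3
      obtain k q where adj: "adj P k q"
      proof -
        have "S k1 k2 = 1 \<or> S k1 (- k2) = 1"
        proof -
          have "k1 \<noteq> - k2" using k12 by (metis minus_minus)
          then show ?thesis using S_circ[of k1 k2] k12 sym_circD(1)[OF P] by auto
        qed
        moreover have "- k2 \<in> P" using k12 P by (simp add: sym_circ_def)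
        ultimately show ?thesis
          using adj_exists[OF P k12(1,2), of "\<lambda>_ _. True"] adj_exists[OF P k12(1), of "- k2" "\<lambda>_ _. True"] that by blast
      qed
      note kq = swap_adj[OF P adj]
      have kP: "k \<in> P" "q \<in> P" using adj by (auto simp: adj_def)
      have avoid: "coord z b \<noteq> lam x" if "x \<in> P" "b \<in> signed_basis" for x b
        using 3 that mult_eq_0 by blast
      have z0: "coord z x = 0" if xP: "x \<in> P" for x
      proof (rule ccontr)
        assume "coord z x \<noteq> 0"
        then obtain a where a: "a \<in> circ" "coord z x = lam a" using z sym_circ_basis[OF P xP] by (auto simp: valued_def)
        show False
        proof (cases "a \<in> P")
          case True then show ?thesis using avoid a sym_circ_basis[OF P xP] by blast
        next
          case False
          then have "a \<in> circ - P" using a(1) by simp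
          then have "x = a" using pin a(2) sym_circ_basis[OF P xP] unfolding pinned_def by blast
          then show ?thesis using False xP by simp
        qed
      qed
      show ?thesis
      proof (rule step[OF adj z pin])
        show "\<forall>b\<in>signed_basis. coord z b \<noteq> lam q" using avoid kP by blast
        fix w g1
        assume w: "fixes_off (P - {q, - q}) w" and fits: "fits w (complexify g1 *v upd z q (lam q))" "g1 \<in> weyl_group_D"
        let ?y = "complexify g1 *v upd z q (lam q)"
        have "coord ?y k = 0"
        proof (rule ccontr)
          assume "coord ?y k \<noteq> 0"
          then obtain a where a: "a \<in> circ" "coord ?y k = lam a" "coord ?y a = lam a"
            using fits_label[OF fits(1) kq(1)] by blast
          show False
          proof (cases "a \<in> P - {q, - q}")
            case False
            then have "w *v a = a" using w a by (simp add: fixes_off_def)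
            then have "k = a" using fits_fixed(2)[OF fits(1) a(1) _ kq(1) a(2)] by blast
            then show False using False kP kq by auto
          next
            case True
            define b where "b = transpose g1 *v k"
            have b: "b \<in> signed_basis" "coord (upd z q (lam q)) b = lam a"
              using a(2) kq(1) fits(2) by (auto simp: b_def coord_complexify weyl_signed_basis weyl_transpose)
            consider "b = q" | "b = - q" | "b \<noteq> q" "b \<noteq> - q" by blast
            then show False
            proof cases
              case 1 then show ?thesis using b True a lam_inj kq by auto
            next
              case 2
              then have "lam (- q) = lam a" using b kq by simp
              then show ?thesis using True a lam_inj[of "- q" a] kq by auto
            next
              case 3
              then show ?thesis using b True avoid[of a b] coord_upd_other[OF kq(2) b(1)] by auto
            qed
          qed
        qed
        then show "coord ?y k = coord z q" using z0[OF kP(2)] by simp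
      qed
    qed
  qed
  then show ?case unfolding G_def .
qed

end

context D_frame
begin

subsection \<open>The labelled representative is unique\<close>

text \<open>If two backward chords met at \<open>a\<close>, the identity would push all its terms to
  their extreme values and force \<open>w *v a = i\<close>, where \<open>S\<close> vanishes.\<close>

lemma opens_imp_no_return:
  assumes w: "w \<in> weyl_group_D" "nc w" and i: "i \<in> signed_basis" and a: "w *v i = a" and op: "opens w i"
    and neq: "w *v a \<noteq> a"
  shows "S (w *v a) a \<noteq> 1"
proof
  assume S1: "S (w *v a) a = 1"
  have ab: "a \<in> signed_basis" "w *v a \<in> signed_basis" using weyl_signed_basis[OF w(1)] i a by blast+
  have eq: "1 - S (w *v a) i + S a i = (w *v a) \<bullet> i - 1"
    using ncD'[OF w(2), of a i] S1 ab by (simp add: a)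
  have "S i a \<noteq> 1" using op by (simp add: opens_def a)
  then have "S a i \<ge> 0" using S_skew[of a i] S_basis(1)[OF i ab(1)] by auto
  moreover have "S (w *v a) i \<le> 1" using S_basis(1)[OF ab(2) i] by auto
  moreover have "(w *v a) \<bullet> i \<le> 1" using inner_signed_basis[OF ab(2) i] by auto
  ultimately have "(w *v a) \<bullet> i = 1" "S (w *v a) i = 1" using eq by linarith+
  then have "w *v a = i" using inner_eq_1_iff[OF ab(2) i] by simp
  then show False using \<open>S (w *v a) i = 1\<close> by simp
qed

text \<open>The chord ending at \<open>q\<close> does not open, so it comes from behind
  \<open>q\<close> or from \<open>- q\<close>. In either case the identity for \<open>k\<close> and
  the source of that chord leaves no place for \<open>w *v k\<close> other than
  \<open>q\<close>.\<close>

lemma nc_maps_to_next: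
  assumes P: "sym_circ P" and adj: "adj P k q" and w: "w \<in> weyl_group_D" "nc w" "fixes_off P w"
    and q: "\<And>i. i \<in> signed_basis \<Longrightarrow> w *v i = q \<Longrightarrow> \<not> opens w i"
    and k: "S (w *v k) k \<noteq> 1" "w *v k \<noteq> k"
  shows "w *v k = q"
proof (rule ccontr)
  assume neq: "w *v k \<noteq> q"
  note kq = swap_adj[OF P adj]
  have Skq: "S k q = 1" using adj by (simp add: adj_def)
  define i where "i = transpose w *v q"
  have i: "i \<in> signed_basis" "w *v i = q" using w(1) kq by (auto simp: i_def weyl_signed_basis weyl_transpose)
  have ik: "i \<noteq> k" using i neq by auto
  have wkb: "w *v k \<in> signed_basis" using weyl_signed_basis[OF w(1) kq(1)] .
  have wkP: "w *v k \<in> P \<or> w *v k = \<eta> \<or> w *v k = - \<eta>"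
    using fixes_off_invariant[OF w(1,3) _ P, of k] adj by (auto simp: adj_def)
  have eq: "S (w *v k) q - S (w *v k) i - 1 + S k i = (w *v k) \<bullet> i"
    using ncD'[OF w(2), of k i] kq Skq inner_eq_0_iff[of k q] by (simp add: i)
  have wkq: "S (w *v k) q \<noteq> 1"
  proof
    assume *: "S (w *v k) q = 1"
    then have "w *v k \<in> P" using wkP by (metis S_eta(1) S_uminus_left minus_zero zero_neq_one)
    moreover have "w *v k \<noteq> - k" "w *v k \<noteq> - q" using * Skq by auto
    ultimately have "S (w *v k) k = S (w *v k) q" using adj_S[OF P adj, of "w *v k"] k neq by blast
    then show False using * k by simp
  qed
  then have wkq': "S (w *v k) q \<le> 0" using S_basis(1)[OF wkb kq(2)] by auto
  have "S i q = 1 \<or> q = - i" using q[OF i] by (auto simp: opens_def i)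
  then show False
  proof
    assume Siq: "S i q = 1"
    then have iq: "i \<noteq> q" "i \<noteq> - q" "i \<noteq> - k" using Skq by auto
    have "i \<in> circ" using S_basis(2)[OF i(1) kq(2)] Siq by simp
    then have iP: "i \<in> P"
      using w(3) i iq(1) unfolding fixes_off_def by (metis DiffI)
    have "S i k = 1" using adj_S[OF P adj, of i] iP ik iq Siq by simp
    then have "S k i = -1" using S_skew[of k i] by simp
    then have *: "S (w *v k) q - S (w *v k) i - 2 = (w *v k) \<bullet> i" using eq by simp
    then have "S (w *v k) i \<le> -1" using wkq' inner_signed_basis[OF wkb i(1)] S_basis(1)[OF wkb i(1)]
      by (auto split: if_splits)
    then have "S (w *v k) i = -1" using S_basis(1)[OF wkb i(1)] by auto
    then have "(w *v k) \<bullet> i = 0" using inner_eq_0_iff[OF wkb i(1)] by auto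
    then have "S (w *v k) q = 1" using * \<open>S (w *v k) i = -1\<close> by simp
    then show False using wkq by simp
  next
    assume "q = - i"
    then have iq: "i = - q" by simp
    then have "2 * S (w *v k) q - 2 = (w *v k) \<bullet> i" using eq Skq by simp
    then have "w *v k = - i" using wkq' inner_signed_basis[OF wkb i(1)] by (auto split: if_splits)
    then show False using iq neq by simp
  qed
qed

text \<open>The unique vector with this label is \<open>k\<close> itself, and \<open>w\<close>
  preserves values.\<close>

lemma fits_mult_1:
  assumes w: "w \<in> weyl_group_D" and fits: "fits w z" and k: "k \<in> circ" and m: "mult z k = 1"
  shows "w *v k = k"
proof -
  obtain b where b: "b \<in> signed_basis" "coord z b = lam k"
    and uniq: "\<And>b'. b' \<in> signed_basis \<Longrightarrow> coord z b' = lam k \<Longrightarrow> b' = b"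
    using m unfolding mult_eq_1 by blast
  obtain a where "a \<in> circ" "lam k = lam a" "coord z a = lam a"
    using fits_label[OF fits b(1)] b(2) lam_nonzero[OF k] by auto
  then have zk: "coord z k = lam k" using lam_inj[OF k] by metis
  then have "coord z (w *v k) = lam k" using fits_invariant[OF fits circ_basis[OF k]] by simp
  then have "w *v k = b" using uniq weyl_signed_basis[OF w circ_basis[OF k]] by blast
  also have "b = k" using uniq[OF circ_basis[OF k] zk] by simp
  finally show ?thesis .
qed

text \<open>The multiplicities of \<open>z\<close> detect a shortest chord of \<open>w\<close>.\<close>

lemma fits_chord:
  assumes P: "sym_circ P" and adj: "adj P k q" and w: "w \<in> weyl_group_D" "nc w" "fixes_off P w"
    and fits: "fits w z"
    and m: "mult z k \<ge> 2 \<and> mult z q = 0 \<or> (\<forall>x\<in>P. mult z x = 0)"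
  shows "w *v k = q" "coord z k = (if mult z k = 0 then 0 else lam k)"
proof -
  note kq = swap_adj[OF P adj]
  have kP: "k \<in> P" "q \<in> P" using adj by (auto simp: adj_def)
  have label: "coord z k = lam k" if mk: "mult z k \<noteq> 0"
  proof -
    obtain b where b: "b \<in> signed_basis" "coord z b = lam k" using mk unfolding mult_eq_0 by blast
    obtain a where "a \<in> circ" "lam k = lam a" "coord z a = lam a"
      using fits_label[OF fits b(1)] b(2) lam_nonzero[OF kq(5)] by auto
    then show ?thesis using lam_inj[OF kq(5)] by metis
  qed
  have notlab: "coord z x \<noteq> lam x" if "mult z x = 0" "x \<in> P" for x
    using that mult_eq_0 sym_circ_basis[OF P] by blast
  have nofix: "w *v x \<noteq> x" if "mult z x = 0" "x \<in> P" for x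
    using notlab[OF that] fits_fixed(1)[OF fits, of x] that sym_circD(1)[OF P] by blast
  have qm: "mult z q = 0" using m kP by auto
  have "S (w *v k) k \<noteq> 1 \<and> w *v k \<noteq> k"
  proof (cases "mult z k = 0")
    case False
    then have k2: "mult z k \<ge> 2" using m kP by auto
    have zk: "coord z k = lam k" using label False .
    obtain b where b: "b \<in> signed_basis" "b \<noteq> k" "coord z b = lam k" using mult_ge_2[OF k2 kq(1)] by blast
    have neq: "w *v k \<noteq> k" using fits_fixed(2)[OF fits kq(5) _ b(1,3)] b(2) by blast
    define i where "i = transpose w *v k"
    have i: "i \<in> signed_basis" "w *v i = k" using w(1) kq by (auto simp: i_def weyl_signed_basis weyl_transpose)
    have "opens w i" using fits_opens[OF fits i(1)] i zk kq by simp
    then show ?thesis using opens_imp_no_return[OF w(1,2) i _ neq] neq by blast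
  next
    case True
    then have all0: "\<forall>x\<in>P. mult z x = 0" using m by auto
    have neq: "w *v k \<noteq> k" using nofix True kP by blast
    moreover have "S (w *v k) k \<noteq> 1"
    proof
      assume *: "S (w *v k) k = 1"
      then have c: "w *v k \<in> circ" using S_basis(2)[OF weyl_signed_basis[OF w(1) kq(1)] kq(1)] by simp
      then have wkP: "w *v k \<in> P"
        using fixes_off_invariant[OF w(1,3) _ P, of k] kP eta_notin_circ by metis
      then have "\<not> opens w k" using fits_opens[OF fits kq(1) c] notlab all0 by blast
      then have "S k (w *v k) = 1 \<or> w *v k = - k" by (auto simp: opens_def)
      then show False using * S_skew[of k "w *v k"] by auto
    qed
    ultimately show ?thesis by blast
  qed
  moreover have "\<not> opens w i" if "i \<in> signed_basis" "w *v i = q" for i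
    using fits_opens[OF fits that(1)] that kq notlab[OF qm kP(2)] by simp
  ultimately show "w *v k = q" using nc_maps_to_next[OF P adj w] by blast
  show "coord z k = (if mult z k = 0 then 0 else lam k)"
  proof (cases "mult z k = 0")
    case True
    then have all0: "\<forall>x\<in>P. mult z x = 0" using m by auto
    have "coord z k = 0"
    proof (rule ccontr)
      assume "coord z k \<noteq> 0"
      then obtain a where a: "a \<in> circ" "coord z k = lam a" "coord z a = lam a" using fits_label[OF fits kq(1)] by blast
      have "a \<notin> P" using notlab all0 a by blast
      then have "k = a" using fits_fixed(2)[OF fits a(1) _ kq(1) a(2)] w(3) a(1) by (auto simp: fixes_off_def)
      then show False using \<open>a \<notin> P\<close> kP by simp
    qed
    then show ?thesis using True by simp
  qed (use label in simp)
qed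

text \<open>Corrects \<open>g\<close> by an element stabilizing the image point. If
  \<open>g *v q\<close> is off the line of \<open>q\<close>, both carry the value \<open>v\<close>
  and can be exchanged. If it is - q, then v = 0, and the sign change is paired with one on
  \<open>k\<close>, where the point vanishes too.\<close>

lemma move_stabilizing:
  fixes g :: "real^'n^'n"
  assumes g: "g \<in> weyl_group_D" and q: "q \<in> signed_basis" and k: "k \<in> signed_basis" "q \<noteq> k" "q \<noteq> - k"
    and eq: "coord z q = v" "coord (complexify g *v z) q = v" "v = 0 \<Longrightarrow> coord (complexify g *v z) k = 0"
  shows "\<exists>g'. g' \<in> weyl_group_D \<and> complexify g' *v z = complexify g *v z \<and> g' *v q = q"
proof -
  let ?z = "complexify g *v z" and ?b = "g *v q"
  have b: "?b \<in> signed_basis" using weyl_signed_basis[OF g q] .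
  have zb: "coord ?z ?b = v" using coord_complexify_mult_vec[OF g] eq by simp
  have fix_z: "complexify s *v ?z = ?z" if s: "s \<in> weyl_group_D" "\<And>a. a \<in> signed_basis \<Longrightarrow> coord ?z (s *v a) = coord ?z a" for s
  proof (rule coord_ext)
    fix a :: "real^'n" assume a: "a \<in> signed_basis"
    have "coord (complexify s *v ?z) a = coord ?z (transpose s *v a)" by (rule coord_complexify)
    also have "\<dots> = coord ?z (s *v (transpose s *v a))"
      using s(2)[of "transpose s *v a"] a s(1) by (simp add: weyl_signed_basis weyl_transpose)
    also have "\<dots> = coord ?z a" using s(1) by simp
    finally show "coord (complexify s *v ?z) a = coord ?z a" .
  qed
  have compose: ?thesis if "s \<in> weyl_group_D" "complexify s *v ?z = ?z" "s *v ?b = q" for s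
    using that weyl_mult[OF that(1) g]
    by (intro exI[of _ "s ** g"]) (simp add: complexify_mult matrix_vector_mul_assoc[symmetric])
  consider "?b = q" | "?b = - q" | "?b \<noteq> q" "?b \<noteq> - q" by blast
  then show ?thesis
  proof cases
    case 1 then show ?thesis using g by blast
  next
    case 2
    then have "v = - v" using zb eq by simp
    then have v: "v = 0" by (simp add: equal_neg_zero)
    let ?s = "neg2 q k"
    have "complexify ?s *v ?z = ?z"
    proof (rule fix_z[OF neg2_in_weyl[OF q k]])
      fix a :: "real^'n" assume a: "a \<in> signed_basis"
      have zz: "coord ?z q = 0" "coord ?z k = 0" using v eq by auto
      show "coord ?z (?s *v a) = coord ?z a"
      proof (cases "a = q \<or> a = - q \<or> a = k \<or> a = - k")
        case True
        then show ?thesis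
          using neg2_left[OF q k] neg2_right[OF q k] zz by (auto simp: matrix_vector_mult_uminus)
      next
        case False then show ?thesis using neg2_other[OF q k a] by simp
      qed
    qed
    then show ?thesis
      using compose[OF neg2_in_weyl[OF q k]] 2 neg2_left[OF q k] by (simp add: matrix_vector_mult_uminus)
  next
    case 3
    let ?s = "reflection_along (?b - q)"
    have "complexify ?s *v ?z = ?z"
    proof (rule fix_z[OF swap_in_weyl[OF b q 3]])
      fix a :: "real^'n" assume a: "a \<in> signed_basis"
      show "coord ?z (?s *v a) = coord ?z a"
      proof (cases "a = q \<or> a = - q \<or> a = ?b \<or> a = - ?b")
        case True
        have "?s *v ?b = q" "?s *v q = ?b" using swap_left[OF b q 3] swap_right[OF b q 3] .
        then show ?thesis using True zb eq by (elim disjE) (simp_all add: matrix_vector_mult_uminus)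
      next
        case False then show ?thesis using swap_other[OF b q 3 a] by simp
      qed
    qed
    then show ?thesis using compose[OF swap_in_weyl[OF b q 3]] swap_left[OF b q 3] by simp
  qed
qed

text \<open>The number of zeros, counted on signed vectors, is an orbit invariant that separates the
  base cases up to the sign of \<eta>.\<close>

lemma card_zeros_base:
  assumes k: "k \<in> circ" and y: "y = \<eta> \<or> y = - \<eta>"
  shows "card {b \<in> signed_basis. coord zeta b = 0} = 2"
    and "card {b \<in> signed_basis. coord (upd zeta k 0) b = 0} = 4"
    and "card {b \<in> signed_basis. coord (upd zeta y (lam k)) b = 0} = 0"
proof -
  note ky = ky[OF k y]
  have eta: "- \<eta> \<noteq> \<eta>" "k \<noteq> - k" using signed_basis_neq_uminus[OF eta_basis] signed_basis_neq_uminus[OF ky(1)] by metis+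
  have ke: "k \<noteq> \<eta>" "k \<noteq> - \<eta>" "- k \<noteq> \<eta>" "- k \<noteq> - \<eta>" using k circ_uminus eta_notin_circ by metis+
  have "{b \<in> signed_basis. coord zeta b = 0} = {\<eta>, - \<eta>}"
    using lam_nonzero by (auto simp: basis_cases)
  then show "card {b \<in> signed_basis. coord zeta b = 0} = 2" using eta by auto
  have "k \<bullet> \<eta> = 0" using k by (auto simp: circ_def)
  then have e0: "coord (upd zeta k 0) \<eta> = 0" by (simp add: coord_upd)
  have "coord (upd zeta k 0) b \<noteq> 0" if "b \<in> circ" "b \<noteq> k" "b \<noteq> - k" for b
    using coord_upd_other[OF ky(1) circ_basis that(2,3)] that lam_nonzero by simp
  then have "{b \<in> signed_basis. coord (upd zeta k 0) b = 0} = {k, - k, \<eta>, - \<eta>}"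
    using e0 ky(1) by (auto simp: basis_cases)
  then show "card {b \<in> signed_basis. coord (upd zeta k 0) b = 0} = 4"
    using eta ke by (simp add: card_insert_if)
  have "coord (upd zeta y (lam k)) b \<noteq> 0" if "b \<in> circ" for b
    using coord_upd_other[OF ky(2) circ_basis[OF that]] that lam_nonzero ky(5) circ_uminus by metis
  moreover have "coord (upd zeta y (lam k)) y = lam k" using ky by simp
  then have "coord (upd zeta y (lam k)) \<eta> \<noteq> 0" using y lam_nonzero[OF k] by auto
  ultimately have "{b \<in> signed_basis. coord (upd zeta y (lam k)) b = 0} = {}"
    by (auto simp: basis_cases)
  then show "card {b \<in> signed_basis. coord (upd zeta y (lam k)) b = 0} = 0" by simp
qed

text \<open>The multiplicities are common to both points, so \<open>w\<close> and \<open>w'\<close>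
  have the same fixed vector or the same shortest chord. After correcting \<open>g\<close> to fix
  \<open>q\<close>, the chord is cut from both elements with one and the same transporting
  element.\<close>

lemma fits_orbit_unique:
  assumes "sym_circ P" "w \<in> weyl_group_D" "nc w" "fixes_off P w" "fits w z"
    and "w' \<in> weyl_group_D" "nc w'" "fixes_off P w'" "fits w' (complexify g *v z)" "g \<in> weyl_group_D"
  shows "w = w'"
  using assms
proof (induction "card P" arbitrary: P w w' z g rule: less_induct)
  case less
  note P = less.prems(1) and w = less.prems(2-4) and z = less.prems(5) and w' = less.prems(6-8)
    and z' = less.prems(9) and g = less.prems(10)
  let ?z = "complexify g *v z"
  show ?case
  proof (cases "\<exists>k1\<in>P. \<exists>k2\<in>P. k2 \<noteq> k1 \<and> k2 \<noteq> - k1")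
    case False
    then obtain k where k: "k \<in> circ" "P \<subseteq> {k, - k}" using small_sym_circ[OF P] by blast
    define Z where "Z z = card {b \<in> signed_basis. coord z b = 0}" for z :: "complex^'n"
    have ZZ: "Z ?z = Z z" using card_coord_weyl[OF g] by (simp only: Z_def)
    have cases: "(w = mat 1 \<and> Z z = 2) \<or> (w = neg2 k \<eta> \<and> Z z = 4) \<or>
        (\<exists>y. (y = \<eta> \<or> y = - \<eta>) \<and> w = reflection_along (k - y) \<and> z = upd zeta y (lam k) \<and> Z z = 0)"
      if w: "w \<in> weyl_group_D" "fixes_off P w" "fits w z" for w z
    proof -
      note u = fits_unique[OF w(1) w(3)]
      consider "w = mat 1" | "w = neg2 k \<eta>" | y where "y = \<eta> \<or> y = - \<eta>" "w = reflection_along (k - y)"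
        using weyl_supported_on_line[OF w(1) k(1) fixes_off_mono[OF w(2) k(2)]] by blast
      then show ?thesis
      proof cases
        case 1
        then have "z = zeta" using u fits_id by blast
        then show ?thesis using 1 card_zeros_base(1)[OF k(1), of \<eta>] by (simp add: Z_def)
      next
        case 2
        then have "z = upd zeta k 0" using u fits_neg2_eta[OF k(1), of \<eta>] by blast
        then show ?thesis using 2 card_zeros_base(2)[OF k(1), of \<eta>] by (simp add: Z_def)
      next
        case 3
        then have "z = upd zeta y (lam k)" using u fits_reflection_eta[OF k(1) 3(1)] by blast
        moreover from this have "Z z = 0" using card_zeros_base(3)[OF k(1) 3(1)] by (simp only: Z_def)
        ultimately show ?thesis using 3 by blast
      qed
    qed
    note cw = cases[OF w(1,3) z] and cw' = cases[OF w'(1,3) z', unfolded ZZ]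
    have "Z z = 2 \<or> Z z = 4 \<or> Z z = 0" using cw by (elim disjE exE conjE) simp_all
    then show ?thesis
    proof (elim disjE)
      assume "Z z = 2" then show ?thesis using cw cw' by simp
    next
      assume "Z z = 4" then show ?thesis using cw cw' by simp
    next
      assume 3: "Z z = 0"
      obtain y where y: "y = \<eta> \<or> y = - \<eta>" "w = reflection_along (k - y)" "z = upd zeta y (lam k)"
        using cw 3 by force
      obtain y' where y': "y' = \<eta> \<or> y' = - \<eta>" "w' = reflection_along (k - y')" "?z = upd zeta y' (lam k)"
        using cw' 3 by force
      have yb: "y \<in> signed_basis" using y(1) by auto
      show ?thesis
      proof (cases "y = y'")
        case False
        \<comment> \<open>The two points differ only in the sign at \<eta>, and neither has a zero
          coordinate, so no element of the group relates them.\<close>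
        have "y' = - y" using y(1) y'(1) False by auto
        then have "?z = upd z y (- coord z y)"
          using y'(3) y(3) yb by (intro coord_ext) (simp add: coord_upd algebra_simps)
        then obtain b where "b \<in> signed_basis" "coord z b = 0" using weyl_flip_imp_zero[OF g yb] by blast
        then have "Z z \<noteq> 0" by (auto simp: Z_def)
        then show ?thesis using 3 by simp
      qed (use y y' in simp)
    qed
  next
    case True
    then obtain k1 k2 where k12: "k1 \<in> P" "k2 \<in> P" "k2 \<noteq> k1" "k2 \<noteq> - k1" by blast
    have off: "mult z d = 1" if "d \<in> circ - P" for d
      unfolding mult_eq_1 using fits_fixed[OF z, of d] that w(3) circ_basis by (auto simp: fixes_off_def)
    consider k where "k \<in> P" "mult z k = 1"
      | k q where "adj P k q" "mult z k \<ge> 2 \<and> mult z q = 0 \<or> (\<forall>x\<in>P. mult z x = 0)"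
    proof -
      have "\<exists>k q. adj P k q"
      proof -
        have "k1 \<noteq> - k2" using k12 by (metis minus_minus)
        then have "S k1 k2 = 1 \<or> S k1 (- k2) = 1" using S_circ[of k1 k2] k12 sym_circD(1)[OF P] by auto
        moreover have "- k2 \<in> P" using k12 P by (simp add: sym_circ_def)
        ultimately show ?thesis
          using adj_exists[OF P k12(1,2), of "\<lambda>_ _. True"] adj_exists[OF P k12(1), of "- k2" "\<lambda>_ _. True"] by blast
      qed
      then show ?thesis using mult_cases[OF fits_valued[OF z] P off k12] that by blast
    qed
    then show ?thesis
    proof cases
      case 1
      then have "w *v k = k" "w' *v k = k"
        using fits_mult_1[OF w(1) z] fits_mult_1[OF w'(1) z'] sym_circD(1)[OF P] mult_weyl[OF g] by auto
      then show ?thesis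
        using less.hyps[OF card_diff_less[OF P 1(1)] sym_circ_diff[OF P] w(1,2) fixes_off_diff[OF w(3)] z
            w'(1,2) fixes_off_diff[OF w'(3)] z' g] by blast
    next
      case 2
      note adj = 2(1)
      note kq = swap_adj[OF P adj]
      have qP: "q \<in> P" using adj by (simp add: adj_def)
      note f = fits_chord[OF P adj w z 2(2)]
      note f' = fits_chord[OF P adj w' z', unfolded mult_weyl[OF g], OF 2(2)]
      have zq: "coord z q = coord z k" "coord ?z q = coord ?z k"
        using fits_invariant[OF z kq(1)] fits_invariant[OF z' kq(1)] f(1) f'(1) by auto
      have "coord ?z q = coord z q" unfolding zq f(2) f'(2) ..
      then obtain g' where g': "g' \<in> weyl_group_D" "complexify g' *v z = ?z" "g' *v q = q"
        using move_stabilizing[OF g kq(2,1), of z "coord z q"] kq(3,4) zq by (metis minus_minus)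
      let ?t = "reflection_along (k - q)"
      note v = mult_swap_short_chord[OF P adj w f(1)]
      note v' = mult_swap_short_chord[OF P adj w' f'(1)]
      have fv: "fits (w ** ?t) (upd z q (lam q))" using fits_mult_swap_short_chord[OF P adj w f(1) z] .
      have fv': "fits (w' ** ?t) (complexify g' *v upd z q (lam q))"
        using fits_mult_swap_short_chord[OF P adj w' f'(1) z'] complexify_upd[OF g'(1) kq(2)] g' by simp
      have "w ** ?t = w' ** ?t"
        using less.hyps[OF card_diff_less[OF P qP] sym_circ_diff[OF P] v(1-3) fv v'(1-3) fv' g'(1)] .
      then show ?thesis using v(5) v'(5) by metis
    qed
  qed
qed

subsection \<open>Stabilizers and rotation\<close>

text \<open>A stabilizing \<open>g\<close> permutes vectors of equal value. For nonzero values these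
  are in one block. Zeros give 0 on all fixed vectors if some cycle vector vanishes; if only \<eta>
  does, parity keeps \<open>g\<close> from reversing it.\<close>

lemma fits_stabilizer:
  assumes w: "w \<in> weyl_group_D" and fits: "fits w z" and g: "g \<in> weyl_group_D"
  shows "complexify g *v z = z \<longleftrightarrow> (\<forall>x. w *v x = x \<longrightarrow> g *v x = x)"
proof
  assume *: "\<forall>x. w *v x = x \<longrightarrow> g *v x = x"
  show "complexify g *v z = z"
  proof (rule coord_ext)
    fix a :: "real^'n"
    have "x \<bullet> (transpose g *v a) = x \<bullet> a" if "w *v x = x" for x
      using * that inner_transpose[of g a x] by (simp add: inner_commute)
    then show "coord (complexify g *v z) a = coord z a"
      unfolding coord_complexify using fits_same_block[OF w fits] by blast
  qed
next
  assume gz: "complexify g *v z = z"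
  have inv: "coord z (g *v a) = coord z a" for a using coord_complexify_mult_vec[OF g, of z a] gz by simp
  show "\<forall>x. w *v x = x \<longrightarrow> g *v x = x"
  proof (intro allI impI)
    fix x assume x: "w *v x = x"
    have key: "x \<bullet> (g *v a) = x \<bullet> a" if a: "a \<in> signed_basis" for a
    proof (cases "coord z a = 0")
      case False
      then show ?thesis using fits_block[OF fits weyl_signed_basis[OF g a] a _ _ x] inv by simp
    next
      case True
      have ga: "g *v a \<in> signed_basis" "coord z (g *v a) = 0" using weyl_signed_basis[OF g a] True inv by auto
      show ?thesis
      proof (cases "\<exists>d\<in>circ. coord z d = 0")
        case True
        then have "x \<bullet> \<eta> = 0" using fits_zero[OF fits _ _ x] by blast
        then have "x \<bullet> b = 0" if "b \<in> signed_basis" "coord z b = 0" for b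
          using that fits_zero[OF fits _ _ x, of b] by (auto simp: basis_cases)
        then show ?thesis using a ga \<open>coord z a = 0\<close> by simp
      next
        case False
        then have eta: "a = \<eta> \<or> a = - \<eta>" "g *v a = \<eta> \<or> g *v a = - \<eta>"
          using a ga \<open>coord z a = 0\<close> by (auto simp: basis_cases)
        have "g *v a \<noteq> - a"
        proof
          assume neg: "g *v a = - a"
          \<comment> \<open>Filling the only zero with 1 leaves a point without zeros on which
            \<open>g\<close> changes exactly one sign.\<close>
          let ?u = "upd z a 1"
          have "complexify g *v ?u = upd z (- a) 1" using complexify_upd[OF g a] neg gz by simp
          also have "\<dots> = upd ?u a (- coord ?u a)"
            using a True by (intro coord_ext) (simp add: coord_upd)
          finally obtain b where b: "b \<in> signed_basis" "coord ?u b = 0" using weyl_flip_imp_zero[OF g a] by blast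
          have "b \<noteq> a" "b \<noteq> - a" using b a by auto
          then have "b \<in> circ" "coord z b = 0" using b coord_upd_other[OF a b(1)] eta by (auto simp: basis_cases)
          then show False using False by blast
        qed
        then have "g *v a = a" using eta by auto
        then show ?thesis by simp
      qed
    qed
    show "g *v x = x"
    proof (rule signed_basis_ext)
      fix b :: "real^'n" assume b: "b \<in> signed_basis"
      let ?a = "transpose g *v b"
      have a: "?a \<in> signed_basis" "g *v ?a = b" using b g by (auto simp: weyl_signed_basis weyl_transpose)
      have "(g *v x) \<bullet> b = x \<bullet> ?a" using inner_transpose[of g b x] by (simp add: inner_commute)
      also have "\<dots> = x \<bullet> b" using key[OF a(1)] a(2) by simp
      finally show "(g *v x) \<bullet> b = x \<bullet> b" .
    qed
  qed
qed

text \<open>Advancing the cycle by one step multiplies every label by exp (pi i / N), and all other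
  data in \<open>fits\<close> are invariant under \<open>c\<close>.\<close>

lemma fits_rotate:
  assumes w: "w \<in> weyl_group_D" and fits: "fits w z"
  shows "fits (c ** w ** transpose c) (cis (pi / of_int N) *s (complexify c *v z))"
proof -
  let ?w = "c ** w ** transpose c" and ?z = "cis (pi / of_int N) *s (complexify c *v z)"
  have wc: "?w *v (c *v a) = c *v (w *v a)" for a
    using c_weyl by (simp add: matrix_vector_mul_assoc[symmetric])
  have zc: "coord ?z (c *v a) = cis (pi / of_int N) * coord z a" for a
    using coord_complexify_mult_vec[OF c_weyl] by (simp add: coord_smult)
  have lc: "lam (c *v a) = cis (pi / of_int N) * lam a" if "a \<in> circ" for a
    using lam_c circ_basis that by blast
  have nz: "cis (pi / of_int N) \<noteq> 0" by simp
  have onto: "\<exists>a'\<in>signed_basis. a = c *v a'" if "a \<in> signed_basis" for a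
    using that c_weyl by (intro bexI[of _ "transpose c *v a"]) (auto simp: weyl_signed_basis weyl_transpose)
  have onto_circ: "\<exists>a'\<in>circ. a = c *v a'" if "a \<in> circ" for a
    using onto[of a] that circ_basis c_circ by auto
  have fixed: "w *v (transpose c *v x) = transpose c *v x" if "?w *v x = x" for x
  proof -
    have "c *v (w *v (transpose c *v x)) = x" using that by (simp add: matrix_vector_mul_assoc[symmetric])
    then show ?thesis by (metis weyl_transpose_mult_vec(1)[OF c_weyl])
  qed
  have inner: "x \<bullet> (c *v a) = (transpose c *v x) \<bullet> a" for x a
    by (metis inner_transpose)
  have wb: "w *v a \<in> signed_basis" if "a \<in> signed_basis" for a using weyl_signed_basis[OF w that] .
  have opens_c: "opens ?w (c *v i) \<longleftrightarrow> opens w i" for i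
  proof -
    have "c *v (w *v i) = - (c *v i) \<longleftrightarrow> w *v i = - i"
      using weyl_inj[OF c_weyl, of "w *v i" "- i"] by (simp add: matrix_vector_mult_uminus)
    then show ?thesis by (simp add: opens_def wc)
  qed
  show ?thesis
    unfolding fits_def
  proof (intro conjI ballI impI allI)
    fix a :: "real^'n" assume "a \<in> signed_basis"
    then obtain a' where "a' \<in> signed_basis" "a = c *v a'" using onto by blast
    then show "coord ?z (?w *v a) = coord ?z a" using fits_invariant[OF fits] by (simp only: wc zc)
  next
    fix i :: "real^'n" assume i: "i \<in> signed_basis" "?w *v i \<in> circ"
    obtain i' where i': "i' \<in> signed_basis" "i = c *v i'" using onto[OF i(1)] by blast
    then have wi: "w *v i' \<in> circ" using i(2) by (simp only: wc c_circ)
    show "coord ?z (?w *v i) = lam (?w *v i) \<longleftrightarrow> opens ?w i"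
      unfolding i'(2) wc zc lc[OF wi] opens_c using fits_opens[OF fits i'(1) wi] nz by simp
  next
    fix b :: "real^'n" assume b: "b \<in> signed_basis" "coord ?z b \<noteq> 0"
    obtain b' where b': "b' \<in> signed_basis" "b = c *v b'" using onto[OF b(1)] by blast
    then have "coord z b' \<noteq> 0" using b(2) zc by simp
    then obtain a where a: "a \<in> circ" "coord z b' = lam a" "coord z a = lam a" using fits_label[OF fits b'(1)] by blast
    then show "\<exists>a\<in>circ. coord ?z b = lam a \<and> coord ?z a = lam a"
      unfolding b'(2) by (intro bexI[of _ "c *v a"]) (simp_all only: zc lc c_circ)
  next
    fix a b x :: "real^'n"
    assume ab: "a \<in> signed_basis" "b \<in> signed_basis" "coord ?z a = coord ?z b \<and> coord ?z a \<noteq> 0"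
      and x: "?w *v x = x"
    obtain a' b' where a': "a' \<in> signed_basis" "a = c *v a'" and b': "b' \<in> signed_basis" "b = c *v b'"
      using onto[OF ab(1)] onto[OF ab(2)] by blast
    have "coord z a' = coord z b'" "coord z a' \<noteq> 0" using ab(3) unfolding a'(2) b'(2) zc using nz by auto
    then show "x \<bullet> a = x \<bullet> b"
      unfolding a'(2) b'(2) inner using fits_block[OF fits a'(1) b'(1) _ _ fixed[OF x]] by blast
  next
    fix a x :: "real^'n" assume a: "a \<in> circ" "coord ?z a = 0" and x: "?w *v x = x"
    obtain a' where a': "a' \<in> circ" "a = c *v a'" using onto_circ[OF a(1)] by blast
    have "coord z a' = 0" using a(2) unfolding a'(2) zc using nz by simp
    then have "(transpose c *v x) \<bullet> a' = 0 \<and> (transpose c *v x) \<bullet> \<eta> = 0"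
      using fits_zero[OF fits a'(1) _ fixed[OF x]] by blast
    then show "x \<bullet> a = 0" "x \<bullet> \<eta> = 0"
      unfolding a'(2) inner using inner[of x \<eta>] by (auto simp: c_eta)
  qed
qed

end

section \<open>Powers of the coordinates as a system of parameters\<close>

abbreviation var_power :: "nat \<Rightarrow> 'n \<Rightarrow> 'n cpoly" where
  "var_power d i \<equiv> Poly_Mapping.single (Poly_Mapping.single i d) 1"

lemma poly_mapping_eq_sum_single:
  "p = (\<Sum>m\<in>Poly_Mapping.keys p. Poly_Mapping.single m (Poly_Mapping.lookup p m))"
proof (rule poly_mapping_eqI)
  fix k
  show "Poly_Mapping.lookup p k =
      Poly_Mapping.lookup (\<Sum>m\<in>Poly_Mapping.keys p. Poly_Mapping.single m (Poly_Mapping.lookup p m)) k"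
    by (cases "k \<in> Poly_Mapping.keys p")
      (simp_all add: lookup_sum lookup_single when_def in_keys_iff)
qed

lemma const_poly_mult_single: "const_poly a * Poly_Mapping.single m b = Poly_Mapping.single m (a * b)"
  by (simp add: const_poly_def mult_single)

lemma const_poly_simps:
  "const_poly 0 = 0" "const_poly 1 = 1" "const_poly (a + b) = const_poly a + const_poly b"
  "const_poly (a * b) = const_poly a * const_poly b" "const_poly (a ^ k) = const_poly a ^ k"
proof -
  show *: "const_poly (a * b) = const_poly a * const_poly b" for a b by (simp add: const_poly_def mult_single)
  show one: "const_poly 1 = 1" by (simp add: const_poly_def)
  show "const_poly (a ^ k) = const_poly a ^ k" by (induction k) (simp_all add: * one)
qed (simp_all add: const_poly_def single_add)

lemma var_power_add: "var_power (d + e) i = var_power d i * var_power e i"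
  by (simp add: mult_single single_add)

lemma var_power_eq: "var_power d i = var_poly i ^ d"
proof (induction d)
  case (Suc d)
  then show ?case using var_power_add[where d = 1 and e = d and i = i] by (simp add: var_poly_def)
qed simp

lemma homogeneous_var_power: "homogeneous_of_degree d (var_power d (i :: 'n::finite))"
  by (simp add: homogeneous_of_degree_def lookup_single when_def)

lemma gen_ideal_add: "p \<in> gen_ideal \<theta> \<Longrightarrow> q \<in> gen_ideal \<theta> \<Longrightarrow> p + q \<in> gen_ideal \<theta>"
proof -
  assume "p \<in> gen_ideal \<theta>" "q \<in> gen_ideal \<theta>"
  then obtain a b where "p = (\<Sum>i\<in>UNIV. a i * \<theta> i)" "q = (\<Sum>i\<in>UNIV. b i * \<theta> i)"
    unfolding gen_ideal_def by blast
  then have "p + q = (\<Sum>i\<in>UNIV. (a i + b i) * \<theta> i)" by (simp add: distrib_right sum.distrib)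
  then show ?thesis unfolding gen_ideal_def mem_Collect_eq by (rule exI[of _ "\<lambda>i. a i + b i"])
qed

lemma gen_ideal_mult_generator: "q * \<theta> i \<in> gen_ideal \<theta>"
proof -
  have "q * \<theta> i = (\<Sum>j\<in>UNIV. (if j = i then q else 0) * \<theta> j)"
    by (simp add: if_distrib[where f = "\<lambda>x. x * _"] cong: if_cong)
  then show ?thesis unfolding gen_ideal_def mem_Collect_eq
    by (rule exI[of _ "\<lambda>j. if j = i then q else 0"])
qed

lemma zero_in_gen_ideal: "0 \<in> gen_ideal \<theta>"
  using gen_ideal_mult_generator[of 0] by simp

lemma finite_bounded_exponents:
  "finite {m :: 'n::finite \<Rightarrow>\<^sub>0 nat. \<forall>i. Poly_Mapping.lookup m i < d}" (is "finite ?M")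
proof (rule finite_imageD)
  show "inj_on Poly_Mapping.lookup ?M" by (simp add: inj_on_def)
  have "Poly_Mapping.lookup ` ?M \<subseteq> PiE UNIV (\<lambda>_. {..<d})" by auto
  then show "finite (Poly_Mapping.lookup ` ?M)" by (rule finite_subset) (simp add: finite_PiE)
qed

text \<open>Modulo the ideal only monomials with all exponents below \<open>d\<close> remain; any
  other monomial is a multiple of a generator.\<close>

lemma hsop_var_power:
  assumes "0 < d" shows "hsop_of_degree d (var_power d :: 'n::finite \<Rightarrow> 'n cpoly)"
proof -
  define B :: "'n cpoly set" where
    "B = (\<lambda>m. Poly_Mapping.single m 1) ` {m. \<forall>i. Poly_Mapping.lookup m i < d}"
  have B: "finite B" by (simp add: B_def finite_bounded_exponents)
  let ?I = "gen_ideal (var_power d :: 'n \<Rightarrow> 'n cpoly)"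
  define R where "R p \<longleftrightarrow> (\<exists>a. p - (\<Sum>b\<in>B. const_poly (a b) * b) \<in> ?I)" for p
  have R0: "R p" if "p \<in> ?I" for p
    unfolding R_def by (rule exI[of _ "\<lambda>_. 0"]) (simp add: that const_poly_simps)
  have R_add: "R (p + q)" if pq: "R p" "R q" for p q
  proof -
    obtain a a' where "p - (\<Sum>b\<in>B. const_poly (a b) * b) \<in> ?I" "q - (\<Sum>b\<in>B. const_poly (a' b) * b) \<in> ?I"
      using pq unfolding R_def by blast
    from gen_ideal_add[OF this]
    have "p + q - (\<Sum>b\<in>B. const_poly (a b + a' b) * b) \<in> ?I"
      by (simp add: const_poly_simps distrib_right sum.distrib algebra_simps)
    then show ?thesis unfolding R_def by (rule exI[of _ "\<lambda>b. a b + a' b"])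
  qed
  have R_single: "R (Poly_Mapping.single m a)" for m a
  proof (cases "\<forall>i. Poly_Mapping.lookup m i < d")
    case True
    then have mB: "Poly_Mapping.single m 1 \<in> B" by (simp add: B_def)
    have "(\<Sum>b\<in>B. const_poly (if b = Poly_Mapping.single m 1 then a else 0) * b)
        = (\<Sum>b\<in>B. if b = Poly_Mapping.single m 1 then Poly_Mapping.single m a else 0)"
      by (rule sum.cong) (simp_all add: const_poly_simps const_poly_mult_single)
    also have "\<dots> = Poly_Mapping.single m a" using B mB by simp
    finally have "Poly_Mapping.single m a
        - (\<Sum>b\<in>B. const_poly (if b = Poly_Mapping.single m 1 then a else 0) * b) \<in> ?I"
      using zero_in_gen_ideal by (metis cancel_comm_monoid_add_class.diff_cancel)
    then show ?thesis unfolding R_def by (rule exI[of _ "\<lambda>b. if b = Poly_Mapping.single m 1 then a else 0"])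
  next
    case False
    then obtain i where i: "d \<le> Poly_Mapping.lookup m i" by (auto simp: not_less)
    have "m = (m - Poly_Mapping.single i d) + Poly_Mapping.single i d"
      by (rule poly_mapping_eqI) (use i in \<open>auto simp: lookup_add lookup_minus lookup_single when_def\<close>)
    then have "Poly_Mapping.single m a = Poly_Mapping.single (m - Poly_Mapping.single i d) a * var_power d i"
      by (simp add: mult_single)
    then have "Poly_Mapping.single m a \<in> ?I"
      using gen_ideal_mult_generator[of _ "var_power d" i] by metis
    then show ?thesis by (rule R0)
  qed
  have sums: "R (\<Sum>m\<in>M. Poly_Mapping.single m (a m))" if "finite M" for M a
    using that
  proof (induction M rule: finite_induct)
    case empty then show ?case by (simp add: R0 zero_in_gen_ideal)
  next
    case (insert m M) then show ?case by (simp add: R_add R_single)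
  qed
  have "R p" for p using sums[of "Poly_Mapping.keys p" "Poly_Mapping.lookup p"] by (simp flip: poly_mapping_eq_sum_single)
  then show ?thesis
    unfolding hsop_of_degree_def R_def using assms B homogeneous_var_power by blast
qed

lemma lookup_lin_comb_var_power:
  fixes a :: "complex^'n"
  assumes "0 < d"
  shows "Poly_Mapping.lookup (lin_comb (var_power d) a) (Poly_Mapping.single j d) = a $ j"
proof -
  have "(Poly_Mapping.single i d = Poly_Mapping.single j d) = (i = j)" for i :: 'n
    using assms by (metis lookup_single_eq lookup_single_not_eq less_numeral_extra(3))
  then show ?thesis
    by (simp add: lin_comb_def const_poly_mult_single lookup_sum lookup_single when_def)
qed

lemma lin_comb_var_power_inj: "0 < d \<Longrightarrow> inj (lin_comb (var_power d))"
  by (rule injI) (metis lookup_lin_comb_var_power vec_eq_iff)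

section \<open>The action on powers of the coordinates, and evaluation\<close>

lemma poly_subst_superset:
  assumes "finite A" "Poly_Mapping.keys p \<subseteq> A"
  shows "poly_subst p \<sigma> = (\<Sum>m\<in>A. const_poly (Poly_Mapping.lookup p m) *
     (\<Prod>i\<in>UNIV. \<sigma> i ^ Poly_Mapping.lookup m i))"
  unfolding poly_subst_def
  by (rule sum.mono_neutral_left) (use assms in \<open>auto simp: in_keys_iff const_poly_simps\<close>)

lemma poly_subst_add: "poly_subst (p + q) \<sigma> = poly_subst p \<sigma> + poly_subst q \<sigma>"
proof -
  let ?A = "Poly_Mapping.keys p \<union> Poly_Mapping.keys q"
  have "Poly_Mapping.keys (p + q) \<subseteq> ?A" by (rule keys_add)
  then show ?thesis
    using poly_subst_superset[of ?A] by (simp add: lookup_add const_poly_simps distrib_right sum.distrib)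
qed

lemma poly_subst_sum: "poly_subst (sum f A) \<sigma> = (\<Sum>x\<in>A. poly_subst (f x) \<sigma>)"
proof (induction A rule: infinite_finite_induct)
  case (insert x F) then show ?case by (simp add: poly_subst_add)
qed (simp_all add: poly_subst_def)

lemma poly_subst_single:
  "poly_subst (Poly_Mapping.single (Poly_Mapping.single i d) a) \<sigma> = const_poly a * \<sigma> i ^ d"
proof -
  have "(\<Prod>j\<in>UNIV. \<sigma> j ^ Poly_Mapping.lookup (Poly_Mapping.single i d) j) = \<sigma> i ^ d"
    using prod.remove[of UNIV i "\<lambda>j. \<sigma> j ^ Poly_Mapping.lookup (Poly_Mapping.single i d) j"]
    by (simp add: lookup_single when_def)
  then show ?thesis by (simp add: poly_subst_def const_poly_simps)
qed

text \<open>Odd powers preserve signs, so a signed permutation acts on the powers exactly as on the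
  coordinates.\<close>

lemma poly_act_lin_comb_var_power:
  assumes w: "transpose w = sperm \<pi> r" "w \<in> weyl_group_D" and r: "\<And>i. r i = 1 \<or> r i = -1" and d: "odd d"
  shows "poly_act w (lin_comb (var_power d) a) = (\<Sum>i\<in>UNIV. const_poly (a $ i * of_real (r i)) * var_power d (\<pi> i))"
proof -
  have \<sigma>: "(\<Sum>j\<in>UNIV. const_poly (complex_of_real (matrix_inv w $ i $ j)) * var_poly j)
      = const_poly (of_real (r i)) * var_poly (\<pi> i)" for i
  proof -
    have "(\<Sum>j\<in>UNIV. const_poly (complex_of_real (matrix_inv w $ i $ j)) * var_poly j)
      = (\<Sum>j\<in>UNIV. if j = \<pi> i then const_poly (of_real (r i)) * var_poly (\<pi> i) else 0)"
      by (rule sum.cong) (simp_all add: weyl_matrix_inv[OF w(2)] w(1) sperm_def const_poly_simps)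
    then show ?thesis by simp
  qed
  have pow: "complex_of_real (r i) ^ d = of_real (r i)" for i using r[of i] d by auto
  show ?thesis
    unfolding poly_act_def lin_comb_def \<sigma> const_poly_mult_single poly_subst_sum poly_subst_single
    by (simp add: power_mult_distrib pow const_poly_mult_single flip: const_poly_simps(5) var_power_eq)
qed

text \<open>The coefficient vector \<open>b'\<close> works for all odd degrees at once; degree 1
  identifies it with \<open>b\<close> by injectivity.\<close>

lemma admissible_var_power:
  assumes "even h" shows "admissible_hsop weyl_group_D h (var_power (h + 1) :: 'n::finite \<Rightarrow> 'n cpoly)"
proof -
  have "poly_act w (lin_comb (var_power (h + 1)) a) = lin_comb (var_power (h + 1)) b"
    if w: "w \<in> weyl_group_D" and eq: "poly_act w (lin_comb var_poly a) = lin_comb var_poly b" for w :: "real^'n^'n" and a b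
  proof -
    obtain \<pi> r where t: "transpose w = sperm \<pi> r" "bij \<pi>" "\<And>i. r i = 1 \<or> r i = -1"
      using weyl_group_DE[OF weyl_transpose[OF w]] by metis
    define b' where "b' = (\<chi> j. a $ (inv \<pi> j) * of_real (r (inv \<pi> j)))"
    have act: "poly_act w (lin_comb (var_power d) a) = lin_comb (var_power d) b'" if "odd d" for d
    proof -
      have "poly_act w (lin_comb (var_power d) a)
          = (\<Sum>i\<in>UNIV. const_poly (b' $ \<pi> i) * var_power d (\<pi> i))"
        using poly_act_lin_comb_var_power[OF t(1) w t(3) that] t(2) by (simp add: b'_def bij_is_inj)
      also have "\<dots> = lin_comb (var_power d) b'"
        unfolding lin_comb_def by (rule sum.reindex_bij_betw[OF t(2), of "\<lambda>j. const_poly (b' $ j) * var_power d j"])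
      finally show ?thesis .
    qed
    have "lin_comb (var_power 1) b' = lin_comb (var_power 1) b"
      using eq act[of 1] by (simp add: var_poly_def[abs_def])
    then have "b' = b" using injD[OF lin_comb_var_power_inj[of 1]] by simp
    then show ?thesis using act assms by simp
  qed
  then show ?thesis
    unfolding admissible_hsop_def Ball_def using hsop_var_power[of "h + 1"] lin_comb_var_power_inj[of "h + 1"]
    by (simp only: Suc_eq_plus1[symmetric] zero_less_Suc) blast
qed

lemma poly_eval_superset:
  assumes "finite A" "Poly_Mapping.keys p \<subseteq> A"
  shows "poly_eval p z = (\<Sum>m\<in>A. Poly_Mapping.lookup p m * (\<Prod>i\<in>UNIV. (z $ i) ^ Poly_Mapping.lookup m i))"
  unfolding poly_eval_def by (rule sum.mono_neutral_left) (use assms in \<open>auto simp: in_keys_iff\<close>)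

lemma poly_eval_add: "poly_eval (p + q) z = poly_eval p z + poly_eval q z"
proof -
  let ?A = "Poly_Mapping.keys p \<union> Poly_Mapping.keys q"
  have "Poly_Mapping.keys (p + q) \<subseteq> ?A" by (rule keys_add)
  then show ?thesis
    using poly_eval_superset[of ?A] by (simp add: lookup_add distrib_right sum.distrib)
qed

lemma poly_eval_diff: "poly_eval (p - q) z = poly_eval p z - poly_eval q z"
  using poly_eval_add[of "p - q" q z] by simp

lemma poly_eval_sum: "poly_eval (sum f A) z = (\<Sum>x\<in>A. poly_eval (f x) z)"
proof (induction A rule: infinite_finite_induct)
  case (insert x F) then show ?case by (simp add: poly_eval_add)
qed (simp_all add: poly_eval_def)

lemma poly_eval_single:
  "poly_eval (Poly_Mapping.single m a) z = a * (\<Prod>i\<in>UNIV. (z $ i) ^ Poly_Mapping.lookup m i)"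
  by (simp add: poly_eval_def)

lemma poly_eval_mult: "poly_eval (p * q) z = poly_eval p z * poly_eval q z"
proof -
  have single: "poly_eval (Poly_Mapping.single m a * Poly_Mapping.single k b) z
      = poly_eval (Poly_Mapping.single m a) z * poly_eval (Poly_Mapping.single k b) z" for m k a b
    by (simp add: mult_single poly_eval_single lookup_add power_add prod.distrib)
  have sums: "poly_eval ((\<Sum>m\<in>A. Poly_Mapping.single m (a m)) * (\<Sum>m\<in>B. Poly_Mapping.single m (b m))) z
      = poly_eval (\<Sum>m\<in>A. Poly_Mapping.single m (a m)) z * poly_eval (\<Sum>m\<in>B. Poly_Mapping.single m (b m)) z"
    for A B a b
    by (simp only: sum_product poly_eval_sum single)
  show ?thesis
    using sums[of "Poly_Mapping.lookup p" "Poly_Mapping.keys p" "Poly_Mapping.lookup q" "Poly_Mapping.keys q"]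
    by (simp flip: poly_mapping_eq_sum_single)
qed

lemma poly_eval_var_power: "poly_eval (var_power d i) z = (z $ i) ^ d"
  using prod.remove[of UNIV i "\<lambda>j. (z $ j) ^ Poly_Mapping.lookup (Poly_Mapping.single i d) j"]
  by (simp add: poly_eval_single lookup_single when_def)

lemma V_theta_var_power: "V_theta (var_power d) = {z :: complex^'n. \<forall>i. (z $ i) ^ d = z $ i}"
proof -
  have gen: "poly_eval (var_power d i - var_poly i) z = (z $ i) ^ d - z $ i" for i :: 'n and z
    using poly_eval_var_power[where d = 1 and i = i and z = z] by (simp add: poly_eval_diff poly_eval_var_power var_poly_def)
  show ?thesis
  proof (intro equalityI subsetI)
    fix z :: "complex^'n" assume z: "z \<in> V_theta (var_power d)"
    have "poly_eval (1 * (var_power d i - var_poly i)) z = 0" for i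
      using z gen_ideal_mult_generator[of 1 "\<lambda>i. var_power d i - var_poly i" i] unfolding V_theta_def by blast
    then show "z \<in> {z. \<forall>i. (z $ i) ^ d = z $ i}" by (simp add: gen)
  next
    fix z :: "complex^'n" assume "z \<in> {z. \<forall>i. (z $ i) ^ d = z $ i}"
    then show "z \<in> V_theta (var_power d)"
      by (auto simp: V_theta_def gen_ideal_def poly_eval_sum poly_eval_mult gen)
  qed
qed

lemma card_complex_fixed_power:
  assumes "0 < h" shows "card {x :: complex. x ^ (h + 1) = x} = h + 1"
proof -
  have "{x :: complex. x ^ (h + 1) = x} = insert 0 {x. x ^ h = 1}" using assms by auto
  moreover have "finite {x :: complex. x ^ h = 1}" "card {x :: complex. x ^ h = 1} = h"
    using assms finite_roots_unity[of h] card_roots_unity_eq[of h] by simp_all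
  moreover have "0 \<notin> {x :: complex. x ^ h = 1}" using assms by (simp add: power_0_left)
  ultimately show ?thesis by (metis Suc_eq_plus1 card_insert_disjoint)
qed

lemma card_vec_in: "card {z :: 'a^'n. \<forall>i. z $ i \<in> R} = card R ^ CARD('n)"
proof -
  have "bij_betw vec_nth {z :: 'a^'n. \<forall>i. z $ i \<in> R} (PiE UNIV (\<lambda>_. R))"
    by (rule bij_betw_byWitness[where f' = vec_lambda]) auto
  then show ?thesis using bij_betw_same_card by (fastforce simp: card_PiE)
qed

lemma card_V_theta_var_power:
  assumes "0 < h" shows "card (V_theta (var_power (h + 1)) :: (complex^'n) set) = (h + 1) ^ CARD('n)"
  using card_vec_in[of "{x :: complex. x ^ (h + 1) = x}"] card_complex_fixed_power[OF assms]
  unfolding V_theta_var_power by simp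

section \<open>Noncrossing parking functions\<close>

lemma pointwise_stabilizer_coset_eq_iff:
  assumes w: "w \<in> weyl_group_D" and w': "w' \<in> weyl_group_D"
  shows "(\<lambda>u. w ** u) ` pointwise_stabilizer weyl_group_D X = (\<lambda>u. w' ** u) ` pointwise_stabilizer weyl_group_D X
    \<longleftrightarrow> transpose w ** w' \<in> pointwise_stabilizer weyl_group_D X" (is "?L = ?R \<longleftrightarrow> ?k \<in> ?G")
proof
  assume "?L = ?R"
  moreover have "mat 1 \<in> ?G" by (simp add: pointwise_stabilizer_def mat_1_in_weyl)
  ultimately have "w' ** mat 1 \<in> ?L" by blast
  then obtain u where u: "u \<in> ?G" "w' = w ** u" by auto
  then have "?k = u" using weyl_transpose_mult[OF w] by (simp add: matrix_mul_assoc)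
  then show "?k \<in> ?G" using u(1) by simp
next
  have mult: "u ** v \<in> ?G" if "u \<in> ?G" "v \<in> ?G" for u v
    using that by (auto simp: pointwise_stabilizer_def weyl_mult matrix_vector_mul_assoc[symmetric])
  have inv: "transpose u \<in> ?G" if "u \<in> ?G" for u
  proof -
    have u: "u \<in> weyl_group_D" "\<And>x. x \<in> X \<Longrightarrow> u *v x = x" using that by (auto simp: pointwise_stabilizer_def)
    have "transpose u *v x = x" if "x \<in> X" for x
      using weyl_transpose_mult_vec(1)[OF u(1), of x] u(2)[OF that] by simp
    then show ?thesis using weyl_transpose[OF u(1)] by (simp add: pointwise_stabilizer_def)
  qed
  assume k: "?k \<in> ?G"
  have w'_eq: "w' ** u = w ** (?k ** u)" and w_eq: "w ** u = w' ** (transpose ?k ** u)" for u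
    using weyl_transpose_mult[OF w] weyl_transpose_mult[OF w']
    by (simp_all add: matrix_mul_assoc matrix_transpose_mul)
  show "?L = ?R"
  proof (intro equalityI image_subsetI)
    fix u assume u: "u \<in> ?G"
    show "w ** u \<in> ?R" unfolding w_eq using mult[OF inv[OF k] u] by blast
    show "w' ** u \<in> ?L" unfolding w'_eq using mult[OF k u] by blast
  qed
qed

lemma equiv_park_rel: "equiv (W \<times> noncrossing_flats W c) (park_rel W c)"
  by (rule equivI) (auto simp: park_rel_def refl_on_def sym_def trans_def)

lemma park_class_eq_iff:
  assumes "w \<in> weyl_group_D" "w' \<in> weyl_group_D"
    and "X \<in> noncrossing_flats weyl_group_D c" "X' \<in> noncrossing_flats weyl_group_D c"
  shows "park_class weyl_group_D c w X = park_class weyl_group_D c w' X' \<longleftrightarrow>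
    X = X' \<and> (\<forall>x\<in>X. (transpose w ** w') *v x = x)"
proof -
  have "park_class weyl_group_D c w X = park_class weyl_group_D c w' X' \<longleftrightarrow>
      ((w, X), (w', X')) \<in> park_rel weyl_group_D c"
    unfolding park_class_def by (rule eq_equiv_class_iff[OF equiv_park_rel]) (use assms in auto)
  also have "\<dots> \<longleftrightarrow> X = X' \<and> transpose w ** w' \<in> pointwise_stabilizer weyl_group_D X"
    unfolding park_rel_def using assms pointwise_stabilizer_coset_eq_iff[OF assms(1,2), of X] by blast
  finally show ?thesis
    using weyl_mult[OF weyl_transpose[OF assms(1)] assms(2)] by (simp add: pointwise_stabilizer_def)
qed

section \<open>The bijection and its equivariance\<close>

context D_frame
begin

lemma lam_power: "a \<in> circ \<Longrightarrow> lam a ^ nat (2 * N) = 1"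
proof -
  assume "a \<in> circ"
  then obtain k where "a = e k" by (auto simp: circ_def)
  then have "lam a ^ nat (2 * N) = cis (real (nat (2 * N)) * (pi * of_int k / of_int N))"
    by (simp only: lam_e Complex.DeMoivre)
  also have "real (nat (2 * N)) * (pi * of_int k / of_int N) = 2 * pi * of_int k" using N by simp
  also have "cis (2 * pi * of_int k) = 1" unfolding complex_eq_iff cis.sel by (simp add: cos_int_2pin sin_int_2pin)
  finally show ?thesis .
qed

lemma root_of_unity_eq_lam:
  assumes "x ^ nat (2 * N) = 1"
  shows "\<exists>a\<in>circ. x = lam a"
proof -
  have "0 < nat (2 * N)" using N by simp
  then have "x \<in> (\<lambda>k. cis (2 * pi * real k / real (nat (2 * N)))) ` {..<nat (2 * N)}"
    using bij_betw_imp_surj_on[OF Complex.bij_betw_roots_unity[of "nat (2 * N)"]] assms by blast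
  then obtain k where "x = cis (2 * pi * real k / real (nat (2 * N)))" by blast
  then have "x = lam (e (int k))" using N by (simp add: lam_e)
  then show ?thesis by (rule bexI) simp
qed

lemma valued_iff: "valued z \<longleftrightarrow> (\<forall>i. (z $ i) ^ (nat (2 * N) + 1) = z $ i)"
proof -
  have *: "x ^ (nat (2 * N) + 1) = x \<longleftrightarrow> x = 0 \<or> (\<exists>a\<in>circ. x = lam a)" for x
  proof -
    have "x ^ (nat (2 * N) + 1) = x \<longleftrightarrow> x = 0 \<or> x ^ nat (2 * N) = 1" by auto
    then show ?thesis using root_of_unity_eq_lam lam_power by metis
  qed
  have neg: "- x = 0 \<or> (\<exists>b\<in>circ. - x = lam b)" if "x = 0 \<or> (\<exists>b\<in>circ. x = lam b)" for x
    using that by (metis add.inverse_neutral circ_uminus coord_uminus)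
  show ?thesis unfolding *
  proof
    assume "valued z" then show "\<forall>i. z $ i = 0 \<or> (\<exists>a\<in>circ. z $ i = lam a)"
      unfolding valued_def using axis_in_signed_basis coord_axis by metis
  next
    assume z: "\<forall>i. z $ i = 0 \<or> (\<exists>a\<in>circ. z $ i = lam a)"
    show "valued z" unfolding valued_def
    proof
      fix a :: "real^'n" assume "a \<in> signed_basis"
      then obtain i where "a = axis i 1 \<or> a = - axis i 1" unfolding signed_basis_def by blast
      then have "coord z a = z $ i \<or> coord z a = - z $ i" by (metis coord_axis coord_uminus)
      then show "coord z a = 0 \<or> (\<exists>b\<in>circ. coord z a = lam b)"
      proof
        assume "coord z a = z $ i" then show ?thesis using z by simp
      next
        assume "coord z a = - z $ i" then show ?thesis using neg[OF spec[OF z, of i]] by simp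
      qed
    qed
  qed
qed

lemma sym_circ_circ: "sym_circ circ"
  by (simp add: sym_circ_def)

lemma fixes_off_circ: "fixes_off circ w"
  by (simp add: fixes_off_def)

lemma pinned_circ: "pinned circ z"
  by (simp add: pinned_def)

lemma noncrossing_flats_eq:
  "noncrossing_flats weyl_group_D c = fixed_space ` {w \<in> weyl_group_D. nc w}"
  by (auto simp: noncrossing_flats_def absolute_le_iff_nc)

text \<open>The relation z = g z_w, with \<open>g\<close> moved to the other side so that it reads
  as a statement about a fitting point.\<close>

definition represents :: "real^'n^'n \<Rightarrow> real^'n^'n \<Rightarrow> complex^'n \<Rightarrow> bool" where
  "represents g w z \<longleftrightarrow> g \<in> weyl_group_D \<and> w \<in> weyl_group_D \<and> nc w \<and> fits w (complexify (transpose g) *v z)"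

lemma complexify_transpose_mult:
  assumes "g \<in> weyl_group_D"
  shows "complexify g *v (complexify (transpose g) *v z) = z" "complexify (transpose g) *v (complexify g *v z) = z"
  using weyl_transpose_mult[OF assms] by (simp_all flip: complexify_mult)

lemma representsD:
  assumes "represents g w z"
  shows "g \<in> weyl_group_D" "w \<in> weyl_group_D" "nc w" "fits w (complexify (transpose g) *v z)"
    "fixed_space w \<in> noncrossing_flats weyl_group_D c"
  using assms by (auto simp: represents_def noncrossing_flats_eq)

lemma represents_exists:
  assumes "valued z"
  obtains g w where "represents g w z"
proof -
  obtain w g where wg: "w \<in> weyl_group_D" "nc w" "g \<in> weyl_group_D" "fits w (complexify g *v z)"
    using fits_exists_in_orbit[OF sym_circ_circ assms pinned_circ] by blast
  then have "represents (transpose g) w z" by (simp add: represents_def weyl_transpose)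
  then show thesis by (rule that)
qed

lemma represents_valued:
  assumes "represents g w z" shows "valued z"
  using valued_weyl[OF representsD(1)[OF assms] fits_valued[OF representsD(4)[OF assms]]]
  by (simp add: complexify_transpose_mult representsD(1)[OF assms])

text \<open>The element \<open>w\<close> is unique by \<open>fits_orbit_unique\<close>, and
  \<open>g\<close> is determined up to the stabilizer of the fitting point, which is the pointwise
  stabilizer of the flat. So the representations of a point form exactly one parking
  function.\<close>

lemma represents_iff:
  assumes g: "represents g w z" and g': "g' \<in> weyl_group_D"
  shows "represents g' w' z \<longleftrightarrow> w' = w \<and> (\<forall>x\<in>fixed_space w. (transpose g ** g') *v x = x)"
proof -
  note R = representsD[OF g]
  let ?y = "complexify (transpose g) *v z"
  define k where "k = transpose g' ** g"
  have k: "k \<in> weyl_group_D" "transpose k = transpose g ** g'"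
    using R(1) g' by (simp_all add: k_def weyl_mult weyl_transpose matrix_transpose_mul)
  have y': "complexify (transpose g') *v z = complexify k *v ?y"
    using complexify_transpose_mult[OF R(1)] by (simp add: k_def complexify_mult)
  have fix_k: "(\<forall>x\<in>fixed_space w. (transpose g ** g') *v x = x) \<longleftrightarrow> complexify k *v ?y = ?y"
  proof -
    have "transpose k *v x = x \<longleftrightarrow> k *v x = x" for x using weyl_transpose_mult_vec[OF k(1)] by metis
    then show ?thesis
      unfolding fits_stabilizer[OF R(2,4) k(1)] k(2)[symmetric] by (simp add: fixed_space_def)
  qed
  show ?thesis
  proof
    assume g'w': "represents g' w' z"
    then have fits': "fits w' (complexify k *v ?y)" using representsD(4) y' by metis
    have "w = w'"
      using fits_orbit_unique[OF sym_circ_circ R(2,3) fixes_off_circ R(4) representsD(2,3)[OF g'w']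
          fixes_off_circ fits' k(1)] .
    then show "w' = w \<and> (\<forall>x\<in>fixed_space w. (transpose g ** g') *v x = x)"
      using fits_unique[OF R(2) _ R(4)] fits' fix_k by blast
  next
    assume "w' = w \<and> (\<forall>x\<in>fixed_space w. (transpose g ** g') *v x = x)"
    then have "w' = w" "complexify (transpose g') *v z = ?y" using fix_k y' by simp_all
    then show "represents g' w' z" using R g' by (simp only: represents_def)
  qed
qed

definition park_map :: "complex^'n \<Rightarrow> ((real^'n^'n) \<times> (real^'n) set) set" where
  "park_map z = (SOME p. \<exists>g w. represents g w z \<and> p = park_class weyl_group_D c g (fixed_space w))"

lemma park_map_eq:
  assumes "represents g w z"
  shows "park_map z = park_class weyl_group_D c g (fixed_space w)"
  unfolding park_map_def
proof (rule some_equality)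
  show "\<exists>g' w'. represents g' w' z \<and> park_class weyl_group_D c g (fixed_space w) = park_class weyl_group_D c g' (fixed_space w')"
    using assms by blast
next
  fix p assume "\<exists>g' w'. represents g' w' z \<and> p = park_class weyl_group_D c g' (fixed_space w')"
  then obtain g' w' where g': "represents g' w' z" "p = park_class weyl_group_D c g' (fixed_space w')" by blast
  have "w' = w \<and> (\<forall>x\<in>fixed_space w. (transpose g ** g') *v x = x)"
    using represents_iff[OF assms representsD(1)[OF g'(1)]] g'(1) by blast
  then have "park_class weyl_group_D c g (fixed_space w) = park_class weyl_group_D c g' (fixed_space w')"
    using park_class_eq_iff[OF representsD(1)[OF assms] representsD(1)[OF g'(1)] representsD(5)[OF assms] representsD(5)[OF g'(1)]]
    by simp
  then show "p = park_class weyl_group_D c g (fixed_space w)" using g'(2) by simp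
qed

text \<open>Any pair naming the class of \<open>z\<close> comes from a representation of
  \<open>z\<close>; injectivity and equivariance start from such an arbitrary name.\<close>

lemma park_map_eqD:
  assumes z: "valued z" and eq: "park_map z = park_class weyl_group_D c g X"
    and g: "g \<in> weyl_group_D" and X: "X \<in> noncrossing_flats weyl_group_D c"
  obtains w where "represents g w z" "fixed_space w = X"
proof -
  obtain g0 w where R: "represents g0 w z" using represents_exists[OF z] .
  have "park_class weyl_group_D c g0 (fixed_space w) = park_class weyl_group_D c g X"
    using park_map_eq[OF R] eq by simp
  then have *: "fixed_space w = X \<and> (\<forall>x\<in>fixed_space w. (transpose g0 ** g) *v x = x)"
    using park_class_eq_iff[OF representsD(1)[OF R] g representsD(5)[OF R] X] by blast
  then have "represents g w z" using represents_iff[OF R g] by blast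
  then show thesis using that * by blast
qed

text \<open>For injectivity, the flat determines \<open>w\<close>, \<open>w\<close> determines its
  fitting point, and a common \<open>g\<close> carries that point to both \<open>z\<close> and
  \<open>z'\<close>. Surjectivity is the existence of fitting points.\<close>

lemma park_map_bij: "bij_betw park_map {z. valued z} (Park_NC weyl_group_D c)"
  unfolding bij_betw_def
proof (intro conjI inj_onI equalityI subsetI)
  fix z z' assume "z \<in> {z. valued z}" "z' \<in> {z. valued z}" and eq: "park_map z = park_map z'"
  then have z: "valued z" "valued z'" by simp_all
  obtain g w where R: "represents g w z" using represents_exists[OF z(1)] .
  obtain w' where R': "represents g w' z'" "fixed_space w' = fixed_space w"
    using park_map_eqD[OF z(2) _ representsD(1,5)[OF R]] park_map_eq[OF R] eq by metis
  have "w' = w" using nc_fixed_space_inj[OF representsD(2,3)[OF R'(1)] representsD(2,3)[OF R] R'(2)] .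
  then have "complexify (transpose g) *v z' = complexify (transpose g) *v z"
    using fits_unique[OF representsD(2,4)[OF R]] representsD(4)[OF R'(1)] by simp
  then show "z = z'" using complexify_transpose_mult(1)[OF representsD(1)[OF R]] by metis
next
  fix p assume "p \<in> park_map ` {z. valued z}"
  then obtain z where z: "valued z" "p = park_map z" by blast
  obtain g w where R: "represents g w z" using represents_exists[OF z(1)] .
  then show "p \<in> Park_NC weyl_group_D c"
    unfolding z(2) park_map_eq[OF R] park_class_def Park_NC_def
    by (intro quotientI) (use representsD[OF R] in simp)
next
  fix p assume "p \<in> Park_NC weyl_group_D c"
  then obtain g X where g: "g \<in> weyl_group_D" "X \<in> noncrossing_flats weyl_group_D c"
    "p = park_class weyl_group_D c g X"
    by (auto simp: Park_NC_def park_class_def elim: quotientE)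
  obtain w where w: "w \<in> weyl_group_D" "nc w" "X = fixed_space w" using g(2) by (auto simp: noncrossing_flats_eq)
  obtain z where "fits w z" using nc_imp_fits[OF sym_circ_circ w(1,2) fixes_off_circ] by blast
  then have R: "represents g w (complexify g *v z)"
    using g(1) w by (simp add: represents_def complexify_transpose_mult)
  show "p \<in> park_map ` {z. valued z}"
    by (rule image_eqI[of _ _ "complexify g *v z"])
      (use park_map_eq[OF R] represents_valued[OF R] in \<open>simp_all add: g(3) w(3)\<close>)
qed

lemma fits_rotate_power:
  assumes "w \<in> weyl_group_D" "nc w" "fits w z"
  shows "mat_power c d ** w ** transpose (mat_power c d) \<in> weyl_group_D"
    and "nc (mat_power c d ** w ** transpose (mat_power c d))"
    and "fits (mat_power c d ** w ** transpose (mat_power c d))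
      (cis (pi / of_int N) ^ d *s (complexify (mat_power c d) *v z))"
proof (induction d)
  case 0
  { case 1 then show ?case using assms by (simp add: mat_power_0) }
  { case 2 then show ?case using assms by (simp add: mat_power_0) }
  { case 3 then show ?case using assms by (simp add: mat_power_0) }
next
  case (Suc d)
  have eq: "mat_power c (Suc d) ** w ** transpose (mat_power c (Suc d))
      = c ** (mat_power c d ** w ** transpose (mat_power c d)) ** transpose c"
    by (simp add: mat_power_Suc matrix_transpose_mul matrix_mul_assoc)
  have eq': "cis (pi / of_int N) ^ Suc d *s (complexify (mat_power c (Suc d)) *v z)
      = cis (pi / of_int N) *s (complexify c *v (cis (pi / of_int N) ^ d *s (complexify (mat_power c d) *v z)))"
    by (simp add: mat_power_Suc complexify_mult complexify_smult vector_smult_assoc)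
  { case 1 then show ?case unfolding eq
      by (intro weyl_mult[OF weyl_mult] c_weyl weyl_transpose Suc(1)) }
  { case 2 then show ?case unfolding eq using Suc(2) by (rule nc_conj) }
  { case 3 then show ?case unfolding eq eq' using Suc(1,3) by (rule fits_rotate) }
qed

text \<open>Inserting the d-th power of \<open>c\<close> and its inverse between \<open>g\<close>
  and the fitting point splits off a rotated, rescaled point, which fits the conjugate of
  \<open>w\<close>.\<close>

lemma represents_V_act:
  assumes R: "represents g w z" and v: "v \<in> weyl_group_D"
  shows "represents (v ** g ** transpose (mat_power c d)) (mat_power c d ** w ** transpose (mat_power c d))
    (V_act (mat_order c) v d z)"
proof -
  let ?k = "mat_power c d"
  have k: "?k \<in> weyl_group_D" by (rule mat_power_weyl[OF c_weyl])
  have \<omega>: "exp (2 * of_real pi * \<i> / of_nat (mat_order c)) = cis (pi / of_int N)"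
    using N by (simp add: mat_order_c cis_conv_exp field_simps)
  have "transpose (v ** g ** transpose ?k) ** v = ?k ** transpose g"
    using weyl_transpose_mult(1)[OF v] by (simp add: matrix_transpose_mul flip: matrix_mul_assoc)
  then have "complexify (transpose (v ** g ** transpose ?k)) *v V_act (mat_order c) v d z
      = cis (pi / of_int N) ^ d *s (complexify ?k *v (complexify (transpose g) *v z))"
    unfolding V_act_def \<omega> complexify_smult by (simp flip: complexify_mult)
  then show ?thesis
    using fits_rotate_power[OF representsD(2-4)[OF R], of d] v k representsD(1)[OF R]
    unfolding represents_def by (simp add: weyl_mult weyl_transpose)
qed

lemma fixed_space_conj:
  assumes "k \<in> weyl_group_D"
  shows "fixed_space (k ** w ** transpose k) = (*v) k ` fixed_space w"
proof (intro equalityI subsetI)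
  fix x assume "x \<in> fixed_space (k ** w ** transpose k)"
  then have "k *v (w *v (transpose k *v x)) = x"
    by (simp add: fixed_space_def matrix_vector_mul_assoc[symmetric])
  then have "w *v (transpose k *v x) = transpose k *v x" by (metis assms weyl_transpose_mult_vec(1))
  then have "transpose k *v x \<in> fixed_space w" by (simp add: fixed_space_def)
  then show "x \<in> (*v) k ` fixed_space w" using weyl_transpose_mult_vec(2)[OF assms, of x] by (metis image_eqI)
next
  fix x assume "x \<in> (*v) k ` fixed_space w"
  then show "x \<in> fixed_space (k ** w ** transpose k)"
    using assms by (auto simp: fixed_space_def matrix_vector_mul_assoc[symmetric])
qed

lemma park_map_equivariant: "park_equivariant weyl_group_D c {z. valued z} park_map"
  unfolding park_equivariant_def
proof (intro ballI allI impI)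
  fix v g :: "real^'n^'n" and d z X
  assume v: "v \<in> weyl_group_D" and z: "z \<in> {z. valued z}" and g: "g \<in> weyl_group_D"
    and X: "X \<in> noncrossing_flats weyl_group_D c" and eq: "park_map z = park_class weyl_group_D c g X"
  obtain w where w: "represents g w z" "fixed_space w = X" using park_map_eqD[OF _ eq g X] z by blast
  have k: "mat_power c d \<in> weyl_group_D" by (rule mat_power_weyl[OF c_weyl])
  show "park_map (V_act (mat_order c) v d z) =
      park_class weyl_group_D c (v ** g ** matrix_inv (mat_power c d)) ((*v) (mat_power c d) ` X)"
    unfolding park_map_eq[OF represents_V_act[OF w(1) v]] fixed_space_conj[OF k] w(2) weyl_matrix_inv[OF k] ..
qed

end

theorem mainTheorem4:
  fixes c :: "real^'n^'n" and \<Delta> :: "(real^'n) set" and h :: nat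
  assumes "CARD('n) \<ge> 4"
    and "simple_system weyl_group_D \<Delta>"
    and "coxeter_element \<Delta> c"
    and "h = mat_order c"
  shows "h = 2 * (CARD('n) - 1) \<and>
    (\<exists>\<theta> :: 'n \<Rightarrow> 'n cpoly.
       admissible_hsop weyl_group_D h \<theta> \<and>
       card (V_theta \<theta>) = (h + 1) ^ CARD('n) \<and>
       (\<exists>f. bij_betw f (V_theta \<theta>) (Park_NC weyl_group_D c) \<and>
            park_equivariant weyl_group_D c (V_theta \<theta>) f))"
proof -
  define N where "N = int (CARD('n) - 1)"
  have "CARD('n) \<ge> 3" using assms(1) by simp
  from coxeter_element_D_frame[OF this assms(2,3)]
  obtain e \<eta> where "D_frame c e \<eta> N" unfolding N_def by metis
  then interpret D_frame c e \<eta> N .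
  have hN: "h = nat (2 * N)" using assms(4) mat_order_c by simp
  have h: "h = 2 * (CARD('n) - 1)" unfolding hN N_def by linarith
  have V: "V_theta (var_power (h + 1)) = {z :: complex^'n. valued z}"
    unfolding V_theta_var_power valued_iff hN ..
  have "admissible_hsop weyl_group_D h (var_power (h + 1) :: 'n \<Rightarrow> 'n cpoly)"
    by (rule admissible_var_power) (simp add: h)
  moreover have "card (V_theta (var_power (h + 1)) :: (complex^'n) set) = (h + 1) ^ CARD('n)"
    by (rule card_V_theta_var_power) (use h assms(1) in simp)
  moreover have "bij_betw park_map (V_theta (var_power (h + 1))) (Park_NC weyl_group_D c)"
    unfolding V by (rule park_map_bij)
  moreover have "park_equivariant weyl_group_D c (V_theta (var_power (h + 1))) park_map"
    unfolding V by (rule park_map_equivariant)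
  ultimately show ?thesis using h by blast
qed

end
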